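(* Let $m,n\geqslant 1$, let $p_1,\ldots,p_m\geqslant 1$ be integers with $p_1=1$, and let $\mathbf f_i:(\mathbb C^{m+n},0)\to(\mathbb C^n,0)$, $i=1,\ldots,m$, be germs of holomorphic maps in the variables $(x,y)$, $x=(x_1,\ldots,x_m)$, $y=(y_1,\ldots,y_n)^{\top}$. Let $\varphi\in\mathbb C[[x]]^n$ be a formal power series without constant term which is a formal solution of the system $$x_i^{p_i}\,\frac{\partial y}{\partial x_i}=\mathbf f_i(x,y),\qquad i=1,\ldots,m.$$ If the matrix $$A=\frac{\partial \mathbf f_1}{\partial y}(x,\varphi)\Big|_{x_1=0}\in \mathrm{Mat}(n,\mathbb C[[x_2,\ldots,x_m]])$$ is such that $\det(A-jI)\not\equiv 0$ (as an element of $\mathbb C[[x_2,\ldots,x_m]]$) for every non-negative integer $j$, then $\varphi$ converges near $0\in\mathbb C^m$.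
   Context: A formal power series solution of the system is a series $\varphi=\sum_{|k|>0}\mathbf c_k x^k\in\mathbb C[[x]]^n$, with $\mathbf c_k\in\mathbb C^n$, $k\in\mathbb Z_+^m$, $|k|=k_1+\ldots+k_m$, $x^k=x_1^{k_1}\cdots x_m^{k_m}$ (so without constant term), such that $x_i^{p_i}\,\partial\varphi/\partial x_i=\mathbf f_i(x,\varphi)$ in $\mathbb C[[x]]^n$ for all $i=1,\ldots,m$. Here $\mathbf f_i(x,\varphi)$ and $\frac{\partial\mathbf f_i}{\partial y}(x,\varphi)$ denote the formal power series obtained by substituting $y=\varphi$ into the Taylor series at the origin; $\frac{\partial\mathbf f_1}{\partial y}$ is the $n\times n$ Jacobi matrix with respect to $y$. $I$ is the identity $n\times n$ matrix. No integrability of the system is assumed. *)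

theory Defs
  imports "HOL-Analysis.Analysis"
begin

section \<open>Formal power series in finitely many variables\<close>

text \<open>
  The variables are indexed by a finite type \<open>'v\<close>; a multi-index is a vector \<open>k :: nat^'v\<close>.
\<close>

typedef ('v::finite, 'a) mfps = "UNIV :: (nat^'v \<Rightarrow> 'a) set"
  morphisms mfps_nth Abs_mfps ..

lemma mfps_nth_Abs_mfps [simp]: "mfps_nth (Abs_mfps c) k = c k"
  by (simp add: Abs_mfps_inverse)

lemma mfps_eq_iff: "F = G \<longleftrightarrow> (\<forall>k. mfps_nth F k = mfps_nth G k)"
  by (metis ext mfps_nth_inject)

lemma finite_multiindex_sum: "finite {(a, b). a + b = (k :: nat^'v::finite)}"
proof -
  let ?N = "\<Sum>i\<in>UNIV. k $ i"
  have le: "k $ i \<le> ?N" for i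
    by (rule member_le_sum) auto
  have "finite {g :: 'v \<Rightarrow> nat. \<forall>i. (i \<in> UNIV \<longrightarrow> g i \<in> {..?N}) \<and> (i \<notin> UNIV \<longrightarrow> g i = 0)}"
    by (rule finite_set_of_finite_funs) auto
  then have fin: "finite (vec_lambda ` {g :: 'v \<Rightarrow> nat. \<forall>i. g i \<le> ?N})"
    by (intro finite_imageI) simp
  have bound: "a \<in> vec_lambda ` {g. \<forall>i. g i \<le> ?N}" if "\<forall>i. a $ i \<le> k $ i" for a :: "nat^'v"
    using that le by (intro image_eqI[of _ _ "vec_nth a"]) (auto intro: order_trans)
  have "a \<in> vec_lambda ` {g. \<forall>i. g i \<le> ?N} \<and> b \<in> vec_lambda ` {g. \<forall>i. g i \<le> ?N}"
    if "a + b = k" for a b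
    using that by (intro conjI bound) auto
  then have "{(a, b). a + b = k} \<subseteq>
      vec_lambda ` {g. \<forall>i. g i \<le> ?N} \<times> vec_lambda ` {g. \<forall>i. g i \<le> ?N}"
    by blast
  then show ?thesis
    using fin by (meson finite_SigmaI finite_subset)
qed

instantiation mfps :: (finite, comm_ring_1) comm_ring_1
begin

definition "0 = Abs_mfps (\<lambda>k. 0)"
definition "1 = Abs_mfps (\<lambda>k. if k = 0 then 1 else 0)"
definition "F + G = Abs_mfps (\<lambda>k. mfps_nth F k + mfps_nth G k)"
definition "F - G = Abs_mfps (\<lambda>k. mfps_nth F k - mfps_nth G k)"
definition "- F = Abs_mfps (\<lambda>k. - mfps_nth F k)"
definition "F * G = Abs_mfps (\<lambda>k. \<Sum>(a, b) | a + b = k. mfps_nth F a * mfps_nth G b)"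

instance
proof
  fix F G H :: "('a, 'b) mfps"
  show "F * G * H = F * (G * H)"
  proof -
    have "(\<Sum>(a, b) | a + b = k.
              (\<Sum>(c, d) | c + d = a. mfps_nth F c * mfps_nth G d) * mfps_nth H b) =
          (\<Sum>(a, b) | a + b = k.
              mfps_nth F a * (\<Sum>(c, d) | c + d = b. mfps_nth G c * mfps_nth H d))" for k
      unfolding sum_distrib_left sum_distrib_right case_prod_unfold
      apply (subst sum.Sigma)
        apply (use finite_multiindex_sum in \<open>auto simp: case_prod_unfold\<close>)[2]
      apply (subst sum.Sigma)
        apply (use finite_multiindex_sum in \<open>auto simp: case_prod_unfold\<close>)[2]
      by (rule sum.reindex_bij_witness[where
            i = "\<lambda>((a, b), (c, d)). ((a + c, d), (a, c))" and
            j = "\<lambda>((a, b), (c, d)). ((c, d + b), (d, b))"]) (auto simp: algebra_simps)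
    then show ?thesis
      by (simp add: times_mfps_def mfps_eq_iff)
  qed
  show "F * G = G * F"
    unfolding times_mfps_def mfps_eq_iff mfps_nth_Abs_mfps
    by (intro allI sum.reindex_bij_witness[where i = prod.swap and j = prod.swap])
       (auto simp: algebra_simps)
  show "1 * F = F"
  proof -
    have "(\<Sum>(a, b) | a + b = k. (if a = 0 then 1 else 0) * mfps_nth F b) =
          (\<Sum>(a, b) \<in> {(0 :: nat^'a, k)}. mfps_nth F b)" for k
      by (rule sum.mono_neutral_cong_right[OF finite_multiindex_sum]) (auto split: if_splits)
    then show ?thesis
      by (simp add: times_mfps_def one_mfps_def mfps_eq_iff)
  qed
  show "(F + G) * H = F * H + G * H"
    by (simp add: times_mfps_def plus_mfps_def mfps_eq_iff algebra_simps
        case_prod_unfold sum.distrib)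
  show "(0::('a, 'b) mfps) \<noteq> 1"
    by (auto simp: zero_mfps_def one_mfps_def mfps_eq_iff intro!: exI[of _ 0])
qed (simp_all add: zero_mfps_def plus_mfps_def minus_mfps_def uminus_mfps_def mfps_eq_iff
      algebra_simps)

end

definition mfps_X :: "'v \<Rightarrow> ('v::finite, 'a::comm_ring_1) mfps" where
  "mfps_X i = Abs_mfps (\<lambda>k. if k = axis i 1 then 1 else 0)"

definition mfps_deriv :: "'v \<Rightarrow> ('v::finite, 'a::comm_ring_1) mfps \<Rightarrow> ('v, 'a) mfps" where
  "mfps_deriv i F = Abs_mfps (\<lambda>k. of_nat (k $ i + 1) * mfps_nth F (k + axis i 1))"

text \<open>
  The composite of \<open>F\<close> with series \<open>G w\<close>, i.e. \<open>\<Sum>l. F\<^sub>l \<Prod>w. G w ^ l\<^sub>w\<close>. As for \<open>fps_compose\<close>,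
  the truncation of the sum is only meaningful when every \<open>G w\<close> has zero constant term:
  then the terms with \<open>|l| > |k|\<close> do not contribute to the coefficient at \<open>k\<close>.
\<close>

definition mfps_compose ::
    "('w::finite, 'a::comm_ring_1) mfps \<Rightarrow> ('w \<Rightarrow> ('v::finite, 'a) mfps) \<Rightarrow> ('v, 'a) mfps" where
  "mfps_compose F G = Abs_mfps (\<lambda>k. \<Sum>l | (\<Sum>w\<in>UNIV. l $ w) \<le> (\<Sum>v\<in>UNIV. k $ v).
      mfps_nth F l * mfps_nth (\<Prod>w\<in>UNIV. G w ^ (l $ w)) k)"

text \<open>
  The restriction to \<open>x\<^sub>i = 0\<close>. The series not involving \<open>x\<^sub>i\<close> are kept inside the ring of
  series in all variables.
\<close>

definition mfps_restrict0 :: "'v \<Rightarrow> ('v::finite, 'a::comm_ring_1) mfps \<Rightarrow> ('v, 'a) mfps" where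
  "mfps_restrict0 i F = Abs_mfps (\<lambda>k. if k $ i = 0 then mfps_nth F k else 0)"

definition mfps_convergent :: "('v::finite, complex) mfps \<Rightarrow> bool" where
  "mfps_convergent F \<longleftrightarrow>
     (\<forall>\<^sub>F x :: complex^'v in nhds 0. (\<lambda>k. mfps_nth F k * (\<Prod>i\<in>UNIV. x $ i ^ (k $ i))) summable_on UNIV)"


section \<open>Germs of holomorphic maps at the origin and their Taylor series\<close>

text \<open>
  A germ is represented by a total function, of which only the values near the origin matter.
\<close>

definition holomorphic_near_0 :: "(complex^'v::finite \<Rightarrow> complex^'n::finite) \<Rightarrow> bool" where
  "holomorphic_near_0 f \<longleftrightarrow>
     (\<forall>\<^sub>F z in nhds 0. \<exists>L. (f has_derivative L) (at z) \<and> (\<forall>c v. L (c *s v) = c *s L v))"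

definition partial_deriv :: "'v \<Rightarrow> (complex^'v::finite \<Rightarrow> complex) \<Rightarrow> complex^'v \<Rightarrow> complex" where
  "partial_deriv i g z = deriv (\<lambda>t. g (z + axis i t)) 0"

text \<open>
  Partial derivatives of a holomorphic function commute, so the order in which the variables
  are enumerated is immaterial.
\<close>

definition mixed_partial ::
    "nat^'v::finite \<Rightarrow> (complex^'v \<Rightarrow> complex) \<Rightarrow> complex^'v \<Rightarrow> complex" where
  "mixed_partial k = foldr (\<lambda>i. partial_deriv i ^^ (k $ i)) (SOME vs. distinct vs \<and> set vs = UNIV)"

definition taylor :: "(complex^'v::finite \<Rightarrow> complex) \<Rightarrow> ('v, complex) mfps" where
  "taylor g = Abs_mfps (\<lambda>k. mixed_partial k g 0 / (\<Prod>i\<in>UNIV. fact (k $ i)))"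


section \<open>The system of differential equations\<close>

text \<open>
  The variables \<open>x\<close> are indexed by \<open>'m\<close> and the unknowns \<open>y\<close> by \<open>'n\<close>, so that \<open>(x, y)\<close> is a
  vector indexed by \<open>'m + 'n\<close>. The series \<open>g(x, \<phi>)\<close> is obtained by substituting \<open>y = \<phi>\<close> into the
  Taylor series of \<open>g\<close> at the origin.
\<close>

definition subst_y ::
    "(complex^('m::finite + 'n::finite) \<Rightarrow> complex) \<Rightarrow> ('m, complex) mfps^'n \<Rightarrow> ('m, complex) mfps"
  where
  "subst_y g \<phi> = mfps_compose (taylor g) (case_sum mfps_X (\<lambda>b. \<phi> $ b))"

definition formal_solution ::
    "('m::finite \<Rightarrow> nat) \<Rightarrow> ('m \<Rightarrow> complex^('m + 'n::finite) \<Rightarrow> complex^'n)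
      \<Rightarrow> ('m, complex) mfps^'n \<Rightarrow> bool" where
  "formal_solution p f \<phi> \<longleftrightarrow>
     (\<forall>b. mfps_nth (\<phi> $ b) 0 = 0) \<and>
     (\<forall>i b. mfps_X i ^ p i * mfps_deriv i (\<phi> $ b) = subst_y (\<lambda>z. f i z $ b) \<phi>)"

text \<open>The Jacobi matrix \<open>\<partial>f/\<partial>y\<close> along \<open>\<phi>\<close>: rows are the components of \<open>f\<close>, columns the \<open>y\<^sub>b\<close>.\<close>

definition jacobian_y ::
    "(complex^('m::finite + 'n::finite) \<Rightarrow> complex^'n) \<Rightarrow> ('m, complex) mfps^'n
      \<Rightarrow> ('m, complex) mfps^'n^'n" where
  "jacobian_y f \<phi> = (\<chi> a b. subst_y (partial_deriv (Inr b) (\<lambda>z. f z $ a)) \<phi>)"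

end

theory Submission
  imports Defs "HOL-Complex_Analysis.Cauchy_Integral_Formula"
begin

text \<open>
  Fix the index \<open>1\<close> with \<open>p\<^sub>1 = 1\<close> and let \<open>D = x\<^sub>1 \<partial>/\<partial>x\<^sub>1\<close>. With \<open>F\<close> the Taylor series of \<open>f\<^sub>1\<close>, the formal
  solution satisfies \<open>D \<phi> = F(x, \<phi>)\<close>, and this equation with the condition on the determinants forces
  convergence. On the terms of degree \<open>j\<close> in \<open>x\<^sub>1\<close> the linearized operator \<open>D - \<partial>F/\<partial>y(x, \<phi>)\<close> is, to lowest order,
  the matrix \<open>j - A\<close>. It need not be invertible over the power series ring, as \<open>det (A - j)\<close> may be a non-unit; it
  is only known to be injective.

  \<^bold>\<open>Reduction to lines.\<close> In one variable \<open>t\<close>, a non-zero power series is a power of \<open>t\<close> times a unit, so the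
  determinants can be inverted with a loss of finitely many orders. Therefore \<open>x\<close> is restricted to the curves
  \<open>x\<^sub>1 = a\<^sub>1 \<sigma> t\<^sup>N\<close>, \<open>x\<^sub>v = a\<^sub>v t\<close> for a constant vector \<open>a\<close> along which no \<open>det (A - j)\<close> vanishes identically;
  \<open>D\<close> becomes \<open>\<sigma> d/d\<sigma>\<close>. The excluded \<open>a\<close> lie in countably many zero sets of homogeneous polynomials.

  \<^bold>\<open>Convergence along a line\<close> (\<open>directional_bound\<close>). For large \<open>j\<close> the matrix \<open>j - A\<close> is invertible with bounded
  inverse. So only finitely many determinants cause a loss, and their orders in \<open>t\<close> have a common bound \<open>e\<close>. A truncation
  of \<open>\<phi>\<close> at order \<open>N = 2e + 1\<close> is a polynomial approximate solution, and the remainder satisfies an equation in which a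
  Newton step loses \<open>e\<close> orders and gains \<open>N\<close> (\<open>linear_system_estimate\<close>, \<open>nrm_compose_rem_le\<close>). Truncated weighted
  norms of the remainder are thus bounded by induction on the level of truncation.

  \<^bold>\<open>Back to all variables\<close> (\<open>coeff_bound_if_generic_bound\<close>). The homogeneous parts of \<open>\<phi>\<close> grow at most geometrically
  at each generic \<open>a\<close>, at a rate depending on \<open>a\<close>. The Baire category theorem makes the rate uniform on a ball, and
  there the maximum principle and Cauchy's estimates bound the coefficients of homogeneous polynomials.

  The analytic input is that a holomorphic germ is the sum of its Taylor series, with geometrically bounded
  coefficients (\<open>osgood\<close>).
\<close>

section \<open>Multi-indices and monomials\<close>

definition mdeg :: "nat^'v::finite \<Rightarrow> nat" where
  "mdeg k = (\<Sum>i\<in>UNIV. k $ i)"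

definition mpow :: "('v::finite \<Rightarrow> 'a::comm_monoid_mult) \<Rightarrow> nat^'v \<Rightarrow> 'a" where
  "mpow G k = (\<Prod>i\<in>UNIV. G i ^ (k $ i))"

lemma mdeg_0 [simp]: "mdeg 0 = 0"
  by (simp add: mdeg_def)

lemma mdeg_add [simp]: "mdeg (k + l) = mdeg k + mdeg l"
  by (simp add: mdeg_def sum.distrib)

lemma mdeg_axis [simp]: "mdeg (axis i n) = n"
proof -
  have "mdeg (axis i n) = (\<Sum>j\<in>UNIV. if j = i then n else 0)"
    unfolding mdeg_def by (rule sum.cong) (auto simp: axis_def)
  then show ?thesis by simp
qed

lemma le_mdeg: "k $ i \<le> mdeg k"
  unfolding mdeg_def by (rule member_le_sum) auto

lemma mdeg_eq_0_iff [simp]: "mdeg k = 0 \<longleftrightarrow> k = 0"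
  by (simp add: mdeg_def vec_eq_iff)

lemma mpow_0 [simp]: "mpow G 0 = 1"
  by (simp add: mpow_def)

lemma mpow_add: "mpow G (k + l) = mpow G k * mpow G l"
  by (simp add: mpow_def power_add prod.distrib)

lemma mpow_axis [simp]: "mpow G (axis i n) = G i ^ n"
proof -
  have "mpow G (axis i n) = (\<Prod>j\<in>UNIV. if j = i then G i ^ n else 1)"
    unfolding mpow_def by (rule prod.cong) (auto simp: axis_def)
  then show ?thesis by simp
qed

lemma mpow_const [simp]: "mpow (\<lambda>i. c) k = c ^ mdeg k"
  by (simp add: mpow_def mdeg_def power_sum)

lemma norm_mpow: "norm (mpow z k) = mpow (\<lambda>i. norm (z i :: complex)) k"
  by (simp add: mpow_def prod_norm[symmetric] norm_power)

lemma mpow_nonneg: "(\<And>i. 0 \<le> x i) \<Longrightarrow> 0 \<le> mpow x k" for x :: "_ \<Rightarrow> real"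
  by (simp add: mpow_def prod_nonneg)

lemma mpow_mono: "(\<And>i. 0 \<le> x i) \<Longrightarrow> (\<And>i. x i \<le> y i) \<Longrightarrow> mpow x k \<le> mpow y k" for x :: "_ \<Rightarrow> real"
  unfolding mpow_def by (intro prod_mono) (auto intro: power_mono)

lemma mpow_mult: "mpow (\<lambda>i. F i * G i) k = mpow F k * mpow G k"
  by (simp add: mpow_def power_mult_distrib prod.distrib)

lemma minus_axis_add:
  assumes "k $ i \<noteq> 0"
  shows "k - axis i 1 + axis i 1 = (k :: nat^'v::finite)"
  using assms by (auto simp: vec_eq_iff axis_def)

lemma multi_index_induct [case_names zero step]:
  assumes "P 0" and step: "\<And>k i. P k \<Longrightarrow> P (k + axis i 1)"
  shows "P (k :: nat^'v::finite)"
proof (induction "mdeg k" arbitrary: k)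
  case 0
  then show ?case using assms(1) by simp
next
  case (Suc n)
  have "k \<noteq> 0" using Suc.hyps(2) by auto
  then obtain i where i: "k $ i \<noteq> 0" by (auto simp: vec_eq_iff)
  have "mdeg (k - axis i 1 + axis i 1) = Suc n"
    using Suc.hyps(2) minus_axis_add[OF i] by simp
  then have "n = mdeg (k - axis i 1)" by simp
  from step[OF Suc.hyps(1)[OF this], of i] show ?case
    by (simp only: minus_axis_add[OF i])
qed

lemma bij_betw_vec_nth_box:
  "bij_betw vec_nth {k :: nat^'v::finite. \<forall>i. k $ i \<le> n} (PiE UNIV (\<lambda>_. {..n}))"
  by (rule bij_betw_byWitness[where f' = vec_lambda]) auto

lemma finite_mdeg_le [simp]: "finite {k :: nat^'v::finite. mdeg k \<le> n}"
proof -
  have "finite {k :: nat^'v. \<forall>i. k $ i \<le> n}"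
    using bij_betw_finite[OF bij_betw_vec_nth_box[where ?'v = 'v]] by (simp add: finite_PiE)
  then show ?thesis
    by (rule finite_subset[rotated]) (use le_mdeg order_trans in blast)
qed

lemma finite_mdeg_eq [simp]: "finite {k :: nat^'v::finite. mdeg k = n}"
  by (rule finite_subset[OF _ finite_mdeg_le[of n]]) auto

text \<open>
  A finite set of multi-indices lies in a box, and over a box the sum is a product of one
  geometric sum per variable.
\<close>
lemma sum_power_mdeg_le:
  fixes F :: "(nat^'v::finite) set"
  assumes x: "0 \<le> x" "x < (1::real)" and "finite F"
  shows "(\<Sum>k\<in>F. x ^ mdeg k) \<le> (1 / (1 - x)) ^ CARD('v)"
proof -
  define n where "n = Max (insert 0 (mdeg ` F))"
  have n: "mdeg k \<le> n" if "k \<in> F" for k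
    using that assms(3) by (auto simp: n_def)
  have "(\<Sum>k\<in>F. x ^ mdeg k) \<le> (\<Sum>k \<in> {k :: nat^'v. \<forall>i. k $ i \<le> n}. x ^ mdeg k)"
  proof (rule sum_mono2)
    show "finite {k :: nat^'v. \<forall>i. k $ i \<le> n}"
      using bij_betw_finite[OF bij_betw_vec_nth_box[where ?'v = 'v]] by (simp add: finite_PiE)
    show "F \<subseteq> {k :: nat^'v. \<forall>i. k $ i \<le> n}"
      using n le_mdeg order_trans by blast
  qed (use x in auto)
  also have "\<dots> = (\<Sum>k \<in> {k :: nat^'v. \<forall>i. k $ i \<le> n}. \<Prod>i\<in>UNIV. x ^ (k $ i))"
    by (simp add: mdeg_def power_sum)
  also have "\<dots> = (\<Sum>g \<in> PiE UNIV (\<lambda>_. {..n}). \<Prod>i\<in>(UNIV::'v set). x ^ (g i))"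
    by (rule sum.reindex_bij_betw[OF bij_betw_vec_nth_box])
  also have "\<dots> = (\<Prod>i\<in>(UNIV::'v set). \<Sum>m\<le>n. x ^ m)"
    by (rule prod_sum_PiE[symmetric]) auto
  also have "\<dots> \<le> (\<Prod>i\<in>(UNIV::'v set). 1 / (1 - x))"
  proof (rule prod_mono, intro conjI)
    have "(\<Sum>m\<le>n. x ^ m) \<le> (\<Sum>m. x ^ m)"
      by (rule sum_le_suminf) (use x in \<open>auto intro: summable_geometric\<close>)
    then show "(\<Sum>m\<le>n. x ^ m) \<le> 1 / (1 - x)"
      using x by (simp add: suminf_geometric)
  qed (use x in \<open>auto intro: sum_nonneg\<close>)
  finally show ?thesis by simp
qed

lemma summable_power_mdeg:
  assumes x: "0 \<le> x" "x < (1::real)"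
  shows "(\<lambda>k :: nat^'v::finite. x ^ mdeg k) summable_on UNIV"
  by (rule nonneg_bdd_above_summable_on)
     (use x sum_power_mdeg_le[OF x] in \<open>auto intro!: bdd_aboveI2\<close>)

section \<open>Power series expansions and Taylor coefficients\<close>

definition polydisc :: "real \<Rightarrow> (complex^'v::finite) set" where
  "polydisc r = {z. \<forall>i. norm (z $ i) < r}"

text \<open>
  The expansion is only required on the polydisc of radius \<open>1 / (8 * C)\<close>, well inside the polydisc of
  radius \<open>1 / C\<close> on which the coefficient bound gives convergence. The slack pays for crude estimates, and
  a partial derivative of such an expansion is again one with \<open>C\<close> replaced by \<open>2 * C\<close>.
\<close>
definition pseries :: "real \<Rightarrow> (complex^'v::finite \<Rightarrow> complex) \<Rightarrow> (nat^'v \<Rightarrow> complex) \<Rightarrow> bool" where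
  "pseries C g c \<longleftrightarrow> C > 0 \<and> (\<exists>M. \<forall>k. norm (c k) \<le> M * C ^ mdeg k) \<and>
     (\<forall>z \<in> polydisc (1 / (8 * C)). ((\<lambda>k. c k * mpow (($) z) k) has_sum g z) UNIV)"

text \<open>
  The factor \<open>2 ^ n\<close>, in place of the \<open>n\<^sup>2\<close> of the optimal bound, makes the induction trivial and only
  costs a factor in the radius when the estimate is summed over all monomials.
\<close>
lemma power_second_order:
  fixes z t :: complex
  assumes "norm z \<le> \<rho>" "norm (z + t) \<le> \<rho>" "\<rho> > 0"
  shows "norm ((z + t) ^ n - z ^ n - of_nat n * t * z ^ (n - 1)) \<le> (2 * \<rho>) ^ n * (norm t / \<rho>)\<^sup>2"
proof (induction n)
  case 0
  then show ?case by simp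
next
  case (Suc n)
  have eq: "(z + t) ^ Suc n - z ^ Suc n - of_nat (Suc n) * t * z ^ (Suc n - 1) =
     ((z + t) ^ n - z ^ n - of_nat n * t * z ^ (n - 1)) * (z + t) + of_nat n * t\<^sup>2 * z ^ (n - 1)"
    by (cases n) (simp_all add: algebra_simps power2_eq_square)
  have zp: "norm z ^ (n - 1) \<le> \<rho> ^ (n - 1)"
    by (rule power_mono) (use assms in auto)
  have n2: "real n \<le> 2 ^ n"
    using of_nat_less_two_power[of n, where 'a = real] by simp
  have "norm ((z + t) ^ Suc n - z ^ Suc n - of_nat (Suc n) * t * z ^ (Suc n - 1)) \<le>
     norm ((z + t) ^ n - z ^ n - of_nat n * t * z ^ (n - 1)) * norm (z + t) +
       real n * (norm t)\<^sup>2 * norm z ^ (n - 1)"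
    unfolding eq by (rule norm_triangle_le) (simp add: norm_mult norm_power)
  also have "\<dots> \<le> (2 * \<rho>) ^ n * (norm t / \<rho>)\<^sup>2 * \<rho> + 2 ^ n * (norm t)\<^sup>2 * \<rho> ^ (n - 1)"
    if "n > 0"
    by (intro add_mono mult_mono Suc.IH assms zp n2) (use assms in auto)
  also have "2 ^ n * (norm t)\<^sup>2 * \<rho> ^ (n - 1) = (2 * \<rho>) ^ n * (norm t / \<rho>)\<^sup>2 * \<rho>" if "n > 0"
    using that assms(3) by (cases n) (auto simp: field_simps power2_eq_square)
  finally show ?case
    using assms(3) by (cases "n = 0") (auto simp: field_simps)
qed

lemma mpow_split: "mpow F k = F i ^ (k $ i) * (\<Prod>j\<in>UNIV - {i}. F j ^ (k $ j))"
  unfolding mpow_def by (subst prod.remove[of UNIV i]) auto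

lemma mpow_add_axis_second_order:
  fixes z :: "complex^'v::finite"
  assumes "z \<in> polydisc \<rho>" "z + axis i t \<in> polydisc \<rho>" "\<rho> > 0"
  shows "norm (mpow (($) (z + axis i t)) k - mpow (($) z) k -
           t * (of_nat (k $ i) * mpow (($) z) (k - axis i 1))) \<le> (2 * \<rho>) ^ mdeg k * (norm t / \<rho>)\<^sup>2"
proof -
  define P where "P = (\<Prod>j\<in>UNIV - {i}. (z $ j) ^ (k $ j))"
  have z: "norm (z $ j) \<le> \<rho>" for j
    using assms(1) by (auto simp: polydisc_def intro: less_imp_le)
  have zt: "norm (z $ i + t) \<le> \<rho>"
    using assms(2) by (auto simp: polydisc_def axis_def dest!: spec[of _ i])
  have e1: "mpow (($) (z + axis i t)) k = (z $ i + t) ^ (k $ i) * P"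
    by (subst mpow_split[of _ _ i]) (auto simp: P_def axis_def intro!: prod.cong)
  have e2: "mpow (($) z) k = (z $ i) ^ (k $ i) * P"
    by (subst mpow_split[of _ _ i]) (auto simp: P_def)
  have e3: "mpow (($) z) (k - axis i 1) = (z $ i) ^ (k $ i - 1) * P"
    by (subst mpow_split[of _ _ i]) (auto simp: P_def axis_def intro!: prod.cong)
  have "norm P \<le> (\<Prod>j\<in>UNIV - {i}. (2 * \<rho>) ^ (k $ j))"
    unfolding P_def prod_norm[symmetric] norm_power
    by (intro prod_mono conjI power_mono order_trans[OF z]) (use assms(3) in auto)
  moreover have "norm ((z $ i + t) ^ (k $ i) - (z $ i) ^ (k $ i) - of_nat (k $ i) * t * (z $ i) ^ (k $ i - 1))
      \<le> (2 * \<rho>) ^ (k $ i) * (norm t / \<rho>)\<^sup>2"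
    by (rule power_second_order) (use z zt assms in auto)
  ultimately have "norm (((z $ i + t) ^ (k $ i) - (z $ i) ^ (k $ i) - of_nat (k $ i) * t * (z $ i) ^ (k $ i - 1)) * P)
     \<le> ((2 * \<rho>) ^ (k $ i) * (norm t / \<rho>)\<^sup>2) * (\<Prod>j\<in>UNIV - {i}. (2 * \<rho>) ^ (k $ j))"
    unfolding norm_mult by (intro mult_mono) (use assms(3) in auto)
  also have "\<dots> = (2 * \<rho>) ^ mdeg k * (norm t / \<rho>)\<^sup>2"
    by (subst mpow_const[symmetric], subst mpow_split[of _ _ i]) simp
  finally show ?thesis
    by (simp only: e1 e2 e3) (simp add: algebra_simps)
qed

lemma pseries_bound_nonneg:
  assumes "\<forall>k. norm (c k) \<le> M * C ^ mdeg k"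
  shows "0 \<le> M"
  by (rule order_trans[OF norm_ge_zero[of "c 0"]]) (use assms[rule_format, of 0] in simp)

lemma has_sum_pseries_deriv:
  fixes f :: "nat^'v::finite \<Rightarrow> complex"
  assumes "((\<lambda>k. of_nat (k $ i + 1) * f (k + axis i 1)) has_sum s) UNIV"
  shows "((\<lambda>k. of_nat (k $ i) * f k) has_sum s) UNIV"
proof -
  have bij: "bij_betw (\<lambda>k. k + axis i 1) UNIV {k :: nat^'v. k $ i \<noteq> 0}"
    by (rule bij_betw_byWitness[where f' = "\<lambda>k. k - axis i 1"])
       (auto simp: minus_axis_add[simplified])
  have "((\<lambda>k. of_nat (k $ i) * f k) has_sum s) {k. k $ i \<noteq> 0}"
    using assms by (subst has_sum_reindex_bij_betw[OF bij, symmetric]) simp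
  then show ?thesis
    by (rule has_sum_cong_neutral[THEN iffD1, rotated -1]) auto
qed

lemma geometric_coeffs_summable:
  fixes c :: "nat^'v::finite \<Rightarrow> complex"
  assumes "\<forall>k. norm (c k) \<le> M * C ^ mdeg k" "\<And>i. norm (z $ i) \<le> \<rho>" "0 \<le> C" "C * \<rho> < 1"
  shows "(\<lambda>k. c k * mpow (($) z) k) summable_on UNIV"
proof (rule abs_summable_summable, rule Infinite_Sum.abs_summable_on_comparison_test')
  have \<rho>: "0 \<le> \<rho>" using assms(2) norm_ge_zero order_trans by blast
  have M: "0 \<le> M" using assms(1) by (rule pseries_bound_nonneg)
  show "(\<lambda>k. M * (C * \<rho>) ^ mdeg k :: real) summable_on (UNIV :: (nat^'v) set)"
    by (intro summable_on_cmult_right summable_power_mdeg) (use assms \<rho> in auto)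
  fix k :: "nat^'v"
  have "mpow (\<lambda>i. norm (z $ i)) k \<le> mpow (\<lambda>i. \<rho>) k"
    by (rule mpow_mono) (use assms in auto)
  then show "norm (c k * mpow (($) z) k) \<le> M * (C * \<rho>) ^ mdeg k"
    unfolding norm_mult norm_mpow power_mult_distrib mult.assoc[symmetric]
    by (intro mult_mono) (use assms M in \<open>auto intro: mpow_nonneg\<close>)
qed

lemma has_field_derivative_quadratic:
  fixes f :: "complex \<Rightarrow> complex"
  assumes "\<delta> > 0" "\<And>t. norm t < \<delta> \<Longrightarrow> norm (f t - f 0 - t * D) \<le> K * (norm t)\<^sup>2"
  shows "(f has_field_derivative D) (at 0)"
proof -
  have "((\<lambda>h. (f h - f 0) / h - D) \<longlongrightarrow> 0) (at 0)"
  proof (rule Lim_null_comparison)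
    show "\<forall>\<^sub>F h in at 0. norm ((f h - f 0) / h - D) \<le> K * norm h"
      unfolding eventually_at
    proof (intro exI[of _ \<delta>] conjI ballI impI)
      fix h :: complex assume h: "h \<noteq> 0 \<and> dist h 0 < \<delta>"
      have "((f h - f 0) / h - D) * h = f h - f 0 - h * D"
        using h by (simp add: field_simps)
      then have "norm ((f h - f 0) / h - D) * norm h = norm (f h - f 0 - h * D)"
        by (simp only: norm_mult[symmetric])
      also have "\<dots> \<le> (K * norm h) * norm h"
        using assms(2)[of h] h by (simp add: power2_eq_square mult.assoc)
      finally show "norm ((f h - f 0) / h - D) \<le> K * norm h"
        using h by (simp del: norm_minus_cancel)
    qed (rule assms(1))
    show "((\<lambda>h. K * norm h) \<longlongrightarrow> 0) (at (0::complex))"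
      by (rule tendsto_eq_intros refl | simp)+
  qed
  then have "((\<lambda>h. (f h - f 0) / h) \<longlongrightarrow> D) (at 0)"
    by (simp add: LIM_zero_iff)
  then show ?thesis by (simp add: has_field_derivative_iff)
qed

text \<open>
  The second-order errors of the monomials, weighted by the coefficients, are dominated by a geometric
  series with ratio \<open>1/4\<close>. Hence the difference of \<open>g (z + axis i t)\<close> and its linear part is \<open>O(\<bar>t\<bar>\<^sup>2)\<close>,
  which is differentiability with the termwise derivative.
\<close>
lemma pseries_partial_deriv:
  fixes g :: "complex^'v::finite \<Rightarrow> complex"
  assumes "pseries C g c"
  shows "pseries (2 * C) (partial_deriv i g) (\<lambda>k. of_nat (k $ i + 1) * c (k + axis i 1))"
proof -
  let ?d = "\<lambda>k. of_nat (k $ i + 1) * c (k + axis i 1)"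
  from assms obtain M where C: "C > 0" and M: "\<forall>k. norm (c k) \<le> M * C ^ mdeg k"
    and hs: "\<And>z. z \<in> polydisc (1 / (8 * C)) \<Longrightarrow> ((\<lambda>k. c k * mpow (($) z) k) has_sum g z) UNIV"
    by (auto simp: pseries_def)
  have M0: "0 \<le> M" using M by (rule pseries_bound_nonneg)
  have d: "norm (?d k) \<le> M * C * (2 * C) ^ mdeg k" for k
  proof -
    have "k $ i + 1 \<le> 2 ^ mdeg k"
      using le_mdeg[of k i] less_exp[of "mdeg k"] by linarith
    then have "real (k $ i + 1) \<le> 2 ^ mdeg k"
      by (metis of_nat_le_iff of_nat_numeral of_nat_power)
    then have "norm (?d k) \<le> 2 ^ mdeg k * (M * C ^ mdeg (k + axis i 1))"
      unfolding norm_mult norm_of_nat by (intro mult_mono M[rule_format]) auto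
    then show ?thesis by (simp add: power_mult_distrib mult_ac)
  qed
  define \<rho> where "\<rho> = 1 / (8 * C)"
  have \<rho>: "\<rho> > 0" "C * \<rho> = 1 / 8" using C by (auto simp: \<rho>_def)
  define K where "K = M * (\<Sum>\<^sub>\<infinity>k::nat^'v. (1/4) ^ mdeg k) / \<rho>\<^sup>2"
  have "((\<lambda>k. ?d k * mpow (($) z) k) has_sum partial_deriv i g z) UNIV"
    if z: "z \<in> polydisc (1 / (8 * (2 * C)))" for z
  proof -
    have z': "norm (z $ j) < \<rho> / 2" for j
      using z by (auto simp: polydisc_def \<rho>_def)
    have z\<rho>: "z \<in> polydisc \<rho>"
      using z' \<rho>(1) by (force simp: polydisc_def intro: less_trans[OF z'])
    obtain D where D: "((\<lambda>k. ?d k * mpow (($) z) k) has_sum D) UNIV"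
      using geometric_coeffs_summable[of ?d "M * C" "2 * C" z "\<rho> / 2"] d z' \<rho> C
      by (auto simp: summable_on_def intro: less_imp_le)
    have D': "((\<lambda>k. c k * (of_nat (k $ i) * mpow (($) z) (k - axis i 1))) has_sum D) UNIV"
      using has_sum_pseries_deriv[of i "\<lambda>k. c k * mpow (($) z) (k - axis i 1)" D] D
      by (simp add: mult_ac)
    have "norm (g (z + axis i t) - g (z + axis i 0) - t * D) \<le> K * (norm t)\<^sup>2" if t: "norm t < \<rho> / 2" for t
    proof -
      have zt: "z + axis i t \<in> polydisc \<rho>"
        unfolding polydisc_def
      proof (safe)
        fix j
        have "norm (axis i t $ j) \<le> norm t" by (auto simp: axis_def)
        then show "norm ((z + axis i t) $ j) < \<rho>"
          using z'[of j] t norm_triangle_ineq[of "z $ j" "axis i t $ j"] by auto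
      qed
      let ?R = "\<lambda>k. c k * (mpow (($) (z + axis i t)) k - mpow (($) z) k -
           t * (of_nat (k $ i) * mpow (($) z) (k - axis i 1)))"
      have "((\<lambda>k. c k * mpow (($) (z + axis i t)) k + (-1) * (c k * mpow (($) z) k) +
           (- t) * (c k * (of_nat (k $ i) * mpow (($) z) (k - axis i 1)))) has_sum
              (g (z + axis i t) + (-1) * g z + (- t) * D)) UNIV"
        by (intro has_sum_add has_sum_cmult_right D') (use hs zt z\<rho> in \<open>auto simp: \<rho>_def\<close>)
      then have R: "(?R has_sum (g (z + axis i t) - g z - t * D)) UNIV"
        by (simp add: algebra_simps)
      have "((\<lambda>k::nat^'v. (M * (norm t / \<rho>)\<^sup>2) * (1/4) ^ mdeg k) has_sum
               (M * (norm t / \<rho>)\<^sup>2 * (\<Sum>\<^sub>\<infinity>k::nat^'v. (1/4) ^ mdeg k))) UNIV"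
        by (intro has_sum_cmult_right has_sum_infsum summable_power_mdeg) auto
      moreover have "norm (?R k) \<le> (M * (norm t / \<rho>)\<^sup>2) * (1/4) ^ mdeg k" for k
      proof -
        have "norm (?R k) \<le> (M * C ^ mdeg k) * ((2 * \<rho>) ^ mdeg k * (norm t / \<rho>)\<^sup>2)"
          unfolding norm_mult[of "c k"]
          by (intro mult_mono mpow_add_axis_second_order z\<rho> zt \<rho> M[rule_format]) (use M0 C in auto)
        also have "\<dots> = (M * (norm t / \<rho>)\<^sup>2) * (2 * (C * \<rho>)) ^ mdeg k"
          by (simp add: power_mult_distrib mult_ac)
        finally show ?thesis by (simp add: \<rho>)
      qed
      ultimately have "norm (g (z + axis i t) - g z - t * D) \<le> M * (norm t / \<rho>)\<^sup>2 * (\<Sum>\<^sub>\<infinity>k::nat^'v. (1/4) ^ mdeg k)"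
        by (rule norm_infsum_le[OF R])
      then show ?thesis
        by (simp add: K_def power_divide mult_ac axis_def zero_vec_def[symmetric])
    qed
    then have "((\<lambda>t. g (z + axis i t)) has_field_derivative D) (at 0)"
      by (intro has_field_derivative_quadratic[of "\<rho> / 2"]) (use \<rho> in auto)
    then have "partial_deriv i g z = D"
      by (simp add: partial_deriv_def DERIV_imp_deriv)
    then show ?thesis using D by simp
  qed
  then show ?thesis
    unfolding pseries_def using C d by (auto intro!: exI[of _ "M * C"])
qed

lemma pseries_at_0:
  assumes "pseries C g c"
  shows "g 0 = c 0"
proof -
  have "((\<lambda>k. c k * mpow (($) 0) k) has_sum g 0) UNIV"
    using assms by (auto simp: pseries_def polydisc_def)
  moreover have "c k * mpow (($) 0) k = (if k = 0 then c 0 else 0)" for k :: "nat^'a"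
  proof (cases "k = 0")
    case False
    then obtain i where "k $ i \<noteq> 0" by (auto simp: vec_eq_iff)
    then have "mpow (($) (0 :: complex^'a)) k = 0"
      unfolding mpow_def by (intro prod_zero) (auto intro!: bexI[of _ i])
    then show ?thesis using False by simp
  qed simp
  ultimately have "((\<lambda>k :: nat^'a. if k = 0 then c 0 else 0) has_sum g 0) UNIV" by simp
  then have "((\<lambda>k. c k) has_sum g 0) {0}"
    by (rule has_sum_cong_neutral[THEN iffD1, rotated -1]) auto
  from has_sum_unique[OF this has_sum_finite] show ?thesis by simp
qed

lemma pseries_iterated_partial_deriv:
  fixes g :: "complex^'v::finite \<Rightarrow> complex"
  assumes "pseries C g c"
  shows "\<exists>C'. pseries C' ((partial_deriv i ^^ n) g)
           (\<lambda>k. (fact (k $ i + n) / fact (k $ i)) * c (k + axis i n))"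
proof (induction n)
  case 0
  then show ?case using assms by (auto simp: axis_def zero_vec_def[symmetric])
next
  case (Suc n)
  then obtain C' where "pseries C' ((partial_deriv i ^^ n) g)
           (\<lambda>k. (fact (k $ i + n) / fact (k $ i)) * c (k + axis i n))" by blast
  from pseries_partial_deriv[OF this, of i]
  have "pseries (2 * C') ((partial_deriv i ^^ Suc n) g)
     (\<lambda>k. of_nat (k $ i + 1) * (fact ((k + axis i 1) $ i + n) / fact ((k + axis i 1) $ i) * c (k + axis i 1 + axis i n)))"
    by simp
  moreover have "of_nat (k $ i + 1) * (fact ((k + axis i 1) $ i + n) / fact ((k + axis i 1) $ i) * c (k + axis i 1 + axis i n))
     = (fact (k $ i + Suc n) / fact (k $ i)) * c (k + axis i (Suc n))" for k
  proof -
    have "k + axis i 1 + axis i n = k + axis i (Suc n)"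
      by (auto simp: vec_eq_iff axis_def)
    moreover have "of_nat (k $ i + 1) \<noteq> (0 :: complex)"
      by (simp only: of_nat_eq_0_iff)
    moreover have "(k + axis i 1) $ i = k $ i + 1"
      by (simp add: axis_def)
    moreover have "fact (k $ i + 1) = of_nat (k $ i + 1) * (fact (k $ i) :: complex)"
      by (simp only: Suc_eq_plus1[symmetric] fact_Suc)
    moreover have "k $ i + 1 + n = k $ i + Suc n" by simp
    moreover have "x * (F / (x * f) * d) = F / f * d" if "x \<noteq> 0" for x F f d :: complex
      using that by simp
    ultimately show ?thesis by (simp only: not_False_eq_True)
  qed
  ultimately show ?case by auto
qed

text \<open>
  Every intermediate derivative is again the sum of an explicit series, whose coefficients are symmetric in
  the variables treated so far. This is why any enumeration of the variables leads to the same derivative.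
\<close>
lemma pseries_mixed_partial_list:
  fixes g :: "complex^'v::finite \<Rightarrow> complex"
  assumes "pseries C g c" "distinct vs"
  shows "\<exists>C'. pseries C' (foldr (\<lambda>i. partial_deriv i ^^ (k $ i)) vs g)
           (\<lambda>l. (\<Prod>i\<in>set vs. fact (l $ i + k $ i) / fact (l $ i)) * c (l + (\<chi> i. if i \<in> set vs then k $ i else 0)))"
  using assms(2)
proof (induction vs)
  case Nil
  have "(\<chi> i. 0) = (0 :: nat^'v)" by (simp add: vec_eq_iff)
  then show ?case using assms(1) by auto
next
  case (Cons i vs)
  let ?e = "\<lambda>vs. (\<chi> i. if i \<in> set vs then k $ i else 0)"
  from Cons obtain C' where "pseries C' (foldr (\<lambda>i. partial_deriv i ^^ (k $ i)) vs g)
           (\<lambda>l. (\<Prod>i\<in>set vs. fact (l $ i + k $ i) / fact (l $ i)) * c (l + ?e vs))" by auto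
  from pseries_iterated_partial_deriv[OF this, where i = i and n = "k $ i"] obtain C'' where
    C'': "pseries C'' ((partial_deriv i ^^ (k $ i)) (foldr (\<lambda>i. partial_deriv i ^^ (k $ i)) vs g))
     (\<lambda>l. fact (l $ i + k $ i) / fact (l $ i) * ((\<Prod>j\<in>set vs. fact ((l + axis i (k $ i)) $ j + k $ j) /
         fact ((l + axis i (k $ i)) $ j)) * c (l + axis i (k $ i) + ?e vs)))" by blast
  have "fact (l $ i + k $ i) / fact (l $ i) * ((\<Prod>j\<in>set vs. fact ((l + axis i (k $ i)) $ j + k $ j) /
         fact ((l + axis i (k $ i)) $ j)) * c (l + axis i (k $ i) + ?e vs))
      = (\<Prod>j\<in>set (i # vs). fact (l $ j + k $ j) / fact (l $ j)) * c (l + ?e (i # vs))" for l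
  proof -
    have "l + axis i (k $ i) + ?e vs = l + ?e (i # vs)"
      using Cons.prems by (auto simp: vec_eq_iff axis_def)
    moreover have "(\<Prod>j\<in>set vs. fact ((l + axis i (k $ i)) $ j + k $ j) / fact ((l + axis i (k $ i)) $ j))
        = (\<Prod>j\<in>set vs. fact (l $ j + k $ j) / fact (l $ j) :: complex)"
      using Cons.prems by (intro prod.cong) (auto simp: axis_def)
    ultimately show ?thesis using Cons.prems by simp
  qed
  then show ?case using C'' by auto
qed

lemma taylor_pseries:
  assumes "pseries C g c"
  shows "mfps_nth (taylor g) k = c k"
proof -
  define vs :: "'a list" where "vs = (SOME vs. distinct vs \<and> set vs = UNIV)"
  have "\<exists>vs :: 'a list. distinct vs \<and> set vs = UNIV"
    using finite_distinct_list[of "UNIV :: 'a set"] by auto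
  then have vs: "distinct vs" "set vs = UNIV"
    unfolding vs_def by (metis (mono_tags, lifting) someI_ex)+
  from pseries_mixed_partial_list[OF assms vs(1), of k] obtain C' where
    "pseries C' (mixed_partial k g)
       (\<lambda>l. (\<Prod>i\<in>set vs. fact (l $ i + k $ i) / fact (l $ i)) * c (l + (\<chi> i. if i \<in> set vs then k $ i else 0)))"
    by (auto simp: mixed_partial_def vs_def)
  from pseries_at_0[OF this] have "mixed_partial k g 0 = (\<Prod>i\<in>UNIV. fact (k $ i)) * c k"
    by (simp add: vs vec_lambda_eta)
  then show ?thesis
    by (simp add: taylor_def)
qed

section \<open>Separately holomorphic functions\<close>

definition upd :: "complex^'v \<Rightarrow> 'v::finite \<Rightarrow> complex \<Rightarrow> complex^'v" where
  "upd z i t = (\<chi> j. if j = i then t else z $ j)"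

definition sep_holo :: "real \<Rightarrow> real \<Rightarrow> (complex^'v::finite \<Rightarrow> complex) \<Rightarrow> bool" where
  "sep_holo r M g \<longleftrightarrow> (\<forall>z \<in> polydisc r. norm (g z) \<le> M \<and>
     (\<forall>i. (\<lambda>t. g (upd z i t)) holomorphic_on ball 0 r))"

text \<open>
  The coefficient of the \<open>n\<close>-th power of the \<open>i\<close>-th variable, as a function of the other variables. Its
  argument is still a full vector \<open>z\<close>, whose \<open>i\<close>-th entry is ignored; so these operators can be iterated
  within one type.
\<close>
definition taylor_coeff :: "'v \<Rightarrow> nat \<Rightarrow> (complex^'v::finite \<Rightarrow> complex) \<Rightarrow> complex^'v \<Rightarrow> complex" where
  "taylor_coeff i n g z = (deriv ^^ n) (\<lambda>t. g (upd z i t)) 0 / fact n"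

lemma upd_in_polydisc: "z \<in> polydisc r \<Longrightarrow> norm t < r \<Longrightarrow> upd z i t \<in> polydisc r"
  by (auto simp: polydisc_def upd_def)

lemma upd_upd_same [simp]: "upd (upd z i s) i t = upd z i t"
  by (auto simp: upd_def vec_eq_iff)

lemma upd_commute: "i \<noteq> j \<Longrightarrow> upd (upd z i s) j t = upd (upd z j t) i s"
  by (auto simp: upd_def vec_eq_iff)

lemma upd_self [simp]: "upd z i (z $ i) = z"
  by (auto simp: upd_def vec_eq_iff)

text \<open>
  Cauchy's inequality on the circles of radius \<open>s < r\<close>, followed by \<open>s \<rightarrow> r\<close>. The full radius \<open>r\<close> is
  kept, so expanding in all variables one after another does not shrink the polydisc.
\<close>
lemma norm_taylor_coeff_le:
  assumes g: "sep_holo r M g" and z: "z \<in> polydisc r" and r: "r > 0"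
  shows "norm (taylor_coeff i n g z) \<le> M / r ^ n"
proof -
  have hol: "(\<lambda>t. g (upd z i t)) holomorphic_on ball 0 r"
    using g z by (auto simp: sep_holo_def)
  have bd: "norm (g (upd z i t)) \<le> M" if "norm t < r" for t
    using g upd_in_polydisc[OF z that] by (auto simp: sep_holo_def)
  have le: "norm (taylor_coeff i n g z) \<le> M / s ^ n" if s: "0 < s" "s < r" for s
  proof -
    have "norm ((deriv ^^ n) (\<lambda>t. g (upd z i t)) 0) \<le> fact n * M / s ^ n"
    proof (rule Cauchy_inequality)
      show "(\<lambda>t. g (upd z i t)) holomorphic_on ball 0 s"
        by (rule holomorphic_on_subset[OF hol]) (use s in auto)
      show "continuous_on (cball 0 s) (\<lambda>t. g (upd z i t))"
        by (rule holomorphic_on_imp_continuous_on, rule holomorphic_on_subset[OF hol]) (use s in auto)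
    qed (use s bd in auto)
    then show ?thesis
      by (simp add: taylor_coeff_def norm_divide field_simps)
  qed
  show ?thesis
  proof (rule tendsto_lowerbound)
    show "((\<lambda>s. M / s ^ n) \<longlongrightarrow> M / r ^ n) (at_left r)"
      by (intro tendsto_intros) (use r in auto)
    show "\<forall>\<^sub>F s in at_left r. norm (taylor_coeff i n g z) \<le> M / s ^ n"
      using eventually_at_left_real[OF r] by eventually_elim (use le in auto)
  qed auto
qed

lemma sums_taylor_coeff:
  assumes g: "sep_holo r M g" and z: "z \<in> polydisc r" and t: "norm t < r"
  shows "(\<lambda>n. taylor_coeff i n g z * t ^ n) sums g (upd z i t)"
proof -
  have "(\<lambda>t. g (upd z i t)) holomorphic_on ball 0 r"
    using g z by (auto simp: sep_holo_def)
  from holomorphic_power_series[OF this, of t] t show ?thesis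
    by (simp add: taylor_coeff_def)
qed

text \<open>
  The quotient on the left is built from values of \<open>g\<close> and from lower coefficients. It approximates the
  \<open>n\<close>-th coefficient with an error that does not depend on \<open>z\<close>.
\<close>
lemma taylor_coeff_remainder:
  assumes g: "sep_holo r M g" and z: "z \<in> polydisc r" and r: "r > 0" and N: "N \<ge> 1"
  defines "t \<equiv> of_real (r / (real N + 1))"
  shows "norm ((g (upd z i t) - (\<Sum>m<n. taylor_coeff i m g z * t ^ m)) / t ^ n - taylor_coeff i n g z)
           \<le> M / r ^ n * (1 / real N)"
proof -
  define \<theta> where "\<theta> = 1 / (real N + 1)"
  have \<theta>: "0 < \<theta>" "\<theta> < 1" "norm t = r * \<theta>"
    using N r unfolding t_def norm_of_real by (auto simp: \<theta>_def)
  have t: "norm t < r" "t \<noteq> 0"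
    using \<theta> r by auto
  let ?c = "\<lambda>m. taylor_coeff i m g z"
  have "(\<lambda>p. ?c (p + n) * t ^ (p + n)) sums (g (upd z i t) - (\<Sum>m<n. ?c m * t ^ m))"
    using sums_split_initial_segment[OF sums_taylor_coeff[OF g z t(1)]] .
  from sums_divide[OF this, of "t ^ n"]
  have "(\<lambda>p. ?c (p + n) * t ^ p) sums ((g (upd z i t) - (\<Sum>m<n. ?c m * t ^ m)) / t ^ n)"
    using t(2) by (simp add: power_add)
  from sums_split_initial_segment[OF this, of 1]
  have s1: "(\<lambda>p. ?c (p + 1 + n) * t ^ (p + 1)) sums
      ((g (upd z i t) - (\<Sum>m<n. ?c m * t ^ m)) / t ^ n - ?c n)"
    by simp
  have "(\<lambda>p. \<theta> ^ p) sums (1 / (1 - \<theta>))"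
    by (rule geometric_sums) (use \<theta> in auto)
  from sums_mult[OF this, of "M / r ^ n * \<theta>"]
  have s2: "(\<lambda>p. M / r ^ n * \<theta> ^ (p + 1)) sums (M / r ^ n * (\<theta> / (1 - \<theta>)))"
    by (simp add: mult_ac)
  have le: "norm (?c (p + 1 + n) * t ^ (p + 1)) \<le> M / r ^ n * \<theta> ^ (p + 1)" for p
  proof -
    have "norm (?c (p + 1 + n) * t ^ (p + 1)) \<le> M / r ^ (p + 1 + n) * (r * \<theta>) ^ (p + 1)"
      unfolding norm_mult norm_power \<theta>(3)
      by (intro mult_right_mono norm_taylor_coeff_le[OF g z r]) (use r \<theta> in auto)
    also have "\<dots> = M / r ^ n * \<theta> ^ (p + 1)"
      using r by (simp add: power_add power_mult_distrib field_simps)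
    finally show ?thesis .
  qed
  have "norm (\<Sum>p. ?c (p + 1 + n) * t ^ (p + 1)) \<le> (\<Sum>p. M / r ^ n * \<theta> ^ (p + 1))"
    by (rule norm_suminf_le) (use le sums_summable[OF s2] in auto)
  also have "\<dots> = M / r ^ n * (\<theta> / (1 - \<theta>))"
    using s2 by (rule sums_unique[symmetric])
  also have "\<theta> / (1 - \<theta>) = 1 / real N"
    using N by (simp add: \<theta>_def field_simps)
  finally show ?thesis
    using sums_unique[OF s1] by simp
qed

text \<open>
  By induction on \<open>n\<close> the coefficient is a uniform limit of functions that are holomorphic in each of
  the other variables.
\<close>
lemma sep_holo_taylor_coeff:
  assumes g: "sep_holo r M g" and r: "r > 0"
  shows "sep_holo r (M / r ^ n) (taylor_coeff i n g)"
proof (induction n rule: less_induct)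
  case (less n)
  have "(\<lambda>s. taylor_coeff i n g (upd z j s)) holomorphic_on ball 0 r" if z: "z \<in> polydisc r" for z j
  proof (cases "j = i")
    case True
    then show ?thesis by (simp add: taylor_coeff_def)
  next
    case False
    define t where "t = (\<lambda>N. complex_of_real (r / (real (Suc N) + 1)))"
    define h where "h = (\<lambda>N s. (g (upd (upd z j s) i (t N)) -
        (\<Sum>m<n. taylor_coeff i m g (upd z j s) * t N ^ m)) / t N ^ n)"
    have t: "norm (t N) < r" "t N \<noteq> 0" for N
    proof -
      show "norm (t N) < r"
        using r by (simp add: t_def divide_less_eq del: of_real_divide)
      show "t N \<noteq> 0" using r by (simp add: t_def del: of_nat_Suc of_real_divide)
    qed
    have holg: "(\<lambda>s. g (upd (upd z j s) i (t N))) holomorphic_on ball 0 r" for N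
      using g upd_in_polydisc[OF z t(1), of i N] False
      by (subst upd_commute) (auto simp: sep_holo_def)
    have holc: "(\<lambda>s. taylor_coeff i m g (upd z j s)) holomorphic_on ball 0 r" if "m < n" for m
      using less.IH[OF that] z by (auto simp: sep_holo_def)
    have hol: "h N holomorphic_on ball 0 r" for N
      unfolding h_def by (intro holomorphic_intros holg holc) (use t in auto)
    have lim: "uniform_limit (ball 0 r) h (\<lambda>s. taylor_coeff i n g (upd z j s)) sequentially"
    proof (rule uniform_limitI)
      fix e :: real assume e: "e > 0"
      have "(\<lambda>N. M / r ^ n * (1 / real (Suc N))) \<longlonglongrightarrow> M / r ^ n * 0"
        by (intro tendsto_intros) (use LIMSEQ_inverse_real_of_nat in \<open>simp add: inverse_eq_divide\<close>)
      then have "\<forall>\<^sub>F N in sequentially. M / r ^ n * (1 / real (Suc N)) < e"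
        using e by (intro order_tendstoD(2)[of _ 0]) auto
      then show "\<forall>\<^sub>F N in sequentially. \<forall>s\<in>ball 0 r. dist (h N s) (taylor_coeff i n g (upd z j s)) < e"
      proof eventually_elim
        case (elim N)
        show ?case
        proof
          fix s :: complex assume s: "s \<in> ball 0 r"
          have "dist (h N s) (taylor_coeff i n g (upd z j s)) \<le> M / r ^ n * (1 / real (Suc N))"
            unfolding dist_norm h_def t_def
            by (rule taylor_coeff_remainder[OF g _ r]) (use upd_in_polydisc[OF z, of s j] s in auto)
          then show "dist (h N s) (taylor_coeff i n g (upd z j s)) < e"
            using elim by linarith
        qed
      qed
    qed
    show ?thesis
    proof (rule holomorphic_uniform_sequence[OF open_ball hol])
      fix x :: complex assume "x \<in> ball 0 r"
      then obtain d where "d > 0" "cball x d \<subseteq> ball 0 r"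
        using open_contains_cball open_ball by blast
      then show "\<exists>d>0. cball x d \<subseteq> ball 0 r \<and>
          uniform_limit (cball x d) h (\<lambda>s. taylor_coeff i n g (upd z j s)) sequentially"
        using uniform_limit_on_subset[OF lim] by blast
    qed
  qed
  then show ?case
    using norm_taylor_coeff_le[OF g _ r] by (auto simp: sep_holo_def)
qed

lemma has_sum_taylor_coeff:
  assumes g: "sep_holo r M g" and z: "z \<in> polydisc r" and r: "r > 0"
  shows "((\<lambda>n. taylor_coeff i n g z * (z $ i) ^ n) has_sum g z) UNIV"
proof -
  have zi: "norm (z $ i) < r" using z by (auto simp: polydisc_def)
  have "summable (\<lambda>n. norm (taylor_coeff i n g z * (z $ i) ^ n))"
  proof (rule summable_comparison_test')
    show "summable (\<lambda>n. M * (norm (z $ i) / r) ^ n)"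
      by (intro summable_mult summable_geometric) (use zi r in auto)
    fix n
    have "norm (taylor_coeff i n g z * (z $ i) ^ n) \<le> M / r ^ n * norm (z $ i) ^ n"
      unfolding norm_mult norm_power
      by (intro mult_right_mono norm_taylor_coeff_le[OF g z r]) auto
    then show "norm (norm (taylor_coeff i n g z * (z $ i) ^ n)) \<le> M * (norm (z $ i) / r) ^ n"
      by (simp add: power_divide)
  qed
  moreover have "(\<lambda>n. taylor_coeff i n g z * (z $ i) ^ n) sums g z"
    using sums_taylor_coeff[OF g z zi, of i] by simp
  ultimately show ?thesis
    by (rule norm_summable_imp_has_sum)
qed

definition supported_on :: "'v set \<Rightarrow> (nat^'v::finite) set" where
  "supported_on S = {k. \<forall>i. i \<notin> S \<longrightarrow> k $ i = 0}"

text \<open>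
  The set \<open>S\<close> collects the variables in which \<open>g\<close> has been expanded; the coefficients are functions of the
  remaining ones. A further variable is treated by expanding every coefficient; the resulting double series
  converges absolutely, as the bounds on the coefficients refer to the same radius at every stage.
\<close>
lemma sep_holo_expansion:
  fixes g :: "complex^'v::finite \<Rightarrow> complex"
  assumes g: "sep_holo r M g" and r: "r > 0"
  shows "\<exists>c. (\<forall>k\<in>supported_on S. sep_holo r (M / r ^ mdeg k) (c k)) \<and>
           (\<forall>k z z'. (\<forall>i. i \<notin> S \<longrightarrow> z $ i = z' $ i) \<longrightarrow> c k z = c k z') \<and>
           (\<forall>z\<in>polydisc r. ((\<lambda>k. c k z * mpow (($) z) k) has_sum g z) (supported_on S))"
  using finite[of S]
proof (induction S rule: finite_induct)
  case empty
  have "supported_on {} = {0 :: nat^'v}"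
    by (auto simp: supported_on_def vec_eq_iff)
  moreover have "z = z'" if "\<forall>i. z $ i = z' $ i" for z z' :: "complex^'v"
    using that by (simp add: vec_eq_iff)
  moreover have "((\<lambda>k. g z * mpow (($) z) k) has_sum g z) {0}" for z
    using has_sum_finite[of "{0 :: nat^'v}" "\<lambda>k. g z * mpow (($) z) k"] by simp
  ultimately show ?case
    using g by (intro exI[of _ "\<lambda>k. g"]) auto
next
  case (insert i S)
  then obtain c where
    hol: "\<And>k. k \<in> supported_on S \<Longrightarrow> sep_holo r (M / r ^ mdeg k) (c k)" and
    indep: "\<And>k z z'. (\<And>i. i \<notin> S \<Longrightarrow> z $ i = z' $ i) \<Longrightarrow> c k z = c k z'" and
    hs: "\<And>z. z \<in> polydisc r \<Longrightarrow> ((\<lambda>k. c k z * mpow (($) z) k) has_sum g z) (supported_on S)"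
    by blast
  define c' where "c' = (\<lambda>k. taylor_coeff i (k $ i) (c (k - axis i (k $ i))))"
  have bij: "bij_betw (\<lambda>(k, n). k + axis i n) (supported_on S \<times> UNIV) (supported_on (insert i S) :: (nat^'v) set)"
    by (rule bij_betw_byWitness[where f' = "\<lambda>k. (k - axis i (k $ i), k $ i)"])
       (use \<open>i \<notin> S\<close> in \<open>auto simp: supported_on_def vec_eq_iff axis_def\<close>)
  have sub: "k - axis i (k $ i) \<in> supported_on S" "mdeg (k - axis i (k $ i)) + k $ i = mdeg k"
    if "k \<in> supported_on (insert i S)" for k
  proof -
    show "k - axis i (k $ i) \<in> supported_on S"
      using that by (auto simp: supported_on_def axis_def)
    have "mdeg (k - axis i (k $ i)) + k $ i = mdeg (k - axis i (k $ i) + axis i (k $ i))" by simp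
    also have "k - axis i (k $ i) + axis i (k $ i) = k" by (auto simp: vec_eq_iff axis_def)
    finally show "mdeg (k - axis i (k $ i)) + k $ i = mdeg k" .
  qed
  have hol': "sep_holo r (M / r ^ mdeg k) (c' k)" if "k \<in> supported_on (insert i S)" for k
    using sep_holo_taylor_coeff[OF hol[OF sub(1)[OF that]] r, where i = i and n = "k $ i"]
    by (simp add: c'_def sub(2)[OF that, symmetric] power_add)
  have indep': "c' k z = c' k z'" if "\<And>j. j \<notin> insert i S \<Longrightarrow> z $ j = z' $ j" for k z z'
  proof -
    have "c l (upd z i t) = c l (upd z' i t)" for l t
      by (rule indep) (use that in \<open>auto simp: upd_def\<close>)
    then show ?thesis by (simp add: c'_def taylor_coeff_def)
  qed
  have "((\<lambda>k. c' k z * mpow (($) z) k) has_sum g z) (supported_on (insert i S))"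
    if z: "z \<in> polydisc r" for z
  proof -
    define \<theta> where "\<theta> = Max (range (\<lambda>j. norm (z $ j))) / r"
    have \<theta>: "0 \<le> \<theta>" "\<theta> < 1"
    proof -
      have "Max (range (\<lambda>j. norm (z $ j))) \<in> range (\<lambda>j. norm (z $ j))" by (rule Max_in) auto
      then obtain j where "Max (range (\<lambda>j. norm (z $ j))) = norm (z $ j)" by blast
      then show "0 \<le> \<theta>" "\<theta> < 1"
        using z r by (auto simp: \<theta>_def polydisc_def)
    qed
    have z\<theta>: "norm (z $ j) \<le> r * \<theta>" for j
      using r by (auto simp: \<theta>_def)
    have "(\<lambda>k. c' k z * mpow (($) z) k) summable_on (supported_on (insert i S))"
    proof (rule abs_summable_summable, rule Infinite_Sum.abs_summable_on_comparison_test')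
      show "(\<lambda>k. M * \<theta> ^ mdeg k) summable_on (supported_on (insert i S) :: (nat^'v) set)"
        by (rule summable_on_subset_banach[of _ UNIV], intro summable_on_cmult_right summable_power_mdeg)
           (use \<theta> in auto)
      fix k :: "nat^'v" assume k: "k \<in> supported_on (insert i S)"
      have le: "norm (c' k z) \<le> M / r ^ mdeg k"
        using hol'[OF k] z by (auto simp: sep_holo_def)
      have "norm (c' k z * mpow (($) z) k) \<le> M / r ^ mdeg k * mpow (\<lambda>j. r * \<theta>) k"
        unfolding norm_mult norm_mpow
        by (intro mult_mono le mpow_mono z\<theta> mpow_nonneg order_trans[OF norm_ge_zero le]) auto
      then show "norm (c' k z * mpow (($) z) k) \<le> M * \<theta> ^ mdeg k"
        using r by (simp add: power_mult_distrib)
    qed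
    then have summ: "(\<lambda>x. c' (case x of (k, n) \<Rightarrow> k + axis i n) z * mpow (($) z) (case x of (k, n) \<Rightarrow> k + axis i n))
        summable_on (supported_on S \<times> UNIV)"
      by (subst summable_on_reindex_bij_betw[OF bij])
    have eq: "c' (k + axis i n) z * mpow (($) z) (k + axis i n) =
        taylor_coeff i n (c k) z * (z $ i) ^ n * mpow (($) z) k" if "k \<in> supported_on S" for k n
    proof -
      have "k $ i = 0" using that \<open>i \<notin> S\<close> by (auto simp: supported_on_def)
      then have "(k + axis i n) $ i = n" "k + axis i n - axis i n = k"
        by (auto simp: axis_def vec_eq_iff)
      then show ?thesis by (simp add: c'_def mpow_add)
    qed
    have "((\<lambda>x. c' (case x of (k, n) \<Rightarrow> k + axis i n) z * mpow (($) z) (case x of (k, n) \<Rightarrow> k + axis i n))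
        has_sum g z) (supported_on S \<times> UNIV)"
    proof (rule has_sum_SigmaI[OF _ hs[OF z] summ])
      fix k :: "nat^'v" assume k: "k \<in> supported_on S"
      show "((\<lambda>n. c' (case (k, n) of (k, n) \<Rightarrow> k + axis i n) z * mpow (($) z) (case (k, n) of (k, n) \<Rightarrow> k + axis i n))
          has_sum c k z * mpow (($) z) k) UNIV"
        unfolding prod.case eq[OF k]
        by (intro has_sum_cmult_left has_sum_taylor_coeff[OF hol[OF k] z r])
    qed
    then show ?thesis
      by (subst (asm) has_sum_reindex_bij_betw[OF bij])
  qed
  with hol' indep' show ?case by blast
qed

text \<open>
  Once all variables have been expanded, the coefficients are constants, and they agree with the Taylor
  coefficients since the series may be differentiated termwise.
\<close>
theorem osgood:
  fixes g :: "complex^'v::finite \<Rightarrow> complex"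
  assumes g: "sep_holo r M g" and r: "r > 0"
  shows "pseries (1 / r) g (mfps_nth (taylor g))" "norm (mfps_nth (taylor g) k) \<le> M / r ^ mdeg k"
proof -
  have UN: "supported_on UNIV = (UNIV :: (nat^'v) set)"
    by (simp add: supported_on_def)
  obtain c where c: "(\<forall>k. sep_holo r (M / r ^ mdeg k) (c k)) \<and> (\<forall>k z z'. c k z = c k z') \<and>
      (\<forall>z\<in>polydisc r. ((\<lambda>k. c k z * mpow (($) z) k) has_sum g z) UNIV)"
    using sep_holo_expansion[OF g r, of UNIV] unfolding UN by (elim exE) simp
  then have hol: "\<And>k. sep_holo r (M / r ^ mdeg k) (c k)" and
    indep: "\<And>k z z'. c k z = c k z'" and
    hs: "\<And>z. z \<in> polydisc r \<Longrightarrow> ((\<lambda>k. c k z * mpow (($) z) k) has_sum g z) UNIV"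
    by blast+
  have b: "norm (c k 0) \<le> M / r ^ mdeg k" for k
    using hol[of k] r by (auto simp: sep_holo_def polydisc_def)
  have "((\<lambda>k. c k 0 * mpow (($) z) k) has_sum g z) UNIV" if "z \<in> polydisc (r / 8)" for z
  proof -
    have "norm (z $ i) < r" for i
      using that r by (auto simp: polydisc_def dest!: spec[of _ i])
    then have "z \<in> polydisc r" by (simp add: polydisc_def)
    from hs[OF this] show ?thesis by (subst indep[of _ 0 z])
  qed
  then have "pseries (1 / r) g (\<lambda>k. c k 0)"
    using b r by (auto simp: pseries_def power_divide intro!: exI[of _ M])
  moreover from taylor_pseries[OF this] have "mfps_nth (taylor g) = (\<lambda>k. c k 0)" by auto
  ultimately show "pseries (1 / r) g (mfps_nth (taylor g))" "norm (mfps_nth (taylor g) k) \<le> M / r ^ mdeg k"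
    using b by auto
qed

lemma holomorphic_near_0_sep_holo:
  fixes f :: "complex^'v::finite \<Rightarrow> complex^'n::finite"
  assumes "holomorphic_near_0 f"
  shows "\<exists>r M. r > 0 \<and> (\<forall>b. sep_holo r M (\<lambda>z. f z $ b))"
proof -
  from assms obtain d where d: "d > 0" and
    D: "\<And>z. norm z < d \<Longrightarrow> \<exists>L. (f has_derivative L) (at z) \<and> (\<forall>c v. L (c *s v) = c *s L v)"
    unfolding holomorphic_near_0_def eventually_nhds_metric by (auto simp: dist_norm)
  have "continuous_on (cball 0 (d / 2)) f"
  proof (rule continuous_at_imp_continuous_on, rule ballI)
    fix z :: "complex^'v" assume "z \<in> cball 0 (d / 2)"
    then have "norm z < d" using d by auto
    then show "isCont f z" using D has_derivative_continuous by blast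
  qed
  then have "compact (f ` cball 0 (d / 2))"
    by (intro compact_continuous_image) auto
  then obtain M where M: "\<And>z. norm z \<le> d / 2 \<Longrightarrow> norm (f z) \<le> M"
    using compact_imp_bounded by (fastforce simp: bounded_iff)
  define r where "r = d / (2 * real CARD('v))"
  have r: "r > 0" using d by (simp add: r_def)
  have small: "norm z \<le> d / 2" if "z \<in> polydisc r" for z :: "complex^'v"
  proof -
    have "norm z \<le> (\<Sum>i\<in>UNIV. norm (z $ i))"
      unfolding norm_vec_def by (rule L2_set_le_sum) auto
    also have "\<dots> \<le> (\<Sum>i\<in>(UNIV::'v set). r)"
      by (rule sum_mono) (use that in \<open>auto simp: polydisc_def intro: less_imp_le\<close>)
    also have "\<dots> = d / 2" by (simp add: r_def)
    finally show ?thesis .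
  qed
  have "sep_holo r M (\<lambda>z. f z $ b)" for b
    unfolding sep_holo_def
  proof (intro ballI conjI allI)
    fix z :: "complex^'v" and i assume z: "z \<in> polydisc r"
    show "norm (f z $ b) \<le> M"
      using M[OF small[OF z]] Finite_Cartesian_Product.norm_nth_le[of "f z" b] by (rule order_trans[rotated])
    show "(\<lambda>t. f (upd z i t) $ b) holomorphic_on ball 0 r"
    proof (rule holomorphic_onI)
      fix t :: complex assume "t \<in> ball 0 r"
      then have "norm (upd z i t) < d"
        using small[OF upd_in_polydisc[OF z, of t i]] d by simp
      from D[OF this] obtain L where L: "(f has_derivative L) (at (upd z i t))"
        and lin: "\<And>c v. L (c *s v) = c *s L v" by blast
      have upd: "upd z i = (\<lambda>t. upd z i 0 + t *s axis i 1)"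
        by (auto simp: upd_def vec_eq_iff axis_def)
      have bl: "bounded_linear (\<lambda>t. t *s (axis i 1 :: complex^'v))"
        unfolding linear_conv_bounded_linear[symmetric]
        by (auto intro!: linearI simp: vec_eq_iff axis_def algebra_simps)
      have "(upd z i has_derivative (\<lambda>t. t *s axis i 1)) (at t)"
        by (subst upd) (rule derivative_eq_intros bounded_linear.has_derivative[OF bl] refl | simp)+
      from has_derivative_compose[OF this L]
      have "((\<lambda>t. f (upd z i t)) has_derivative (\<lambda>t. t *s L (axis i 1))) (at t)"
        by (simp add: lin)
      from bounded_linear.has_derivative[OF bounded_linear_vec_nth this]
      have "((\<lambda>t. f (upd z i t) $ b) has_derivative (\<lambda>t. L (axis i 1) $ b * t)) (at t)"
        by (simp add: mult.commute)
      then have "((\<lambda>t. f (upd z i t) $ b) has_field_derivative (L (axis i 1) $ b)) (at t)"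
        by (simp add: has_field_derivative_def)
      then show "(\<lambda>t. f (upd z i t) $ b) field_differentiable at t within ball 0 r"
        by (auto simp: field_differentiable_def intro: has_field_derivative_at_within)
    qed
  qed
  then show ?thesis using r by blast
qed

section \<open>Bounds along generic lines and the Baire category theorem\<close>

definition hom_part :: "nat \<Rightarrow> (nat^'v::finite \<Rightarrow> complex) \<Rightarrow> complex^'v \<Rightarrow> complex" where
  "hom_part n c a = (\<Sum>k | mdeg k = n. c k * mpow (($) a) k)"

lemma hom_part_scale: "hom_part n c (\<zeta> *s a) = \<zeta> ^ n * hom_part n c a"
proof -
  have "mpow (($) (\<zeta> *s a)) k = \<zeta> ^ mdeg k * mpow (($) a) k" for k
  proof -
    have "($) (\<zeta> *s a) = (\<lambda>i. \<zeta> * a $ i)" by auto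
    then show ?thesis by (simp add: mpow_mult)
  qed
  then show ?thesis
    unfolding hom_part_def sum_distrib_left by (intro sum.cong) auto
qed

lemma continuous_hom_part: "continuous_on S (hom_part n c)"
  unfolding hom_part_def mpow_def by (intro continuous_intros)

lemma hom_part_holomorphic:
  "(\<lambda>\<zeta>. hom_part n c (\<chi> i. f i \<zeta>)) holomorphic_on S" if "\<And>i. f i holomorphic_on S"
  unfolding hom_part_def mpow_def by (auto intro!: holomorphic_intros that)

text \<open>
  A bound on an arbitrary ball becomes a bound on the unit ball. By homogeneity
  \<open>Q(\<zeta>a + w) = \<zeta>\<^sup>n Q(a + w/\<zeta>)\<close>, and for \<open>\<bar>\<zeta>\<bar> = 2/\<rho>\<close> the point \<open>a + w/\<zeta>\<close> lies in the given ball.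
  Cauchy's inequality on this circle bounds the value \<open>Q(w)\<close> at \<open>\<zeta> = 0\<close>.
\<close>
lemma hom_part_bound_unit_ball:
  assumes bd: "\<And>z. dist a z < \<rho> \<Longrightarrow> norm (hom_part n c z) \<le> M" and "\<rho> > 0" and w: "norm w \<le> 1"
  shows "norm (hom_part n c w) \<le> M * (2 / \<rho>) ^ n"
proof -
  define h where "h = (\<lambda>\<zeta>. hom_part n c (\<chi> i. \<zeta> * a $ i + w $ i))"
  have hol: "h holomorphic_on UNIV"
    unfolding h_def by (intro hom_part_holomorphic holomorphic_intros)
  have "norm ((deriv ^^ 0) h 0) \<le> fact 0 * (M * (2 / \<rho>) ^ n) / (2 / \<rho>) ^ 0"
  proof (rule Cauchy_inequality)
    show "h holomorphic_on ball 0 (2 / \<rho>)" "continuous_on (cball 0 (2 / \<rho>)) h"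
      using hol by (auto intro: holomorphic_on_subset holomorphic_on_imp_continuous_on)
    fix \<zeta> :: complex assume "norm (0 - \<zeta>) = 2 / \<rho>"
    then have \<zeta>: "norm \<zeta> = 2 / \<rho>" "\<zeta> \<noteq> 0" using \<open>\<rho> > 0\<close> by auto
    have eq: "(\<chi> i. \<zeta> * a $ i + w $ i) = \<zeta> *s (a + inverse \<zeta> *s w)"
      using \<zeta> by (simp add: vec_eq_iff algebra_simps)
    have "norm (inverse \<zeta> *s w) = norm (inverse \<zeta>) * norm w"
      by (simp add: norm_vec_def norm_mult L2_set_right_distrib)
    also have "\<dots> \<le> \<rho> / 2 * 1"
      by (intro mult_mono w) (use \<zeta> \<open>\<rho> > 0\<close> in \<open>auto simp: norm_inverse\<close>)
    finally have "dist a (a + inverse \<zeta> *s w) < \<rho>"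
      using \<open>\<rho> > 0\<close> by (simp add: dist_norm)
    from bd[OF this] have "norm (hom_part n c (a + inverse \<zeta> *s w)) \<le> M" .
    then show "norm (h \<zeta>) \<le> M * (2 / \<rho>) ^ n"
      unfolding h_def eq hom_part_scale norm_mult norm_power \<zeta>(1)
      using \<open>\<rho> > 0\<close> by (simp add: mult.commute mult_right_mono)
  qed (use \<open>\<rho> > 0\<close> in auto)
  then show ?thesis by (simp add: h_def)
qed

lemma taylor_hom_part: "mfps_nth (taylor (hom_part n c)) k = (if mdeg k = n then c k else 0)"
proof (rule taylor_pseries[where C = 1])
  let ?c = "\<lambda>k. if mdeg k = n then c k else 0"
  let ?M = "Max (insert 0 ((\<lambda>k. norm (c k)) ` {k. mdeg k = n}))"
  have "norm (?c k) \<le> ?M * 1 ^ mdeg k" for k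
    by (auto intro!: Max_ge)
  moreover have "((\<lambda>k. ?c k * mpow (($) z) k) has_sum hom_part n c z) UNIV" for z
  proof -
    have "((\<lambda>k. c k * mpow (($) z) k) has_sum hom_part n c z) {k. mdeg k = n}"
      unfolding hom_part_def by (rule has_sum_finite) simp
    then show ?thesis
      by (rule has_sum_cong_neutral[THEN iffD1, rotated -1]) auto
  qed
  ultimately show "pseries 1 (hom_part n c) ?c"
    by (auto simp: pseries_def intro!: exI[of _ ?M])
qed

lemma coeff_bound_hom_part:
  fixes c :: "nat^'v::finite \<Rightarrow> complex"
  assumes bd: "\<And>z. dist a z < \<rho> \<Longrightarrow> norm (hom_part n c z) \<le> M" and "\<rho> > 0" and k: "mdeg k = n"
  shows "norm (c k) \<le> M * (2 / \<rho> * CARD('v)) ^ n"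
proof -
  have "sep_holo (1 / CARD('v)) (M * (2 / \<rho>) ^ n) (hom_part n c)"
    unfolding sep_holo_def
  proof (intro ballI conjI allI)
    fix z :: "complex^'v" and i assume z: "z \<in> polydisc (1 / CARD('v))"
    have "norm z \<le> (\<Sum>i\<in>UNIV. norm (z $ i))"
      unfolding norm_vec_def by (rule L2_set_le_sum) auto
    also have "\<dots> \<le> (\<Sum>i\<in>(UNIV::'v set). 1 / CARD('v))"
      by (rule sum_mono) (use z in \<open>auto simp: polydisc_def intro: less_imp_le\<close>)
    finally have "norm z \<le> 1" by simp
    from hom_part_bound_unit_ball[OF bd \<open>\<rho> > 0\<close> this]
    show "norm (hom_part n c z) \<le> M * (2 / \<rho>) ^ n" .
    show "(\<lambda>t. hom_part n c (upd z i t)) holomorphic_on ball 0 (1 / CARD('v))"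
      unfolding upd_def
    proof (rule hom_part_holomorphic)
      show "(\<lambda>t. if j = i then t else z $ j) holomorphic_on ball 0 (1 / CARD('v))" for j
        by (cases "j = i") (auto intro!: holomorphic_intros)
    qed
  qed
  from osgood(2)[OF this, of k] k show ?thesis
    by (simp add: taylor_hom_part power_mult_distrib power_divide)
qed

lemma Baire_union:
  fixes F :: "nat \<Rightarrow> 'a::{real_normed_vector,heine_borel} set"
  assumes "\<And>n. closed (F n)" "(\<Union>n. F n) = UNIV"
  obtains n a \<rho> where "\<rho> > 0" "ball a \<rho> \<subseteq> F n"
proof -
  have "\<exists>n. interior (F n) \<noteq> {}"
  proof (rule ccontr)
    assume "\<not> (\<exists>n. interior (F n) \<noteq> {})"
    then have "closure (- F n) = UNIV" for n
      by (simp add: closure_complement)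
    then have "UNIV \<subseteq> closure (\<Inter>(range (\<lambda>n. - F n)))"
      using assms(1) by (intro Baire) auto
    moreover have "\<Inter>(range (\<lambda>n. - F n)) = {}"
      using assms(2) by blast
    ultimately show False by simp
  qed
  then obtain n a where "a \<in> interior (F n)" by blast
  then show ?thesis using that mem_interior by blast
qed

text \<open>
  The series converges along each line \<open>t \<mapsto> ta\<close> whose direction avoids countably many proper hypersurfaces,
  with a rate that may depend on \<open>a\<close>. The directions with rate at most \<open>N\<close> form a closed set, and these sets
  and the hypersurfaces cover the space. By the Baire category theorem one of them contains a ball. It is not a
  hypersurface, as a homogeneous polynomial vanishing on a ball has zero coefficients. So the rate is uniform on a
  ball, and the bound for homogeneous polynomials on a ball gives a geometric bound of the coefficients.
\<close>
theorem coeff_bound_if_generic_bound: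
  fixes \<phi> :: "nat^'v::finite \<Rightarrow> complex"
  assumes nz: "\<And>j. \<exists>k. mdeg k = d j \<and> c j k \<noteq> 0"
    and bd: "\<And>a. (\<And>j :: nat. hom_part (d j) (c j) a \<noteq> 0) \<Longrightarrow> \<exists>C. \<forall>n. norm (hom_part n \<phi> a) \<le> C ^ (n + 1)"
  shows "\<exists>C. \<forall>k. norm (\<phi> k) \<le> C ^ (mdeg k + 1)"
proof -
  define E where "E = (\<lambda>N::nat. {a. \<forall>n. norm (hom_part n \<phi> a) \<le> real N ^ (n + 1)})"
  define Z where "Z = (\<lambda>j. {a. hom_part (d j) (c j) a = 0})"
  \<comment> \<open>The two countable families are merged into one sequence.\<close>
  define F where "F = (\<lambda>m. if even m then E (m div 2) else Z (m div 2))"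
  have "closed (E N)" for N
    unfolding E_def
    by (intro closed_Collect_all closed_Collect_le continuous_intros continuous_hom_part)
  moreover have "closed (Z j)" for j
    unfolding Z_def
    by (intro closed_Collect_eq continuous_intros continuous_hom_part)
  ultimately have cl: "closed (F m)" for m by (simp add: F_def)
  have "a \<in> (\<Union>m. F m)" for a
  proof (cases "\<exists>j. a \<in> Z j")
    case True
    then obtain j where "a \<in> Z j" ..
    then have "a \<in> F (2 * j + 1)" by (simp add: F_def)
    then show ?thesis by blast
  next
    case False
    then obtain C where C: "\<And>n. norm (hom_part n \<phi> a) \<le> C ^ (n + 1)"
      using bd[of a] by (auto simp: Z_def)
    obtain N where N: "\<bar>C\<bar> \<le> real N" using real_arch_simple by blast
    have "norm (hom_part n \<phi> a) \<le> real N ^ (n + 1)" for n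
    proof -
      have "norm (hom_part n \<phi> a) \<le> \<bar>C\<bar> ^ (n + 1)"
        using C[of n] by (metis abs_ge_self order_trans power_abs)
      also have "\<dots> \<le> real N ^ (n + 1)" by (rule power_mono[OF N]) auto
      finally show ?thesis .
    qed
    then have "a \<in> F (2 * N)" by (simp add: F_def E_def)
    then show ?thesis by blast
  qed
  then have "(\<Union>m. F m) = UNIV" by blast
  from Baire_union[OF cl this] obtain m a \<rho> where \<rho>: "\<rho> > 0" "ball a \<rho> \<subseteq> F m" .
  show ?thesis
  proof (cases "even m")
    case True
    let ?N = "real (m div 2)" and ?B = "2 / \<rho> * CARD('v)"
    let ?C = "max 1 ?B * ?N"
    have "norm (\<phi> k) \<le> ?C ^ (mdeg k + 1)" for k
    proof -
      have "norm (\<phi> k) \<le> ?N ^ (mdeg k + 1) * ?B ^ mdeg k"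
        by (rule coeff_bound_hom_part[OF _ \<rho>(1) refl]) (use \<rho>(2) True in \<open>auto simp: F_def E_def\<close>)
      also have "\<dots> \<le> ?N ^ (mdeg k + 1) * max 1 ?B ^ (mdeg k + 1)"
      proof (intro mult_left_mono)
        have "?B ^ mdeg k \<le> max 1 ?B ^ mdeg k" by (rule power_mono) (use \<rho> in auto)
        also have "\<dots> \<le> max 1 ?B ^ (mdeg k + 1)" by (rule power_increasing) auto
        finally show "?B ^ mdeg k \<le> max 1 ?B ^ (mdeg k + 1)" .
      qed auto
      finally show ?thesis by (simp add: power_mult_distrib mult_ac)
    qed
    then show ?thesis by blast
  next
    case False
    obtain k where k: "mdeg k = d (m div 2)" "c (m div 2) k \<noteq> 0" using nz by blast
    have "norm (c (m div 2) k) \<le> 0 * (2 / \<rho> * CARD('v)) ^ d (m div 2)"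
      by (rule coeff_bound_hom_part[OF _ \<rho>(1) k(1)]) (use \<rho>(2) False in \<open>auto simp: F_def Z_def\<close>)
    then show ?thesis using k(2) by simp
  qed
qed

lemma mfps_convergentI:
  fixes F :: "('v::finite, complex) mfps"
  assumes "\<forall>k. norm (mfps_nth F k) \<le> C ^ (mdeg k + 1)"
  shows "mfps_convergent F"
proof -
  define B where "B = \<bar>C\<bar> + 1"
  have B: "B > 0" by (simp add: B_def)
  have bd: "norm (mfps_nth F k) \<le> B * B ^ mdeg k" for k
  proof -
    have "norm (mfps_nth F k) \<le> \<bar>C\<bar> ^ (mdeg k + 1)"
      using assms by (metis abs_ge_self order_trans power_abs)
    also have "\<dots> \<le> B ^ (mdeg k + 1)" by (rule power_mono) (auto simp: B_def)
    finally show ?thesis by simp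
  qed
  have "(\<lambda>k. mfps_nth F k * mpow (($) x) k) summable_on UNIV" if "norm x < 1 / (2 * B)" for x
  proof (rule geometric_coeffs_summable)
    show "norm (x $ i) \<le> 1 / (2 * B)" for i
      using that Finite_Cartesian_Product.norm_nth_le[of x i] by linarith
  qed (use bd B in auto)
  then show ?thesis
    unfolding mfps_convergent_def mpow_def eventually_nhds_metric
    using B by (intro exI[of _ "1 / (2 * B)"]) auto
qed

section \<open>Coefficients of formal power series\<close>

lemma mfps_nth_0 [simp]: "mfps_nth 0 k = 0"
  by (simp add: zero_mfps_def)

lemma mfps_nth_1: "mfps_nth 1 k = (if k = 0 then 1 else 0)"
  by (simp add: one_mfps_def)

lemma mfps_nth_add [simp]: "mfps_nth (F + G) k = mfps_nth F k + mfps_nth G k"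
  by (simp add: plus_mfps_def)

lemma mfps_nth_diff [simp]: "mfps_nth (F - G) k = mfps_nth F k - mfps_nth G k"
  by (simp add: minus_mfps_def)

lemma mfps_nth_uminus [simp]: "mfps_nth (- F) k = - mfps_nth F k"
  by (simp add: uminus_mfps_def)

lemma mfps_nth_mult: "mfps_nth (F * G) k = (\<Sum>(x, y) | x + y = k. mfps_nth F x * mfps_nth G y)"
  by (simp add: times_mfps_def)

lemma mfps_nth_sum [simp]: "mfps_nth (sum f S) k = (\<Sum>s\<in>S. mfps_nth (f s) k)"
  by (induction S rule: infinite_finite_induct) auto

lemma mfps_eqI: "(\<And>k. mfps_nth F k = mfps_nth G k) \<Longrightarrow> F = G"
  by (simp add: mfps_eq_iff)

definition mfps_smult :: "complex \<Rightarrow> ('v::finite, complex) mfps \<Rightarrow> ('v, complex) mfps" where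
  "mfps_smult c F = Abs_mfps (\<lambda>k. c * mfps_nth F k)"

lemma mfps_nth_smult [simp]: "mfps_nth (mfps_smult c F) k = c * mfps_nth F k"
  by (simp add: mfps_smult_def)

lemma of_nat_mult_eq_smult: "of_nat n * F = mfps_smult (of_nat n) F"
  by (induction n) (auto simp: mfps_eq_iff algebra_simps)

lemma mfps_smult_mult_left: "mfps_smult c F * G = mfps_smult c (F * G)"
  by (rule mfps_eqI) (simp add: mfps_nth_mult sum_distrib_left case_prod_unfold mult.assoc)

lemma mfps_nth_mult_eq_0:
  assumes "\<And>x. mdeg x < n \<Longrightarrow> mfps_nth F x = 0" "\<And>y. mdeg y < m \<Longrightarrow> mfps_nth G y = 0" "mdeg k < n + m"
  shows "mfps_nth (F * G) k = 0"
  unfolding mfps_nth_mult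
proof (rule sum.neutral, safe)
  fix x y :: "nat^'a" assume "k = x + y"
  then have "mdeg x < n \<or> mdeg y < m" using assms(3) by auto
  then show "mfps_nth F x * mfps_nth G y = 0" using assms by auto
qed

lemma mfps_nth_mpow_eq_0:
  assumes "\<And>w. mfps_nth (G w) 0 = 0" "mdeg k < mdeg l"
  shows "mfps_nth (mpow G l) k = 0"
  using assms(2)
proof (induction l arbitrary: k rule: multi_index_induct)
  case zero
  then show ?case by simp
next
  case (step l w)
  have "mfps_nth (mpow G l * G w) k = 0"
    by (rule mfps_nth_mult_eq_0[of "mdeg l" _ 1]) (use step assms(1) in auto)
  then show ?case by (simp only: mpow_add mpow_axis power_one_right)
qed

text \<open>
  Up to a given degree, a composite is a finite sum with a truncation that does not depend on the
  coefficient considered. All estimates of composites below are estimates of such finite sums.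
\<close>
lemma mfps_compose_truncate:
  assumes "\<And>w. mfps_nth (G w) 0 = 0" "mdeg k \<le> D"
  shows "mfps_nth (mfps_compose F G) k =
    mfps_nth (\<Sum>l | mdeg l \<le> D. mfps_smult (mfps_nth F l) (mpow G l)) k"
proof -
  have "mfps_nth (mfps_compose F G) k = (\<Sum>l | mdeg l \<le> mdeg k. mfps_nth F l * mfps_nth (mpow G l) k)"
    by (simp add: mfps_compose_def mdeg_def mpow_def)
  also have "\<dots> = (\<Sum>l | mdeg l \<le> D. mfps_nth F l * mfps_nth (mpow G l) k)"
    by (rule sum.mono_neutral_left) (use assms mfps_nth_mpow_eq_0[of G, OF assms(1)] in auto)
  finally show ?thesis by simp
qed

section \<open>The bigrading along a direction\<close>

text \<open>
  The substitution \<open>x\<^sub>i = a\<^sub>i \<sigma> t\<^bsup>M + 1\<^esup>\<close>, \<open>x\<^sub>v = a\<^sub>v t\<close> for \<open>v \<noteq> i\<close>, turns a series in \<open>x\<close> into a series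
  in \<open>\<sigma>\<close> and \<open>t\<close>. The factor \<open>t\<^sup>M\<close> in front of \<open>x\<^sub>i\<close> makes every term that contains \<open>x\<^sub>i\<close> small of order
  \<open>M + 1\<close>; it is harmless for convergence, since a monomial acquires at most \<open>M\<close> times its degree as additional
  power of \<open>t\<close>. The substituted series is not formed: \<open>grade k\<close> is the pair of exponents of \<open>\<sigma>\<close> and \<open>t\<close> to
  which \<open>x\<^sup>k\<close> contributes, and \<open>part p\<close> reads off the coefficient of \<open>\<sigma>\<close> and \<open>t\<close> with exponents \<open>p\<close>.
\<close>
locale bigrading =
  fixes i :: "'v::finite" and a :: "complex^'v" and M :: nat
begin

definition wt :: "nat^'v \<Rightarrow> nat" where
  "wt k = mdeg k + M * k $ i"

definition grade :: "nat^'v \<Rightarrow> nat \<times> nat" where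
  "grade k = (k $ i, wt k)"

definition part :: "nat \<times> nat \<Rightarrow> ('v, complex) mfps \<Rightarrow> complex" where
  "part p F = (\<Sum>k | grade k = p. mfps_nth F k * mpow (($) a) k)"

lemma grade_add: "grade (k + l) = grade k + grade l"
  by (simp add: grade_def wt_def algebra_simps)

lemma mdeg_le_wt: "mdeg k \<le> wt k"
  by (simp add: wt_def)

lemma nth_le_wt: "k $ i \<le> wt k"
  by (simp add: wt_def trans_le_add1 le_mdeg)

lemma wt_eq_0_iff: "wt k = 0 \<longleftrightarrow> k = 0"
  by (auto simp: wt_def)

lemma finite_grade [simp]: "finite {k. grade k = p}"
  by (rule finite_subset[OF _ finite_mdeg_le[of "snd p"]]) (auto simp: grade_def mdeg_le_wt)

lemma part_cong: "(\<And>k. grade k = p \<Longrightarrow> mfps_nth F k = mfps_nth G k) \<Longrightarrow> part p F = part p G"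
  unfolding part_def by (rule sum.cong) auto

lemma part_eq_0: "(\<And>k. grade k = p \<Longrightarrow> mfps_nth F k = 0) \<Longrightarrow> part p F = 0"
  unfolding part_def by (rule sum.neutral) auto

lemma part_0 [simp]: "part p 0 = 0"
  by (rule part_eq_0) simp

lemma part_add: "part p (F + G) = part p F + part p G"
  by (simp add: part_def sum.distrib algebra_simps)

lemma part_diff: "part p (F - G) = part p F - part p G"
  by (simp add: part_def sum_subtractf algebra_simps)

lemma part_uminus: "part p (- F) = - part p F"
  by (simp add: part_def sum_negf)

lemma part_smult: "part p (mfps_smult c F) = c * part p F"
  by (simp add: part_def sum_distrib_left mult_ac)

lemma part_sum: "part p (sum f S) = (\<Sum>s\<in>S. part p (f s))"
  by (induction S rule: infinite_finite_induct) (auto simp: part_add)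

lemma part_eq_0_grade: "\<not> fst p \<le> snd p \<Longrightarrow> part p F = 0"
  by (rule part_eq_0) (auto simp: grade_def nth_le_wt)

lemma finite_pair_sum: "finite {(p1, p2). p1 + p2 = (p :: nat \<times> nat)}"
  by (rule finite_subset[of _ "({..fst p} \<times> {..snd p}) \<times> ({..fst p} \<times> {..snd p})"]) auto

text \<open>
  This is the multiplicativity of the substitution homomorphism.
\<close>
lemma part_mult: "part p (F * G) = (\<Sum>(p1, p2) | p1 + p2 = p. part p1 F * part p2 G)"
proof -
  let ?f = "\<lambda>x. mfps_nth F x * mpow (($) a) x" and ?g = "\<lambda>y. mfps_nth G y * mpow (($) a) y"
  have "part p (F * G) = (\<Sum>k | grade k = p. \<Sum>(x, y) | x + y = k. ?f x * ?g y)"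
    unfolding part_def mfps_nth_mult sum_distrib_right
    by (intro sum.cong refl) (auto simp: mpow_add mult_ac)
  also have "\<dots> = (\<Sum>(k, x, y) \<in> (SIGMA k:{k. grade k = p}. {(x, y). x + y = k}). ?f x * ?g y)"
    by (rule sum.Sigma) (simp_all add: finite_multiindex_sum)
  also have "\<dots> = (\<Sum>(pp, x, y) \<in> (SIGMA pp:{(p1, p2). p1 + p2 = p}.
      {x. grade x = fst pp} \<times> {y. grade y = snd pp}). ?f x * ?g y)"
    by (rule sum.reindex_bij_witness[where
          i = "\<lambda>((p1, p2), (x, y)). (x + y, x, y)" and
          j = "\<lambda>(k, x, y). ((grade x, grade y), (x, y))"]) (auto simp: grade_add)
  also have "\<dots> = (\<Sum>pp \<in> {(p1, p2). p1 + p2 = p}.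
      \<Sum>(x, y) \<in> {x. grade x = fst pp} \<times> {y. grade y = snd pp}. ?f x * ?g y)"
    by (rule sum.Sigma[symmetric]) (simp_all add: finite_pair_sum)
  also have "\<dots> = (\<Sum>(p1, p2) | p1 + p2 = p. part p1 F * part p2 G)"
    unfolding part_def sum_product sum.cartesian_product by (intro sum.cong) auto
  finally show ?thesis .
qed

text \<open>
  Divisibility of the substituted series by the \<open>N\<close>-th power of \<open>t\<close>.
\<close>
definition ord_ge :: "nat \<Rightarrow> ('v, complex) mfps \<Rightarrow> bool" where
  "ord_ge N F \<longleftrightarrow> (\<forall>p. snd p < N \<longrightarrow> part p F = 0)"

lemma ord_ge_0_left [simp]: "ord_ge 0 F"
  by (simp add: ord_ge_def)

lemma ord_ge_0 [simp]: "ord_ge N 0"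
  by (simp add: ord_ge_def)

lemma ord_ge_add: "ord_ge N F \<Longrightarrow> ord_ge N G \<Longrightarrow> ord_ge N (F + G)"
  by (simp add: ord_ge_def part_add)

lemma ord_ge_diff: "ord_ge N F \<Longrightarrow> ord_ge N G \<Longrightarrow> ord_ge N (F - G)"
  by (simp add: ord_ge_def part_diff)

lemma ord_ge_smult: "ord_ge N F \<Longrightarrow> ord_ge N (mfps_smult c F)"
  by (simp add: ord_ge_def part_smult)

lemma ord_ge_sum: "(\<And>s. s \<in> S \<Longrightarrow> ord_ge N (f s)) \<Longrightarrow> ord_ge N (sum f S)"
  by (simp add: ord_ge_def part_sum)

lemma ord_ge_mult:
  assumes "ord_ge N F" "ord_ge N' G"
  shows "ord_ge (N + N') (F * G)"
  unfolding ord_ge_def part_mult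
proof (intro allI impI sum.neutral ballI)
  fix p x :: "nat \<times> nat" and pp assume "snd p < N + N'" "pp \<in> {(p1, p2). p1 + p2 = p}"
  then have "snd (fst pp) < N \<or> snd (snd pp) < N'" by auto
  then show "(case pp of (p1, p2) \<Rightarrow> part p1 F * part p2 G) = 0"
    using assms by (auto simp: ord_ge_def split: prod.splits)
qed

lemma ord_ge_mult_left: "ord_ge N F \<Longrightarrow> ord_ge N (F * G)"
  using ord_ge_mult[of N F 0 G] by simp

lemma ord_ge_mult_right: "ord_ge N G \<Longrightarrow> ord_ge N (F * G)"
  using ord_ge_mult[of 0 F N G] by simp

lemma ord_ge_I: "(\<And>k. wt k < N \<Longrightarrow> mfps_nth F k = 0) \<Longrightarrow> ord_ge N F"
  unfolding ord_ge_def by (intro allI impI part_eq_0) (auto simp: grade_def)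

text \<open>
  The weighted \<open>\<ell>\<^sup>1\<close> norm of the substituted series, with \<open>\<sigma>\<close> weighted by \<open>1\<close> and \<open>t\<close> by \<open>r\<close>, truncated at the
  \<open>D\<close>-th power of \<open>t\<close>. The truncated norms of a formal series are finite, which permits induction on \<open>D\<close>; a bound
  independent of \<open>D\<close> is convergence. Non-zero parts have the exponent of \<open>\<sigma>\<close> at most that of \<open>t\<close>, so the
  index set is finite and nothing is lost.
\<close>
definition nrm :: "real \<Rightarrow> nat \<Rightarrow> ('v, complex) mfps \<Rightarrow> real" where
  "nrm r D F = (\<Sum>p | fst p \<le> snd p \<and> snd p \<le> D. norm (part p F) * r ^ snd p)"

lemma finite_grades [simp]: "finite {p. fst p \<le> snd p \<and> snd p \<le> (D::nat)}"
  by (rule finite_subset[of _ "{..D} \<times> {..D}"]) auto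

lemma nrm_nonneg: "0 \<le> r \<Longrightarrow> 0 \<le> nrm r D F"
  by (auto simp: nrm_def intro!: sum_nonneg)

lemma nrm_0 [simp]: "nrm r D 0 = 0"
  by (simp add: nrm_def)

lemma nrm_mono:
  assumes "0 \<le> r" "r \<le> s" "\<And>p. snd p \<le> D \<Longrightarrow> norm (part p F) \<le> norm (part p G)" "D \<le> D'"
  shows "nrm r D F \<le> nrm s D' G"
proof -
  have "nrm r D F \<le> nrm s D G"
    unfolding nrm_def by (intro sum_mono mult_mono power_mono) (use assms in auto)
  also have "\<dots> \<le> nrm s D' G"
    unfolding nrm_def by (intro sum_mono2) (use assms in auto)
  finally show ?thesis .
qed

lemma nrm_add_le: "0 \<le> r \<Longrightarrow> nrm r D (F + G) \<le> nrm r D F + nrm r D G"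
  unfolding nrm_def sum.distrib[symmetric] part_add
  by (intro sum_mono) (auto simp: distrib_right[symmetric] intro!: mult_right_mono norm_triangle_ineq)

lemma nrm_uminus [simp]: "nrm r D (- F) = nrm r D F"
  by (simp add: nrm_def part_uminus)

lemma nrm_diff_le: "0 \<le> r \<Longrightarrow> nrm r D (F - G) \<le> nrm r D F + nrm r D G"
  using nrm_add_le[of r D F "- G"] by simp

lemma nrm_smult: "nrm r D (mfps_smult c F) = norm c * nrm r D F"
  by (simp add: nrm_def part_smult norm_mult sum_distrib_left mult_ac)

lemma nrm_sum_le: "0 \<le> r \<Longrightarrow> nrm r D (sum f S) \<le> (\<Sum>s\<in>S. nrm r D (f s))"
proof (induction S rule: infinite_finite_induct)
  case (insert x S)
  then show ?case using nrm_add_le[of r D "f x" "sum f S"] by simp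
qed auto

lemma nrm_cong:
  assumes "\<And>k. mdeg k \<le> D \<Longrightarrow> mfps_nth F k = mfps_nth G k"
  shows "nrm r D F = nrm r D G"
proof -
  have "part p F = part p G" if "snd p \<le> D" for p
    by (rule part_cong, rule assms, rule order_trans[OF mdeg_le_wt]) (use that in \<open>auto simp: grade_def\<close>)
  then show ?thesis unfolding nrm_def by (intro sum.cong) auto
qed

text \<open>
  A factor divisible by a power of \<open>t\<close> lowers the level at which the other factor has to be known. This
  is the gain that makes the final recursion go from lower to higher levels.
\<close>
lemma nrm_mult_le:
  assumes r: "0 \<le> r" and F: "ord_ge N F" and G: "ord_ge N' G"
  shows "nrm r D (F * G) \<le> nrm r (D - N') F * nrm r (D - N) G"
proof -
  let ?T = "\<lambda>D. {p. fst p \<le> snd p \<and> snd p \<le> (D::nat)}"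
  let ?f = "\<lambda>p. norm (part p F) * r ^ snd p" and ?g = "\<lambda>p. norm (part p G) * r ^ snd p"
  let ?S = "SIGMA p:?T D. {(p1, p2). p1 + p2 = p}"
  have f0: "?f p = 0" if "\<not> (fst p \<le> snd p \<and> N \<le> snd p)" for p
    using F[unfolded ord_ge_def, rule_format, of p] part_eq_0_grade[of p F] that
    by (cases "fst p \<le> snd p") auto
  have g0: "?g p = 0" if "\<not> (fst p \<le> snd p \<and> N' \<le> snd p)" for p
    using G[unfolded ord_ge_def, rule_format, of p] part_eq_0_grade[of p G] that
    by (cases "fst p \<le> snd p") auto
  have "nrm r D (F * G) \<le> (\<Sum>p\<in>?T D. \<Sum>(p1, p2) | p1 + p2 = p. ?f p1 * ?g p2)"
    unfolding nrm_def
  proof (rule sum_mono)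
    fix p :: "nat \<times> nat"
    have "norm (part p (F * G)) * r ^ snd p \<le> (\<Sum>(p1, p2) | p1 + p2 = p. norm (part p1 F * part p2 G)) * r ^ snd p"
      unfolding part_mult by (intro mult_right_mono sum_norm_le) (use r in auto)
    also have "\<dots> = (\<Sum>(p1, p2) | p1 + p2 = p. ?f p1 * ?g p2)"
      unfolding sum_distrib_right by (intro sum.cong) (auto simp: norm_mult power_add)
    finally show "norm (part p (F * G)) * r ^ snd p \<le> (\<Sum>(p1, p2) | p1 + p2 = p. ?f p1 * ?g p2)" .
  qed
  also have "\<dots> = (\<Sum>(p, p1, p2) \<in> ?S. ?f p1 * ?g p2)"
    by (rule sum.Sigma) (simp_all add: finite_pair_sum)
  also have "\<dots> = (\<Sum>(p1, p2) \<in> {(p1, p2). p1 + p2 \<in> ?T D}. ?f p1 * ?g p2)"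
    by (rule sum.reindex_bij_witness[where i = "\<lambda>(p1, p2). (p1 + p2, p1, p2)" and j = "\<lambda>(p, p1, p2). (p1, p2)"]) auto
  also have "\<dots> = (\<Sum>(p1, p2) \<in> {(p1, p2). p1 + p2 \<in> ?T D} \<inter> ?T (D - N') \<times> ?T (D - N). ?f p1 * ?g p2)"
  proof (rule sum.mono_neutral_right)
    show "finite {(p1, p2). p1 + p2 \<in> ?T D}"
      by (rule finite_subset[of _ "({..D} \<times> {..D}) \<times> ({..D} \<times> {..D})"]) auto
    show "\<forall>x\<in>{(p1, p2). p1 + p2 \<in> ?T D} - {(p1, p2). p1 + p2 \<in> ?T D} \<inter> ?T (D - N') \<times> ?T (D - N).
        (case x of (p1, p2) \<Rightarrow> ?f p1 * ?g p2) = 0"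
    proof (intro ballI, clarify)
      fix x1 y1 x2 y2 :: nat
      assume *: "((x1, y1), (x2, y2)) \<notin> {(p1, p2). p1 + p2 \<in> ?T D} \<inter> ?T (D - N') \<times> ?T (D - N)"
        "fst ((x1, y1) + (x2, y2)) \<le> snd ((x1, y1) + (x2, y2))" "snd ((x1, y1) + (x2, y2)) \<le> D"
      show "?f (x1, y1) * ?g (x2, y2) = 0"
      proof (rule ccontr)
        assume "?f (x1, y1) * ?g (x2, y2) \<noteq> 0"
        then have "?f (x1, y1) \<noteq> 0" "?g (x2, y2) \<noteq> 0" by auto
        then have "fst (x1, y1) \<le> snd (x1, y1) \<and> N \<le> snd (x1, y1)"
          "fst (x2, y2) \<le> snd (x2, y2) \<and> N' \<le> snd (x2, y2)"
          using f0 g0 by blast+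
        then show False using * by auto
      qed
    qed
  qed auto
  also have "\<dots> \<le> (\<Sum>(p1, p2) \<in> ?T (D - N') \<times> ?T (D - N). ?f p1 * ?g p2)"
    by (rule sum_mono2) (use r in auto)
  also have "\<dots> = nrm r (D - N') F * nrm r (D - N) G"
    unfolding nrm_def sum_product sum.cartesian_product by simp
  finally show ?thesis .
qed

lemma nrm_mult_le': "0 \<le> r \<Longrightarrow> nrm r D (F * G) \<le> nrm r D F * nrm r D G"
  using nrm_mult_le[of r 0 F 0 G D] by simp

lemma part_1: "part p 1 = (if p = 0 then 1 else 0)"
proof (cases "p = 0")
  case True
  then have "{k. grade k = p} = {0}"
    by (auto simp: grade_def zero_prod_def wt_eq_0_iff)
  then show ?thesis using True by (simp add: part_def mfps_nth_1)
next
  case False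
  then have "part p 1 = 0"
    by (intro part_eq_0) (auto simp: mfps_nth_1 grade_def zero_prod_def wt_def)
  then show ?thesis using False by simp
qed

lemma nrm_1 [simp]: "nrm r D 1 = 1"
proof -
  have "nrm r D 1 = (\<Sum>p | fst p \<le> snd p \<and> snd p \<le> D. if p = 0 then 1 else 0)"
    unfolding nrm_def part_1 by (intro sum.cong) auto
  then show ?thesis by simp
qed

lemma nrm_mpow_le: "0 \<le> r \<Longrightarrow> nrm r D (mpow G l) \<le> mpow (\<lambda>w. nrm r D (G w)) l"
proof (induction l rule: multi_index_induct)
  case zero
  then show ?case by simp
next
  case (step l w)
  have "nrm r D (mpow G l * G w) \<le> nrm r D (mpow G l) * nrm r D (G w)"
    by (rule nrm_mult_le') (rule step)
  also have "\<dots> \<le> mpow (\<lambda>w. nrm r D (G w)) l * nrm r D (G w)"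
    by (intro mult_right_mono step nrm_nonneg)
  finally show ?case by (simp only: mpow_add mpow_axis power_one_right)
qed

lemma nrm_prod_le: "0 \<le> r \<Longrightarrow> nrm r D (prod f S) \<le> (\<Prod>s\<in>S. nrm r D (f s))"
proof (induction S rule: infinite_finite_induct)
  case (insert x S)
  then have "nrm r D (f x * prod f S) \<le> nrm r D (f x) * nrm r D (prod f S)"
    by (intro nrm_mult_le')
  also have "\<dots> \<le> nrm r D (f x) * (\<Prod>s\<in>S. nrm r D (f s))"
    by (intro mult_left_mono insert nrm_nonneg)
  finally show ?case using insert by simp
qed auto

text \<open>
  A series divisible by the \<open>N\<close>-th power of \<open>t\<close> has norm \<open>O(r\<^sup>N)\<close> as the radius tends to zero.
\<close>
lemma nrm_scale:
  assumes F: "ord_ge N F" and r: "0 \<le> r" "r \<le> s" "0 < s"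
  shows "nrm r D F \<le> (r / s) ^ N * nrm s D F"
  unfolding nrm_def sum_distrib_left
proof (rule sum_mono)
  fix p :: "nat \<times> nat"
  show "norm (part p F) * r ^ snd p \<le> (r / s) ^ N * (norm (part p F) * s ^ snd p)"
  proof (cases "snd p < N")
    case True
    then show ?thesis using F[unfolded ord_ge_def, rule_format, of p] by simp
  next
    case False
    have "(r / s) ^ snd p \<le> (r / s) ^ N"
      by (rule power_decreasing) (use False r in auto)
    then have "(r / s) ^ snd p * s ^ snd p \<le> (r / s) ^ N * s ^ snd p"
      by (rule mult_right_mono) (use r in auto)
    then have "r ^ snd p \<le> (r / s) ^ N * s ^ snd p"
      using r by (simp add: power_divide)
    then have "norm (part p F) * r ^ snd p \<le> norm (part p F) * ((r / s) ^ N * s ^ snd p)"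
      by (rule mult_left_mono) auto
    then show ?thesis by (simp add: mult_ac)
  qed
qed

lemma nrm_ord_ge_eq_0: "ord_ge N F \<Longrightarrow> D < N \<Longrightarrow> nrm r D F = 0"
  unfolding nrm_def by (rule sum.neutral) (auto simp: ord_ge_def)

lemma nrm_polynomial_le:
  assumes "mfps_nth F 0 = 0" "\<And>k. mfps_nth F k \<noteq> 0 \<Longrightarrow> wt k \<le> W" and r: "0 \<le> r" "r \<le> 1"
  shows "nrm r D F \<le> r * nrm 1 W F"
proof -
  have "ord_ge 1 F"
    by (rule ord_ge_I) (use assms(1) in \<open>auto simp: wt_eq_0_iff\<close>)
  from nrm_scale[OF this r, of D] have "nrm r D F \<le> r * nrm 1 D F" by simp
  also have "nrm 1 D F \<le> nrm 1 W F"
  proof -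
    have "part p F = 0" if "snd p > W" for p
      by (rule part_eq_0) (use assms(2) that in \<open>force simp: grade_def\<close>)
    then have "nrm 1 D F = (\<Sum>p | fst p \<le> snd p \<and> snd p \<le> min D W. norm (part p F) * 1 ^ snd p)"
      unfolding nrm_def by (intro sum.mono_neutral_right) (auto, metis not_less snd_conv)
    also have "\<dots> \<le> nrm 1 W F"
      unfolding nrm_def by (intro sum_mono2) auto
    finally show ?thesis .
  qed
  finally show ?thesis using r by (simp add: mult_left_mono)
qed

end

section \<open>Slices and division by a determinant\<close>

text \<open>
  The part of degree \<open>j\<close> in the variable \<open>x\<^sub>i\<close>, on which \<open>x\<^sub>i \<partial>/\<partial>x\<^sub>i\<close> is multiplication by \<open>j\<close>.
\<close>
definition mfps_slice :: "'v \<Rightarrow> nat \<Rightarrow> ('v::finite, complex) mfps \<Rightarrow> ('v, complex) mfps" where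
  "mfps_slice i j F = Abs_mfps (\<lambda>k. if k $ i = j then mfps_nth F k else 0)"

lemma mfps_nth_slice [simp]: "mfps_nth (mfps_slice i j F) k = (if k $ i = j then mfps_nth F k else 0)"
  by (simp add: mfps_slice_def)

lemma mfps_restrict0_eq_slice: "mfps_restrict0 i F = mfps_slice i 0 F"
  by (simp add: mfps_restrict0_def mfps_slice_def)

lemma mfps_slice_diff: "mfps_slice i j (F - G) = mfps_slice i j F - mfps_slice i j G"
  by (rule mfps_eqI) simp

lemma mfps_slice_sum: "mfps_slice i j (sum f S) = (\<Sum>s\<in>S. mfps_slice i j (f s))"
  by (rule mfps_eqI) simp

definition free_of :: "'v \<Rightarrow> ('v::finite, complex) mfps \<Rightarrow> bool" where
  "free_of i F \<longleftrightarrow> (\<forall>k. k $ i \<noteq> 0 \<longrightarrow> mfps_nth F k = 0)"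

lemma free_of_slice [simp]: "free_of i (mfps_slice i 0 F)"
  by (simp add: free_of_def)

lemma free_of_1 [simp]: "free_of i 1"
  by (auto simp: free_of_def mfps_nth_1)

lemma free_of_uminus: "free_of i F \<Longrightarrow> free_of i (- F)"
  by (simp add: free_of_def)

lemma free_of_diff: "free_of i F \<Longrightarrow> free_of i G \<Longrightarrow> free_of i (F - G)"
  by (simp add: free_of_def)

lemma free_of_sum: "(\<And>s. s \<in> S \<Longrightarrow> free_of i (f s)) \<Longrightarrow> free_of i (sum f S)"
  by (simp add: free_of_def)

lemma free_of_mult: "free_of i F \<Longrightarrow> free_of i G \<Longrightarrow> free_of i (F * G)"
  unfolding free_of_def mfps_nth_mult
  by (intro allI impI sum.neutral) auto

lemma free_of_prod: "(\<And>s. s \<in> S \<Longrightarrow> free_of i (f s)) \<Longrightarrow> free_of i (prod f S)"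
  by (induction S rule: infinite_finite_induct) (auto intro: free_of_mult)

lemma free_of_of_nat [simp]: "free_of i (of_nat n)"
proof -
  have "of_nat n = mfps_smult (of_nat n) (1 :: ('a, complex) mfps)"
    using of_nat_mult_eq_smult[of n 1] by simp
  then show ?thesis by (auto simp: free_of_def mfps_nth_1)
qed

lemma free_of_det:
  fixes X :: "('v::finite, complex) mfps^'n::finite^'n"
  assumes "\<And>a b. free_of i (X $ a $ b)"
  shows "free_of i (det X)"
  unfolding det_def
proof (intro free_of_sum free_of_mult free_of_prod assms)
  fix \<pi> :: "'n \<Rightarrow> 'n"
  show "free_of i (of_int (sign \<pi>))"
    by (cases \<pi> rule: sign_cases) (auto intro: free_of_uminus)
qed

lemma mfps_slice_mult:
  assumes "free_of i F"
  shows "mfps_slice i j (F * G) = F * mfps_slice i j G"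
proof (rule mfps_eqI)
  fix k
  have "mfps_nth (F * mfps_slice i j G) k =
      (\<Sum>(x, y) | x + y = k. if k $ i = j then mfps_nth F x * mfps_nth G y else 0)"
    unfolding mfps_nth_mult
    by (intro sum.cong refl) (use assms in \<open>auto simp: free_of_def\<close>)
  then show "mfps_nth (mfps_slice i j (F * G)) k = mfps_nth (F * mfps_slice i j G) k"
    by (simp add: mfps_nth_mult)
qed

lemma mfps_nth_X_mult:
  fixes F :: "('v::finite, complex) mfps"
  shows "mfps_nth (mfps_X i * F) k = (if k $ i = 0 then 0 else mfps_nth F (k - axis i 1))"
proof -
  have "mfps_nth (mfps_X i * F) k = (\<Sum>(x, y) | x + y = k. if x = axis i 1 then mfps_nth F y else 0)"
    unfolding mfps_nth_mult by (intro sum.cong) (auto simp: mfps_X_def)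
  also have "\<dots> = (if k $ i = 0 then 0 else mfps_nth F (k - axis i 1))"
  proof (cases "k $ i = 0")
    case True
    then have "(\<Sum>(x, y) | x + y = k. if x = axis i 1 then mfps_nth F y else 0) = 0"
      by (intro sum.neutral) auto
    then show ?thesis using True by simp
  next
    case False
    then have "(axis i 1, k - axis i 1) \<in> {(x, y). x + y = k}"
      using minus_axis_add[of k i] by (simp add: add.commute)
    then have "(\<Sum>(x, y) | x + y = k. if x = axis i 1 then mfps_nth F y else 0) =
        mfps_nth F (k - axis i 1) +
        (\<Sum>(x, y) \<in> {(x, y). x + y = k} - {(axis i 1, k - axis i 1)}. if x = axis i 1 then mfps_nth F y else 0)"
      by (subst sum.remove[OF finite_multiindex_sum]) auto
    also have "(\<Sum>(x, y) \<in> {(x, y). x + y = k} - {(axis i 1, k - axis i 1)}. if x = axis i 1 then mfps_nth F y else 0) = 0"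
      by (intro sum.neutral) (auto split: if_splits)
    finally show ?thesis using False by simp
  qed
  finally show ?thesis .
qed

lemma mfps_nth_euler:
  fixes F :: "('v::finite, complex) mfps"
  shows "mfps_nth (mfps_X i * mfps_deriv i F) k = of_nat (k $ i) * mfps_nth F k"
proof (cases "k $ i = 0")
  case False
  from minus_axis_add[OF this] have "k - axis i 1 + axis i 1 = k" .
  moreover have "(k - axis i 1) $ i + 1 = k $ i"
    using False by (simp add: axis_def)
  moreover have "mfps_nth (mfps_X i * mfps_deriv i F) k =
      of_nat ((k - axis i 1) $ i + 1) * mfps_nth F (k - axis i 1 + axis i 1)"
    using False by (simp add: mfps_nth_X_mult mfps_deriv_def)
  ultimately show ?thesis by simp
qed (simp add: mfps_nth_X_mult)

text \<open>
  Cramer's rule without division: the replaced column is a linear combination of the columns of \<open>X\<close>, and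
  all columns but one contribute a determinant with two equal columns.
\<close>
lemma cramer_comm_ring:
  fixes X :: "'a::comm_ring_1^'n::finite^'n"
  assumes "X *v v = h"
  shows "det X * v $ k = det (\<chi> a b. if b = k then h $ a else X $ a $ b)"
proof -
  let ?col = "\<lambda>b. (\<chi> a. X $ a $ b)"
  have h: "h = (\<Sum>c\<in>UNIV. v $ c *s ?col c)"
    unfolding assms[symmetric] by (simp add: vec_eq_iff matrix_vector_mult_def mult.commute)
  have "det (\<chi> a b. if b = k then h $ a else X $ a $ b) = det (\<chi> b. if b = k then h else ?col b)"
    by (subst det_transpose[symmetric]) (rule arg_cong[where f = det], auto simp: transpose_def vec_eq_iff)
  also have "\<dots> = (\<Sum>c\<in>UNIV. det (\<chi> b. if b = k then v $ c *s ?col c else ?col b))"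
    unfolding h by (rule det_linear_row_sum) simp
  also have "\<dots> = (\<Sum>c\<in>UNIV. v $ c * det (\<chi> b. if b = k then ?col c else ?col b))"
    by (simp only: det_row_mul)
  also have "\<dots> = (\<Sum>c\<in>UNIV. if c = k then v $ k * det X else 0)"
  proof (intro sum.cong refl)
    fix c
    show "v $ c * det (\<chi> b. if b = k then ?col c else ?col b) = (if c = k then v $ k * det X else 0)"
    proof (cases "c = k")
      case True
      then have "(\<chi> b. if b = k then ?col c else ?col b) = transpose X"
        by (auto simp: transpose_def vec_eq_iff)
      then show ?thesis using True by simp
    next
      case False
      have "det (\<chi> b. if b = k then ?col c else ?col b) = 0"
        by (rule det_identical_rows[OF False]) (use False in \<open>auto simp: row_def vec_eq_iff\<close>)
      then show ?thesis using False by simp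
    qed
  qed
  finally show ?thesis by (simp add: mult.commute)
qed

context bigrading
begin

lemma part_slice: "part p (mfps_slice i j F) = (if fst p = j then part p F else 0)"
  by (auto intro!: part_cong part_eq_0 simp: grade_def)

lemma sum_nrm_slice_le:
  assumes "0 \<le> r" "finite S"
  shows "(\<Sum>j\<in>S. nrm r D (mfps_slice i j F)) \<le> nrm r D F"
proof -
  have "(\<Sum>j\<in>S. nrm r D (mfps_slice i j F)) =
      (\<Sum>p | fst p \<le> snd p \<and> snd p \<le> D. \<Sum>j\<in>S. if fst p = j then norm (part p F) * r ^ snd p else 0)"
    unfolding nrm_def part_slice by (subst sum.swap) (intro sum.cong, auto)
  also have "\<dots> \<le> nrm r D F"
    unfolding nrm_def by (intro sum_mono) (use assms in auto)
  finally show ?thesis .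
qed

lemma nrm_le_sum_slice: "0 \<le> r \<Longrightarrow> nrm r D F \<le> (\<Sum>j\<le>D. nrm r D (mfps_slice i j F))"
proof -
  assume r: "0 \<le> r"
  have "nrm r D F = nrm r D (\<Sum>j\<le>D. mfps_slice i j F)"
  proof (rule nrm_cong)
    fix k :: "nat^'v" assume "mdeg k \<le> D"
    then have "k $ i \<le> D" using le_mdeg[of k i] by simp
    then show "mfps_nth F k = mfps_nth (\<Sum>j\<le>D. mfps_slice i j F) k" by simp
  qed
  also have "\<dots> \<le> (\<Sum>j\<le>D. nrm r D (mfps_slice i j F))"
    by (rule nrm_sum_le[OF r])
  finally show ?thesis .
qed

lemma ord_ge_slice: "ord_ge N F \<Longrightarrow> ord_ge N (mfps_slice i j F)"
  by (auto simp: ord_ge_def part_slice)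

lemma nrm_slice_le: "0 \<le> r \<Longrightarrow> nrm r D (mfps_slice i j F) \<le> nrm r D F"
  by (rule nrm_mono) (auto simp: part_slice)

lemma ord_ge_off_slice_0: "ord_ge (M + 1) (F - mfps_slice i 0 F)"
proof (rule ord_ge_I)
  fix k assume k: "wt k < M + 1"
  have "k $ i = 0"
  proof (rule ccontr)
    assume "k $ i \<noteq> 0"
    then obtain m where "k $ i = Suc m" by (cases "k $ i") auto
    then show False using k le_mdeg[of k i] by (simp add: wt_def)
  qed
  then show "mfps_nth (F - mfps_slice i 0 F) k = 0" by simp
qed

lemma nrm_off_slice_0_le: "0 \<le> r \<Longrightarrow> nrm r D (F - mfps_slice i 0 F) \<le> nrm r D F"
  by (rule nrm_mono) (auto simp: part_slice part_diff)

lemma part_euler: "part p (mfps_X i * mfps_deriv i F) = of_nat (fst p) * part p F"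
  unfolding part_def sum_distrib_left by (intro sum.cong) (auto simp: mfps_nth_euler grade_def)

lemma ord_ge_euler: "ord_ge N F \<Longrightarrow> ord_ge N (mfps_X i * mfps_deriv i F)"
  by (simp add: ord_ge_def part_euler)

lemma ord_ge_prod_diff:
  "(\<And>s. s \<in> S \<Longrightarrow> ord_ge N (f s - g s)) \<Longrightarrow> ord_ge N (prod f S - prod g S)"
proof (induction S rule: infinite_finite_induct)
  case (insert x S)
  have "prod f (insert x S) - prod g (insert x S) = (f x - g x) * prod f S + g x * (prod f S - prod g S)"
    using insert.hyps by (simp add: algebra_simps)
  moreover have "ord_ge N ((f x - g x) * prod f S + g x * (prod f S - prod g S))"
    using insert by (intro ord_ge_add ord_ge_mult_left ord_ge_mult_right[of _ _ "g x"]) auto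
  ultimately show ?case by simp
qed auto

lemma ord_ge_det_diff:
  fixes X Y :: "('v, complex) mfps^'n::finite^'n"
  assumes "\<And>a b. ord_ge N (X $ a $ b - Y $ a $ b)"
  shows "ord_ge N (det X - det Y)"
  unfolding det_def sum_subtractf[symmetric] right_diff_distrib[symmetric]
  by (intro ord_ge_sum ord_ge_mult_right ord_ge_prod_diff assms)

lemma nrm_sign_mult: "nrm r D (of_int (sign \<pi>) * F) = nrm r D F"
  by (cases \<pi> rule: sign_cases) auto

lemma nrm_det_le:
  fixes X :: "('v, complex) mfps^'n::finite^'n"
  assumes r: "0 \<le> r" and "\<And>a b. nrm r D (X $ a $ b) \<le> \<mu>"
  shows "nrm r D (det X) \<le> fact CARD('n) * \<mu> ^ CARD('n)"
proof -
  have "nrm r D (det X) \<le> (\<Sum>\<pi> | \<pi> permutes (UNIV :: 'n set). \<mu> ^ CARD('n))"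
    unfolding det_def
  proof (rule order_trans[OF nrm_sum_le[OF r] sum_mono])
    fix \<pi> :: "'n \<Rightarrow> 'n"
    have "nrm r D (\<Prod>a\<in>UNIV. X $ a $ \<pi> a) \<le> (\<Prod>a\<in>UNIV. nrm r D (X $ a $ \<pi> a))"
      by (rule nrm_prod_le[OF r])
    also have "\<dots> \<le> (\<Prod>a\<in>(UNIV :: 'n set). \<mu>)"
      by (intro prod_mono conjI assms nrm_nonneg[OF r])
    finally show "nrm r D (of_int (sign \<pi>) * (\<Prod>a\<in>UNIV. X $ a $ \<pi> a)) \<le> \<mu> ^ CARD('n)"
      by (simp add: nrm_sign_mult)
  qed
  also have "\<dots> = fact CARD('n) * \<mu> ^ CARD('n)"
    by (simp add: card_permutations[OF refl finite])
  finally show ?thesis .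
qed

lemma nrm_det_replace_column_le:
  fixes X :: "('v, complex) mfps^'n::finite^'n"
  assumes r: "0 \<le> r" and X: "\<And>a b. nrm r D (X $ a $ b) \<le> \<mu>" and \<mu>: "1 \<le> \<mu>"
  shows "nrm r D (det (\<chi> a b. if b = k then h $ a else X $ a $ b)) \<le>
           fact CARD('n) * \<mu> ^ CARD('n) * (\<Sum>a\<in>UNIV. nrm r D (h $ a))"
proof -
  let ?Y = "(\<chi> a b. if b = k then h $ a else X $ a $ b)" and ?H = "\<Sum>a\<in>UNIV. nrm r D (h $ a)"
  have "nrm r D (det ?Y) \<le> (\<Sum>\<pi> | \<pi> permutes (UNIV :: 'n set). \<mu> ^ CARD('n) * ?H)"
    unfolding det_def
  proof (rule order_trans[OF nrm_sum_le[OF r] sum_mono])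
    fix \<pi> :: "'n \<Rightarrow> 'n" assume "\<pi> \<in> {\<pi>. \<pi> permutes UNIV}"
    then have \<pi>: "bij \<pi>" by (simp add: permutes_bij)
    then obtain c where c: "\<pi> c = k" by (metis bij_pointE)
    have other: "\<pi> b \<noteq> k" if "b \<noteq> c" for b
      using that c bij_is_inj[OF \<pi>] by (metis injD)
    have "nrm r D (\<Prod>a\<in>UNIV. ?Y $ a $ \<pi> a) \<le> (\<Prod>a\<in>UNIV. nrm r D (?Y $ a $ \<pi> a))"
      by (rule nrm_prod_le[OF r])
    also have "\<dots> = nrm r D (?Y $ c $ \<pi> c) * (\<Prod>a\<in>UNIV - {c}. nrm r D (?Y $ a $ \<pi> a))"
      by (subst prod.remove[of UNIV c]) auto
    also have "\<dots> \<le> ?H * (\<Prod>a\<in>UNIV - {c}. \<mu>)"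
    proof (rule mult_mono)
      show "nrm r D (?Y $ c $ \<pi> c) \<le> ?H"
        using c member_le_sum[of c UNIV "\<lambda>a. nrm r D (h $ a)"] nrm_nonneg[OF r] by simp
      show "(\<Prod>a\<in>UNIV - {c}. nrm r D (?Y $ a $ \<pi> a)) \<le> (\<Prod>a\<in>UNIV - {c}. \<mu>)"
        by (intro prod_mono conjI nrm_nonneg[OF r]) (use other X in auto)
      show "0 \<le> ?H" by (intro sum_nonneg nrm_nonneg[OF r])
      show "0 \<le> (\<Prod>a\<in>UNIV - {c}. nrm r D (?Y $ a $ \<pi> a))" by (intro prod_nonneg nrm_nonneg[OF r])
    qed
    also have "\<dots> \<le> ?H * \<mu> ^ CARD('n)"
      by (intro mult_left_mono sum_nonneg nrm_nonneg[OF r]) (use \<mu> in \<open>auto intro: power_increasing\<close>)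
    finally show "nrm r D (of_int (sign \<pi>) * (\<Prod>a\<in>UNIV. ?Y $ a $ \<pi> a)) \<le> \<mu> ^ CARD('n) * ?H"
      by (simp add: nrm_sign_mult mult.commute)
  qed
  also have "\<dots> = fact CARD('n) * \<mu> ^ CARD('n) * ?H"
    by (simp add: card_permutations[OF refl finite])
  finally show ?thesis .
qed

text \<open>
  If \<open>\<Delta> = c t\<^sup>e + \<dots>\<close>, then dividing by \<open>\<Delta>\<close> costs the factor \<open>2 / (\<bar>c\<bar> r\<^sup>e)\<close> and \<open>e\<close> levels, for all radii \<open>r\<close> so
  small that the higher terms of \<open>\<Delta>\<close> weigh at most half of the leading one.
\<close>
lemma nrm_le_nrm_mult:
  assumes \<Delta>: "free_of i \<Delta>" "\<And>w. w < e \<Longrightarrow> part (0, w) \<Delta> = 0"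
    and B: "nrm s (D + e) \<Delta> \<le> B"
    and r: "0 < r" "r \<le> s" and small: "(r / s) ^ (e + 1) * B \<le> norm (part (0, e) \<Delta>) * r ^ e / 2"
  shows "norm (part (0, e) \<Delta>) * r ^ e * nrm r D v \<le> 2 * nrm r (D + e) (\<Delta> * v)"
proof -
  let ?T = "\<lambda>D. {p. fst p \<le> snd p \<and> snd p \<le> (D::nat)}"
  let ?c = "norm (part (0, e) \<Delta>)"
  let ?f = "\<lambda>p. if e < snd p then norm (part p \<Delta>) * r ^ snd p else 0" and ?g = "\<lambda>p. norm (part p v) * r ^ snd p"
  have \<Delta>0: "part p \<Delta> = 0" if "fst p \<noteq> 0 \<or> snd p < e" for p
  proof (cases "fst p = 0")
    case True
    then show ?thesis using that \<Delta>(2)[of "snd p"] by (cases p) auto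
  next
    case False
    then show ?thesis
      by (intro part_eq_0) (use \<Delta>(1) in \<open>auto simp: free_of_def grade_def\<close>)
  qed
  \<comment> \<open>The leading term of \<open>\<Delta>\<close> produces the coefficient of \<open>v\<close> at \<open>p\<close>; the other terms go into \<open>?f\<close>.\<close>
  have split: "?c * r ^ e * ?g p \<le> norm (part (p + (0, e)) (\<Delta> * v)) * r ^ snd (p + (0, e)) +
      (\<Sum>(p1, p2) | p1 + p2 = p + (0, e). ?f p1 * ?g p2)" for p
  proof -
    let ?S = "{(p1, p2). p1 + p2 = p + (0, e)}"
    have "part (p + (0, e)) (\<Delta> * v) = part (0, e) \<Delta> * part p v +
        (\<Sum>(p1, p2) \<in> ?S - {((0, e), p)}. part p1 \<Delta> * part p2 v)"
      unfolding part_mult by (subst sum.remove[of _ "((0, e), p)"]) (use finite_pair_sum in \<open>auto simp: add.commute\<close>)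
    also have "(\<Sum>(p1, p2) \<in> ?S - {((0, e), p)}. part p1 \<Delta> * part p2 v) =
        (\<Sum>(p1, p2) \<in> ?S. if e < snd p1 then part p1 \<Delta> * part p2 v else 0)"
    proof (rule sum.mono_neutral_cong_left)
      show "\<forall>x\<in>?S - (?S - {((0, e), p)}). (case x of (p1, p2) \<Rightarrow> if e < snd p1 then part p1 \<Delta> * part p2 v else 0) = 0"
        by auto
      fix x assume x: "x \<in> ?S - {((0, e), p)}"
      obtain p1 p2 where p12: "x = (p1, p2)" by (cases x)
      show "(case x of (p1, p2) \<Rightarrow> part p1 \<Delta> * part p2 v) =
         (case x of (p1, p2) \<Rightarrow> if e < snd p1 then part p1 \<Delta> * part p2 v else 0)"
      proof (cases "fst p1 \<noteq> 0 \<or> snd p1 < e")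
        case True
        then show ?thesis using \<Delta>0[OF True] p12 by simp
      next
        case False
        have "p1 \<noteq> (0, e)" using x p12 by (auto simp: add.commute)
        then have "e < snd p1" using False by (cases p1) auto
        then show ?thesis using p12 by simp
      qed
    qed (auto simp: finite_pair_sum)
    finally have eq: "part (0, e) \<Delta> * part p v = part (p + (0, e)) (\<Delta> * v) -
        (\<Sum>(p1, p2) \<in> ?S. if e < snd p1 then part p1 \<Delta> * part p2 v else 0)"
      by simp
    have "norm (part (0, e) \<Delta> * part p v) \<le> norm (part (p + (0, e)) (\<Delta> * v)) +
        (\<Sum>(p1, p2) \<in> ?S. norm (if e < snd p1 then part p1 \<Delta> * part p2 v else 0))"
      unfolding eq by (rule order_trans[OF norm_triangle_ineq4]) (auto intro!: sum_norm_le)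
    then have "norm (part (0, e) \<Delta> * part p v) * r ^ (snd p + e) \<le> (norm (part (p + (0, e)) (\<Delta> * v)) +
        (\<Sum>(p1, p2) \<in> ?S. norm (if e < snd p1 then part p1 \<Delta> * part p2 v else 0))) * r ^ (snd p + e)"
      by (rule mult_right_mono) (use r in auto)
    also have "\<dots> = norm (part (p + (0, e)) (\<Delta> * v)) * r ^ snd (p + (0, e)) + (\<Sum>(p1, p2) \<in> ?S. ?f p1 * ?g p2)"
      unfolding distrib_right sum_distrib_right
    proof (intro arg_cong2[where f = "(+)"] sum.cong refl)
      fix x assume x: "x \<in> ?S"
      obtain p1 p2 where p12: "x = (p1, p2)" by (cases x)
      have "snd p + e = snd p1 + snd p2" using x p12 by (auto dest: arg_cong[where f = snd])
      then show "(case x of (p1, p2) \<Rightarrow> norm (if e < snd p1 then part p1 \<Delta> * part p2 v else 0)) * r ^ (snd p + e) =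
          (case x of (p1, p2) \<Rightarrow> ?f p1 * ?g p2)"
        by (simp add: p12 norm_mult power_add mult_ac)
    qed auto
    finally show ?thesis by (simp add: norm_mult power_add mult_ac)
  qed
  have "?c * r ^ e * nrm r D v = (\<Sum>p\<in>?T D. ?c * r ^ e * ?g p)"
    by (simp add: nrm_def sum_distrib_left)
  also have "\<dots> \<le> (\<Sum>p\<in>?T D. norm (part (p + (0, e)) (\<Delta> * v)) * r ^ snd (p + (0, e))) +
      (\<Sum>p\<in>?T D. \<Sum>(p1, p2) | p1 + p2 = p + (0, e). ?f p1 * ?g p2)"
    unfolding sum.distrib[symmetric] by (rule sum_mono) (rule split)
  also have "(\<Sum>p\<in>?T D. norm (part (p + (0, e)) (\<Delta> * v)) * r ^ snd (p + (0, e))) =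
      (\<Sum>p\<in>(\<lambda>p. p + (0, e)) ` ?T D. norm (part p (\<Delta> * v)) * r ^ snd p)"
    by (subst sum.reindex) (auto intro!: inj_onI)
  also have "\<dots> \<le> nrm r (D + e) (\<Delta> * v)"
    unfolding nrm_def by (rule sum_mono2) (use r in auto)
  also have "(\<Sum>p\<in>?T D. \<Sum>(p1, p2) | p1 + p2 = p + (0, e). ?f p1 * ?g p2) =
      (\<Sum>(p, p1, p2) \<in> (SIGMA p:?T D. {(p1, p2). p1 + p2 = p + (0, e)}). ?f p1 * ?g p2)"
    by (rule sum.Sigma) (simp_all add: finite_pair_sum)
  also have "\<dots> = (\<Sum>(p1, p2) \<in> snd ` (SIGMA p:?T D. {(p1, p2). p1 + p2 = p + (0, e)}). ?f p1 * ?g p2)"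
    by (subst sum.reindex) (auto intro!: inj_onI simp: case_prod_unfold)
  also have "\<dots> \<le> (\<Sum>(p1, p2) \<in> ?T (D + e) \<times> ?T D. ?f p1 * ?g p2)"
  proof -
    let ?U = "snd ` (SIGMA p:?T D. {(p1, p2). p1 + p2 = p + (0, e)})"
    have finU: "finite ?U"
      by (intro finite_imageI finite_SigmaI finite_pair_sum) simp
    have "(\<Sum>(p1, p2) \<in> ?U. ?f p1 * ?g p2) = (\<Sum>(p1, p2) \<in> ?U \<inter> ?T (D + e) \<times> ?T D. ?f p1 * ?g p2)"
    proof (rule sum.mono_neutral_right[OF finU])
      show "\<forall>x\<in>?U - ?U \<inter> ?T (D + e) \<times> ?T D. (case x of (p1, p2) \<Rightarrow> ?f p1 * ?g p2) = 0"
      proof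
        fix x assume x: "x \<in> ?U - ?U \<inter> ?T (D + e) \<times> ?T D"
        obtain p1 p2 where p12: "x = (p1, p2)" by (cases x)
        obtain p where p: "p \<in> ?T D" "p1 + p2 = p + (0, e)" using x p12 by auto
        have s: "snd p1 + snd p2 = snd p + e" using p(2) by (auto dest: arg_cong[where f = snd])
        show "(case x of (p1, p2) \<Rightarrow> ?f p1 * ?g p2) = 0"
        proof (rule ccontr)
          assume "(case x of (p1, p2) \<Rightarrow> ?f p1 * ?g p2) \<noteq> 0"
          then have "e < snd p1" "part p1 \<Delta> \<noteq> 0" "part p2 v \<noteq> 0"
            using p12 by (auto split: if_splits)
          then have "fst p1 \<le> snd p1" "fst p2 \<le> snd p2" "e < snd p1"
            using part_eq_0_grade by blast+
          then have "(p1, p2) \<in> ?T (D + e) \<times> ?T D"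
            using s p(1) by auto
          then have "x \<in> ?T (D + e) \<times> ?T D" by (simp only: p12)
          with x show False by (meson DiffD1 DiffD2 IntI)
        qed
      qed
    qed auto
    also have "\<dots> \<le> (\<Sum>(p1, p2) \<in> ?T (D + e) \<times> ?T D. ?f p1 * ?g p2)"
      by (rule sum_mono2) (use r in auto)
    finally show ?thesis .
  qed
  also have "\<dots> = (\<Sum>p\<in>?T (D + e). ?f p) * nrm r D v"
    unfolding nrm_def sum_product sum.cartesian_product by simp
  also have "\<dots> \<le> (?c * r ^ e / 2) * nrm r D v"
  proof (rule mult_right_mono)
    have "(\<Sum>p\<in>?T (D + e). ?f p) \<le> (\<Sum>p\<in>?T (D + e). (r / s) ^ (e + 1) * (norm (part p \<Delta>) * s ^ snd p))"
    proof (rule sum_mono)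
      fix p :: "nat \<times> nat"
      show "?f p \<le> (r / s) ^ (e + 1) * (norm (part p \<Delta>) * s ^ snd p)"
      proof (cases "e < snd p")
        case True
        have "(r / s) ^ snd p \<le> (r / s) ^ (e + 1)"
          by (rule power_decreasing) (use True r in auto)
        then have "norm (part p \<Delta>) * ((r / s) ^ snd p * s ^ snd p) \<le> norm (part p \<Delta>) * ((r / s) ^ (e + 1) * s ^ snd p)"
          by (intro mult_left_mono mult_right_mono) (use r in auto)
        then show ?thesis using True r by (simp add: power_divide mult_ac)
      qed (use r in auto)
    qed
    also have "\<dots> = (r / s) ^ (e + 1) * nrm s (D + e) \<Delta>"
      by (simp add: nrm_def sum_distrib_left)
    also have "\<dots> \<le> (r / s) ^ (e + 1) * B"
      by (intro mult_left_mono B) (use r in auto)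
    finally show "(\<Sum>p\<in>?T (D + e). ?f p) \<le> ?c * r ^ e / 2" using small by linarith
    show "0 \<le> nrm r D v" using r by (intro nrm_nonneg) auto
  qed
  finally show ?thesis by (simp add: field_simps)
qed

end

section \<open>Composition to second order\<close>

text \<open>
  The terms of degree one in \<open>V\<close> of the monomial with exponent \<open>l\<close> at \<open>G + V\<close>.
\<close>
definition mpow_diff :: "('w::finite \<Rightarrow> 'a::comm_ring_1) \<Rightarrow> ('w \<Rightarrow> 'a) \<Rightarrow> nat^'w \<Rightarrow> 'a" where
  "mpow_diff G V l = (\<Sum>w\<in>UNIV. of_nat (l $ w) * (mpow G (l - axis w 1) * V w))"

definition mpow_rem :: "('w::finite \<Rightarrow> 'a::comm_ring_1) \<Rightarrow> ('w \<Rightarrow> 'a) \<Rightarrow> nat^'w \<Rightarrow> 'a" where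
  "mpow_rem G V l = mpow (\<lambda>w. G w + V w) l - mpow G l - mpow_diff G V l"

lemma mpow_step: "mpow G (l + axis v 1) = mpow G l * G v"
  by (simp only: mpow_add mpow_axis power_one_right)

lemma mpow_diff_0 [simp]: "mpow_diff G V 0 = 0"
  by (simp add: mpow_diff_def)

lemma mpow_rem_0 [simp]: "mpow_rem G V 0 = 0"
  by (simp add: mpow_rem_def)

lemma mpow_diff_step:
  "mpow_diff G V (l + axis v 1) = mpow_diff G V l * G v + mpow G l * V v"
proof -
  have "of_nat ((l + axis v 1) $ w) * (mpow G (l + axis v 1 - axis w 1) * V w) =
      of_nat (l $ w) * (mpow G (l - axis w 1) * V w) * G v + (if w = v then mpow G l * V v else 0)" for w
  proof (cases "w = v")
    case True
    have "of_nat (l $ v) * mpow G l = of_nat (l $ v) * (mpow G (l - axis v 1) * G v)"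
    proof (cases "l $ v = 0")
      case False
      then show ?thesis using mpow_step[of G "l - axis v 1" v] minus_axis_add[of l v] by simp
    qed simp
    moreover have "l + axis v 1 - axis v 1 = l" by simp
    moreover have "(l + axis v 1) $ v = l $ v + 1" by (simp add: axis_def)
    ultimately show ?thesis
      using True by (simp add: algebra_simps)
  next
    case False
    have "of_nat (l $ w) * mpow G (l + axis v 1 - axis w 1) = of_nat (l $ w) * (mpow G (l - axis w 1) * G v)"
    proof (cases "l $ w = 0")
      case l: False
      then have "l + axis v 1 - axis w 1 = l - axis w 1 + axis v 1"
        using False by (auto simp: vec_eq_iff axis_def)
      then show ?thesis by (simp only: mpow_step)
    qed simp
    moreover have "(l + axis v 1) $ w = l $ w" using False by (simp add: axis_def)
    ultimately show ?thesis
      using False by (simp add: mult_ac)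
  qed
  then show ?thesis
    by (simp add: mpow_diff_def sum.distrib sum_distrib_right)
qed

lemma mpow_rem_step:
  "mpow_rem G V (l + axis v 1) = mpow_rem G V l * (G v + V v) + mpow_diff G V l * V v"
  unfolding mpow_rem_def mpow_diff_step mpow_step by (simp add: algebra_simps)

definition compose_rem ::
    "('w::finite, complex) mfps \<Rightarrow> ('w \<Rightarrow> ('v::finite, complex) mfps) \<Rightarrow> ('w \<Rightarrow> ('v, complex) mfps) \<Rightarrow> ('v, complex) mfps" where
  "compose_rem F G V = mfps_compose F (\<lambda>w. G w + V w) - mfps_compose F G -
     (\<Sum>w\<in>UNIV. mfps_compose (mfps_deriv w F) G * V w)"

lemma mfps_nth_mult_cong:
  assumes "\<And>x. mdeg x \<le> mdeg k \<Longrightarrow> mfps_nth F x = mfps_nth F' x"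
  shows "mfps_nth (F * G) k = mfps_nth (F' * G) k"
  unfolding mfps_nth_mult by (intro sum.cong) (use assms in auto)

lemma sum_deriv_reindex:
  fixes H :: "nat^'w::finite \<Rightarrow> 'a::comm_monoid_add"
  assumes "\<And>l. l $ w = 0 \<Longrightarrow> H l = 0"
  shows "(\<Sum>l | mdeg l \<le> D. H (l + axis w 1)) = (\<Sum>l | mdeg l \<le> D + 1. H l)"
proof -
  have "(\<Sum>l | mdeg l \<le> D. H (l + axis w 1)) = (\<Sum>l | mdeg l \<le> D + 1 \<and> l $ w \<noteq> 0. H l)"
  proof (rule sum.reindex_bij_witness[where i = "\<lambda>l. l - axis w 1" and j = "\<lambda>l. l + axis w 1"])
    fix l :: "nat^'w" assume l: "l \<in> {l. mdeg l \<le> D + 1 \<and> l $ w \<noteq> 0}"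
    then show eq: "l - axis w 1 + axis w 1 = l" using minus_axis_add by auto
    have "mdeg (l - axis w 1 + axis w 1) \<le> D + 1" unfolding eq using l by simp
    then show "l - axis w 1 \<in> {l. mdeg l \<le> D}" by simp
  qed auto
  also have "\<dots> = (\<Sum>l | mdeg l \<le> D + 1. H l)"
    by (rule sum.mono_neutral_left) (use assms in auto)
  finally show ?thesis .
qed

lemma mfps_nth_compose_rem:
  assumes G: "\<And>w. mfps_nth (G w) 0 = 0" and V: "\<And>w. mfps_nth (V w) 0 = 0" and k: "mdeg k \<le> D"
  shows "mfps_nth (compose_rem F G V) k =
    mfps_nth (\<Sum>l | mdeg l \<le> D + 1. mfps_smult (mfps_nth F l) (mpow_rem G V l)) k"
proof -
  let ?L = "{l. mdeg l \<le> D + 1}"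
  have GV: "mfps_nth (G w + V w) 0 = 0" for w using G V by simp
  have k': "mdeg k \<le> D + 1" using k by simp
  have "mfps_nth (mfps_compose (mfps_deriv w F) G * V w) k =
      (\<Sum>l\<in>?L. mfps_nth F l * mfps_nth (of_nat (l $ w) * (mpow G (l - axis w 1) * V w)) k)" for w
  proof -
    have "mfps_nth (mfps_compose (mfps_deriv w F) G * V w) k =
        mfps_nth ((\<Sum>l | mdeg l \<le> D. mfps_smult (mfps_nth (mfps_deriv w F) l) (mpow G l)) * V w) k"
      by (rule mfps_nth_mult_cong, rule mfps_compose_truncate[OF G]) (use k in auto)
    also have "\<dots> = (\<Sum>l | mdeg l \<le> D. mfps_nth (mfps_deriv w F) l * mfps_nth (mpow G l * V w) k)"
      by (simp only: sum_distrib_right mfps_smult_mult_left mfps_nth_sum mfps_nth_smult)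
    also have "\<dots> = (\<Sum>l | mdeg l \<le> D. mfps_nth F (l + axis w 1) *
        (of_nat ((l + axis w 1) $ w) * mfps_nth (mpow G (l + axis w 1 - axis w 1) * V w) k))"
      by (intro sum.cong refl) (simp add: mfps_deriv_def axis_def)
    also have "\<dots> = (\<Sum>l\<in>?L. mfps_nth F l * (of_nat (l $ w) * mfps_nth (mpow G (l - axis w 1) * V w) k))"
      by (rule sum_deriv_reindex) simp
    finally show ?thesis by (simp add: of_nat_mult_eq_smult)
  qed
  then have "mfps_nth (compose_rem F G V) k =
      (\<Sum>l\<in>?L. mfps_nth F l * mfps_nth (mpow (\<lambda>w. G w + V w) l) k) - (\<Sum>l\<in>?L. mfps_nth F l * mfps_nth (mpow G l) k) -
      (\<Sum>w\<in>UNIV. \<Sum>l\<in>?L. mfps_nth F l * mfps_nth (of_nat (l $ w) * (mpow G (l - axis w 1) * V w)) k)"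
    by (simp add: compose_rem_def mfps_compose_truncate[of G, OF G k'] mfps_compose_truncate[of "\<lambda>w. G w + V w", OF GV k'])
  also have "(\<Sum>w\<in>UNIV. \<Sum>l\<in>?L. mfps_nth F l * mfps_nth (of_nat (l $ w) * (mpow G (l - axis w 1) * V w)) k) =
      (\<Sum>l\<in>?L. mfps_nth F l * mfps_nth (mpow_diff G V l) k)"
    by (subst sum.swap) (simp add: mpow_diff_def sum_distrib_left)
  finally show ?thesis
    by (simp add: mpow_rem_def sum_subtractf right_diff_distrib)
qed

lemma sum_coeff_bound:
  fixes c :: "nat^'w::finite \<Rightarrow> complex"
  assumes c: "\<And>l. norm (c l) \<le> K * C ^ mdeg l" and "0 \<le> C" "0 \<le> x" "C * x \<le> 1 / 2" and "finite S"
  shows "(\<Sum>l\<in>S. norm (c l) * x ^ mdeg l) \<le> K * 2 ^ CARD('w)"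
proof -
  have K: "0 \<le> K" using order_trans[OF norm_ge_zero c[of 0]] by simp
  have "(\<Sum>l\<in>S. norm (c l) * x ^ mdeg l) \<le> (\<Sum>l\<in>S. K * (1 / 2) ^ mdeg l)"
  proof (rule sum_mono)
    fix l
    have "norm (c l) * x ^ mdeg l \<le> (K * C ^ mdeg l) * x ^ mdeg l"
      by (intro mult_right_mono c) (use assms in auto)
    also have "\<dots> = K * (C * x) ^ mdeg l" by (simp add: power_mult_distrib)
    also have "\<dots> \<le> K * (1 / 2) ^ mdeg l"
      by (intro mult_left_mono power_mono K) (use assms in auto)
    finally show "norm (c l) * x ^ mdeg l \<le> K * (1 / 2) ^ mdeg l" .
  qed
  also have "\<dots> \<le> K * 2 ^ CARD('w)"
    unfolding sum_distrib_left[symmetric]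
    by (intro mult_left_mono K) (use sum_power_mdeg_le[of "1/2" S] \<open>finite S\<close> in simp)
  finally show ?thesis .
qed

context bigrading
begin

lemma ord_ge_mpow_add:
  assumes "\<And>w. ord_ge N (V w)"
  shows "ord_ge N (mpow (\<lambda>w. G w + V w) l - mpow G l)"
proof (induction l rule: multi_index_induct)
  case (step l v)
  have "mpow (\<lambda>w. G w + V w) (l + axis v 1) - mpow G (l + axis v 1) =
      (mpow (\<lambda>w. G w + V w) l - mpow G l) * (G v + V v) + mpow G l * V v"
    unfolding mpow_step by (simp add: algebra_simps)
  then show ?case
    by (simp only: ord_ge_add ord_ge_mult_left ord_ge_mult_right step assms)
qed simp

lemma ord_ge_mpow_diff: "(\<And>w. ord_ge N (V w)) \<Longrightarrow> ord_ge N (mpow_diff G V l)"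
  unfolding mpow_diff_def by (intro ord_ge_sum ord_ge_mult_right)

lemma ord_ge_mpow_rem: "(\<And>w. ord_ge N (V w)) \<Longrightarrow> ord_ge N (mpow_rem G V l)"
  unfolding mpow_rem_def by (intro ord_ge_diff ord_ge_mpow_add ord_ge_mpow_diff)

lemma nrm_mpow_diff_le:
  assumes r: "0 \<le> r" and \<eta>: "0 < \<eta>" and G: "\<And>w. nrm r D (G w) \<le> \<eta>" and V: "\<And>w. nrm r D (V w) \<le> U"
  shows "nrm r D (mpow_diff G V l) \<le> (2 * \<eta>) ^ mdeg l * (U / \<eta>)"
proof (induction l rule: multi_index_induct)
  case zero
  have "0 \<le> U" using order_trans[OF nrm_nonneg[OF r] V] .
  then show ?case using \<eta> by simp
next
  case (step l v)
  have U: "0 \<le> U" using order_trans[OF nrm_nonneg[OF r] V] .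
  have "nrm r D (mpow_diff G V (l + axis v 1)) \<le> nrm r D (mpow_diff G V l * G v) + nrm r D (mpow G l * V v)"
    unfolding mpow_diff_step by (rule nrm_add_le[OF r])
  also have "\<dots> \<le> nrm r D (mpow_diff G V l) * nrm r D (G v) + nrm r D (mpow G l) * nrm r D (V v)"
    by (intro add_mono nrm_mult_le' r)
  also have "\<dots> \<le> (2 * \<eta>) ^ mdeg l * (U / \<eta>) * \<eta> + \<eta> ^ mdeg l * U"
  proof (intro add_mono mult_mono step G V)
    have "nrm r D (mpow G l) \<le> mpow (\<lambda>w. nrm r D (G w)) l" by (rule nrm_mpow_le[OF r])
    also have "\<dots> \<le> mpow (\<lambda>w. \<eta>) l" by (intro mpow_mono nrm_nonneg r G)
    finally show "nrm r D (mpow G l) \<le> \<eta> ^ mdeg l" by simp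
  qed (use \<eta> U nrm_nonneg[OF r] in auto)
  also have "\<dots> = (2 ^ mdeg l + 1) * (\<eta> ^ mdeg l * U)"
    using \<eta> by (simp add: power_mult_distrib algebra_simps)
  also have "\<dots> \<le> (2 * 2 ^ mdeg l) * (\<eta> ^ mdeg l * U)"
    by (intro mult_right_mono) (use \<eta> U in auto)
  also have "\<dots> = (2 * \<eta>) ^ mdeg (l + axis v 1) * (U / \<eta>)"
    using \<eta> by (simp add: power_mult_distrib)
  finally show ?case .
qed

text \<open>
  The remainder is quadratic in \<open>V\<close>. When \<open>V\<close> is divisible by the \<open>N\<close>-th power of \<open>t\<close>, its level \<open>D + N\<close> is
  controlled by the level \<open>D\<close> of \<open>G\<close> and \<open>V\<close>: in each product of the recursion one of the factors is
  divisible by that power.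
\<close>
lemma nrm_mpow_rem_le:
  assumes r: "0 \<le> r" and \<eta>: "0 < \<eta>" and G: "\<And>w. nrm r D (G w) \<le> \<eta>"
    and V: "\<And>w. nrm r D (V w) \<le> U" "U \<le> \<eta>" and ordV: "\<And>w. ord_ge N (V w)"
  shows "nrm r (D + N) (mpow_rem G V l) \<le> (4 * \<eta>) ^ mdeg l * (U / \<eta>)\<^sup>2"
proof (induction l rule: multi_index_induct)
  case zero
  then show ?case by simp
next
  case (step l v)
  have U: "0 \<le> U" using order_trans[OF nrm_nonneg[OF r] V(1)] .
  have GV: "nrm r D (G v + V v) \<le> 2 * \<eta>"
    using nrm_add_le[OF r, of D "G v" "V v"] G[of v] V(1)[of v] V(2) by simp
  have "nrm r (D + N) (mpow_rem G V (l + axis v 1)) \<le>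
      nrm r (D + N) (mpow_rem G V l * (G v + V v)) + nrm r (D + N) (mpow_diff G V l * V v)"
    unfolding mpow_rem_step by (rule nrm_add_le[OF r])
  also have "\<dots> \<le> nrm r (D + N - 0) (mpow_rem G V l) * nrm r (D + N - N) (G v + V v) +
      nrm r (D + N - N) (mpow_diff G V l) * nrm r (D + N - N) (V v)"
    by (intro add_mono nrm_mult_le r ord_ge_mpow_rem ord_ge_mpow_diff ordV ord_ge_0_left)
  also have "\<dots> \<le> (4 * \<eta>) ^ mdeg l * (U / \<eta>)\<^sup>2 * (2 * \<eta>) + (2 * \<eta>) ^ mdeg l * (U / \<eta>) * U"
    unfolding diff_zero add_diff_cancel_right'
    by (intro add_mono mult_mono step GV V nrm_mpow_diff_le[OF r \<eta> G V(1)])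
       (use \<eta> U nrm_nonneg[OF r] in auto)
  also have "\<dots> = (2 * 4 ^ mdeg l + 2 ^ mdeg l) * (\<eta> ^ mdeg l * \<eta> * (U / \<eta>)\<^sup>2)"
    using \<eta> by (simp add: power_mult_distrib field_simps power2_eq_square)
  also have "\<dots> \<le> (4 * 4 ^ mdeg l) * (\<eta> ^ mdeg l * \<eta> * (U / \<eta>)\<^sup>2)"
  proof (rule mult_right_mono)
    have "(2::real) ^ mdeg l \<le> 4 ^ mdeg l" by (rule power_mono) auto
    then show "2 * 4 ^ mdeg l + 2 ^ mdeg l \<le> (4 * 4 ^ mdeg l :: real)"
      using zero_le_power[of "4::real" "mdeg l"] by linarith
  qed (use \<eta> in auto)
  also have "\<dots> = (4 * \<eta>) ^ mdeg (l + axis v 1) * (U / \<eta>)\<^sup>2"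
    by (simp add: power_mult_distrib)
  finally show ?case .
qed

lemma nrm_compose_le:
  fixes F :: "('w::finite, complex) mfps"
  assumes G0: "\<And>w. mfps_nth (G w) 0 = 0" and F: "\<And>l. norm (mfps_nth F l) \<le> K * C ^ mdeg l"
    and r: "0 \<le> r" and G: "\<And>w. nrm r D (G w) \<le> \<eta>" and C: "0 \<le> C" "C * \<eta> \<le> 1 / 2"
  shows "nrm r D (mfps_compose F G) \<le> K * 2 ^ CARD('w)"
proof -
  have \<eta>: "0 \<le> \<eta>" using order_trans[OF nrm_nonneg[OF r] G] .
  have "nrm r D (mfps_compose F G) = nrm r D (\<Sum>l | mdeg l \<le> D. mfps_smult (mfps_nth F l) (mpow G l))"
    by (rule nrm_cong, rule mfps_compose_truncate) (use G0 in auto)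
  also have "\<dots> \<le> (\<Sum>l | mdeg l \<le> D. norm (mfps_nth F l) * \<eta> ^ mdeg l)"
  proof (rule order_trans[OF nrm_sum_le[OF r] sum_mono])
    fix l
    have "nrm r D (mpow G l) \<le> mpow (\<lambda>w. nrm r D (G w)) l" by (rule nrm_mpow_le[OF r])
    also have "\<dots> \<le> mpow (\<lambda>w. \<eta>) l" by (intro mpow_mono nrm_nonneg r G)
    finally show "nrm r D (mfps_smult (mfps_nth F l) (mpow G l)) \<le> norm (mfps_nth F l) * \<eta> ^ mdeg l"
      by (simp add: nrm_smult mult_left_mono)
  qed
  also have "\<dots> \<le> K * 2 ^ CARD('w)"
    by (rule sum_coeff_bound[OF F C(1) \<eta> C(2)]) simp
  finally show ?thesis .
qed

lemma ord_ge_compose_diff: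
  assumes G0: "\<And>w. mfps_nth (G w) 0 = 0" and V0: "\<And>w. mfps_nth (V w) 0 = 0" and V: "\<And>w. ord_ge N (V w)"
  shows "ord_ge N (mfps_compose F (\<lambda>w. G w + V w) - mfps_compose F G)"
  unfolding ord_ge_def
proof (intro allI impI)
  fix p :: "nat \<times> nat" assume p: "snd p < N"
  let ?R = "\<Sum>l | mdeg l \<le> snd p. mfps_smult (mfps_nth F l) (mpow (\<lambda>w. G w + V w) l - mpow G l)"
  have GV0: "mfps_nth (G w + V w) 0 = 0" for w using G0 V0 by simp
  have "part p (mfps_compose F (\<lambda>w. G w + V w) - mfps_compose F G) = part p ?R"
  proof (rule part_cong)
    fix k assume "grade k = p"
    then have k: "mdeg k \<le> snd p" using mdeg_le_wt by (auto simp: grade_def)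
    show "mfps_nth (mfps_compose F (\<lambda>w. G w + V w) - mfps_compose F G) k = mfps_nth ?R k"
      by (simp add: mfps_compose_truncate[of G, OF G0 k] mfps_compose_truncate[of "\<lambda>w. G w + V w", OF GV0 k]
          sum_subtractf right_diff_distrib)
  qed
  also have "\<dots> = 0"
  proof -
    have "ord_ge N ?R" by (intro ord_ge_sum ord_ge_smult ord_ge_mpow_add V)
    then show ?thesis using p unfolding ord_ge_def by blast
  qed
  finally show "part p (mfps_compose F (\<lambda>w. G w + V w) - mfps_compose F G) = 0" .
qed

lemma ord_ge_compose_rem:
  assumes G0: "\<And>w. mfps_nth (G w) 0 = 0" and V0: "\<And>w. mfps_nth (V w) 0 = 0" and V: "\<And>w. ord_ge N (V w)"
  shows "ord_ge N (compose_rem F G V)"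
  unfolding compose_rem_def
  by (intro ord_ge_diff[OF ord_ge_compose_diff[OF assms]] ord_ge_sum ord_ge_mult_right V)

lemma nrm_compose_rem_le:
  fixes F :: "('w::finite, complex) mfps"
  assumes G0: "\<And>w. mfps_nth (G w) 0 = 0" and V0: "\<And>w. mfps_nth (V w) 0 = 0"
    and F: "\<And>l. norm (mfps_nth F l) \<le> K * C ^ mdeg l"
    and r: "0 \<le> r" and G: "\<And>w. nrm r D (G w) \<le> \<eta>" and C: "0 \<le> C" "C * (4 * \<eta>) \<le> 1 / 2" "0 < \<eta>"
    and V: "\<And>w. nrm r D (V w) \<le> U" "U \<le> \<eta>" "\<And>w. ord_ge N (V w)"
  shows "nrm r (D + N) (compose_rem F G V) \<le> K * 2 ^ CARD('w) * (U / \<eta>)\<^sup>2"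
proof -
  let ?L = "{l. mdeg l \<le> D + N + 1}"
  have "nrm r (D + N) (compose_rem F G V) = nrm r (D + N) (\<Sum>l\<in>?L. mfps_smult (mfps_nth F l) (mpow_rem G V l))"
    by (rule nrm_cong, rule mfps_nth_compose_rem[OF G0 V0])
  also have "\<dots> \<le> (\<Sum>l\<in>?L. norm (mfps_nth F l) * (4 * \<eta>) ^ mdeg l * (U / \<eta>)\<^sup>2)"
  proof (rule order_trans[OF nrm_sum_le[OF r] sum_mono])
    fix l
    show "nrm r (D + N) (mfps_smult (mfps_nth F l) (mpow_rem G V l)) \<le> norm (mfps_nth F l) * (4 * \<eta>) ^ mdeg l * (U / \<eta>)\<^sup>2"
      unfolding nrm_smult mult.assoc
      by (intro mult_left_mono nrm_mpow_rem_le[OF r C(3) G V]) auto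
  qed
  also have "\<dots> = (\<Sum>l\<in>?L. norm (mfps_nth F l) * (4 * \<eta>) ^ mdeg l) * (U / \<eta>)\<^sup>2"
    by (simp add: sum_distrib_right)
  also have "\<dots> \<le> K * 2 ^ CARD('w) * (U / \<eta>)\<^sup>2"
    by (intro mult_right_mono sum_coeff_bound[OF F C(1)]) (use C in auto)
  finally show ?thesis .
qed

end

section \<open>A uniform estimate for the linear systems\<close>

lemma finite_uniform_constants:
  fixes J :: nat
  assumes ex: "\<And>j. j < J \<Longrightarrow> \<exists>K s. 0 < s \<and> (\<forall>r. 0 < r \<longrightarrow> r \<le> s \<longrightarrow> P j K r)"
    and mono: "\<And>j K K' r. P j K r \<Longrightarrow> K \<le> K' \<Longrightarrow> P j K' r" and "0 < s0"
  shows "\<exists>K s. 1 \<le> (K::real) \<and> 0 < s \<and> s \<le> (s0::real) \<and> (\<forall>j<J. \<forall>r. 0 < r \<longrightarrow> r \<le> s \<longrightarrow> P j K r)"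
  using ex
proof (induction J)
  case 0
  then show ?case using \<open>0 < s0\<close> by (intro exI[of _ 1] exI[of _ s0]) auto
next
  case (Suc J)
  have "\<exists>K s. 1 \<le> K \<and> 0 < s \<and> s \<le> s0 \<and> (\<forall>j<J. \<forall>r. 0 < r \<longrightarrow> r \<le> s \<longrightarrow> P j K r)"
    by (rule Suc.IH) (use Suc.prems in auto)
  then obtain K s where K: "1 \<le> K" "0 < s" "s \<le> s0" "\<And>j r. j < J \<Longrightarrow> 0 < r \<Longrightarrow> r \<le> s \<Longrightarrow> P j K r" by blast
  from Suc.prems[of J] obtain K' s' where K': "0 < s'" "\<And>r. 0 < r \<Longrightarrow> r \<le> s' \<Longrightarrow> P J K' r" by blast
  have "P j (max K K') r" if "j < Suc J" "0 < r" "r \<le> min s s'" for j r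
  proof (cases "j = J")
    case True
    then show ?thesis using mono[OF K'(2), of r] that by simp
  next
    case False
    then show ?thesis using mono[OF K(4), of j r] that by simp
  qed
  then show ?case using K K' by (intro exI[of _ "max K K'"] exI[of _ "min s s'"]) auto
qed

context bigrading
begin

lemma nrm_of_nat [simp]: "nrm r D (of_nat j) = real j"
  using nrm_smult[of r D "of_nat j" 1] of_nat_mult_eq_smult[of j "1 :: ('v, complex) mfps"] by simp

lemma free_of_det_minus_mat:
  fixes B :: "('v, complex) mfps^'n::finite^'n"
  assumes "\<And>b c. free_of i (B $ b $ c)"
  shows "free_of i (det (B - mat (of_nat j)))"
proof (rule free_of_det)
  show "free_of i ((B - mat (of_nat j)) $ b $ c)" for b c
    by (auto simp: mat_def free_of_def[of _ 0] intro!: free_of_diff assms)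
qed

text \<open>
  For a single \<open>j\<close>: Cramer's rule expresses \<open>det (B - j) v\<close> by \<open>h\<close>, and the determinant is divided out at the
  cost of its order \<open>e'\<close> in \<open>t\<close>.
\<close>
lemma linear_system_estimate_small:
  fixes B :: "('v, complex) mfps^'n::finite^'n"
  assumes free: "\<And>b c. free_of i (B $ b $ c)" and s: "0 < s" "s \<le> 1"
    and B: "\<And>D b c. nrm s D (B $ b $ c) \<le> \<beta>"
    and e': "e' \<le> e" "\<And>w. w < e' \<Longrightarrow> part (0, w) (det (B - mat (of_nat j))) = 0"
      "part (0, e') (det (B - mat (of_nat j))) \<noteq> 0"
  shows "\<exists>K s. 0 < s \<and> (\<forall>r. 0 < r \<longrightarrow> r \<le> s \<longrightarrow> (\<forall>D v h.
      (\<forall>b. of_nat j * v $ b - (\<Sum>c\<in>UNIV. B $ b $ c * v $ c) = h $ b) \<longrightarrow>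
      r ^ e * (\<Sum>b\<in>UNIV. nrm r D (v $ b)) \<le> K * (\<Sum>b\<in>UNIV. nrm r (D + e) (h $ b))))"
proof -
  let ?X = "B - mat (of_nat j)"
  let ?n = "CARD('n)"
  define \<mu> where "\<mu> = \<beta> + real j + 1"
  define \<Gamma> where "\<Gamma> = fact ?n * \<mu> ^ ?n"
  define c where "c = norm (part (0, e') (det ?X))"
  have c: "c > 0" using e'(3) by (simp add: c_def)
  have \<beta>: "0 \<le> \<beta>" by (rule order_trans[OF nrm_nonneg B]) (use s in simp)
  have \<mu>: "1 \<le> \<mu>" using \<beta> by (simp add: \<mu>_def)
  have \<Gamma>: "0 < \<Gamma>" using \<mu> by (simp add: \<Gamma>_def)
  have X: "nrm r D (?X $ a' $ b) \<le> \<mu>" if "0 \<le> r" "r \<le> s" for r D a' b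
  proof -
    have "nrm r D (?X $ a' $ b) \<le> nrm r D (B $ a' $ b) + nrm r D (mat (of_nat j) $ a' $ b)"
      by (simp add: nrm_diff_le that)
    also have "nrm r D (B $ a' $ b) \<le> nrm s D (B $ a' $ b)"
      by (rule nrm_mono) (use that in auto)
    also have "\<dots> \<le> \<beta>" by (rule B)
    also have "nrm r D (mat (of_nat j) $ a' $ b) \<le> real j" by (simp add: mat_def)
    finally show ?thesis by (simp add: \<mu>_def)
  qed
  define s' where "s' = min s (c * s ^ (e' + 1) / (2 * \<Gamma>))"
  have s': "0 < s'" "s' \<le> s" using c s \<Gamma> by (auto simp: s'_def)
  define K where "K = real ?n * (2 * \<Gamma> / c)"
  have "r ^ e * (\<Sum>b\<in>UNIV. nrm r D (v $ b)) \<le> K * (\<Sum>b\<in>UNIV. nrm r (D + e) (h $ b))"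
    if r: "0 < r" "r \<le> s'" and sys: "\<forall>b. of_nat j * v $ b - (\<Sum>c\<in>UNIV. B $ b $ c * v $ c) = h $ b" for r D v h
  proof -
    have r1: "r \<le> 1" "r \<le> s" using r s' s by auto
    let ?H = "\<Sum>b\<in>UNIV. nrm r (D + e) (h $ b)"
    have Xv: "?X *v v = - h"
    proof -
      have "(?X *v v) $ b = - (h $ b)" for b
      proof -
        have "(?X *v v) $ b = (\<Sum>c\<in>UNIV. B $ b $ c * v $ c - (if b = c then of_nat j * v $ c else 0))"
          unfolding matrix_vector_mult_def by (auto simp: mat_def algebra_simps intro!: sum.cong)
        also have "\<dots> = (\<Sum>c\<in>UNIV. B $ b $ c * v $ c) - of_nat j * v $ b"
          by (simp add: sum_subtractf)
        finally show ?thesis by (simp add: sys[rule_format, symmetric])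
      qed
      then show ?thesis by (simp add: vec_eq_iff)
    qed
    have "r ^ e * nrm r D (v $ k) \<le> (2 * \<Gamma> / c) * ?H" for k
    proof -
      have "c * r ^ e' * nrm r D (v $ k) \<le> 2 * nrm r (D + e') (det ?X * v $ k)"
        unfolding c_def
      proof (rule nrm_le_nrm_mult)
        show "free_of i (det ?X)" by (rule free_of_det_minus_mat[OF free])
        show "nrm s (D + e') (det ?X) \<le> \<Gamma>"
          unfolding \<Gamma>_def by (rule nrm_det_le) (use X s in auto)
        have "(r / s) ^ (e' + 1) * \<Gamma> = r ^ e' * (r * \<Gamma> / s ^ (e' + 1))"
          by (simp add: power_divide)
        also have "\<dots> \<le> r ^ e' * (c / 2)"
        proof (rule mult_left_mono)
          have "r \<le> c * s ^ (e' + 1) / (2 * \<Gamma>)" using r by (simp add: s'_def)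
          then show "r * \<Gamma> / s ^ (e' + 1) \<le> c / 2"
            using \<Gamma> s by (simp add: field_simps)
        qed (use r in auto)
        finally show "(r / s) ^ (e' + 1) * \<Gamma> \<le> norm (part (0, e') (det ?X)) * r ^ e' / 2"
          by (simp add: c_def mult.commute)
      qed (use e' r r1 in auto)
      also have "det ?X * v $ k = det (\<chi> a b. if b = k then (- h) $ a else ?X $ a $ b)"
        by (rule cramer_comm_ring[OF Xv])
      also have "nrm r (D + e') \<dots> \<le> \<Gamma> * (\<Sum>b\<in>UNIV. nrm r (D + e') ((- h) $ b))"
        unfolding \<Gamma>_def by (rule nrm_det_replace_column_le) (use X r r1 \<mu> in auto)
      also have "(\<Sum>b\<in>UNIV. nrm r (D + e') ((- h) $ b)) \<le> ?H"
        by (rule sum_mono) (use r e' in \<open>auto intro: nrm_mono\<close>)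
      finally have "c * r ^ e' * nrm r D (v $ k) \<le> 2 * (\<Gamma> * ?H)"
        using \<Gamma> by (simp add: mult_left_mono)
      then have "r ^ e' * nrm r D (v $ k) \<le> (2 * \<Gamma> / c) * ?H"
        using c by (simp add: field_simps)
      moreover have "r ^ e * nrm r D (v $ k) \<le> r ^ e' * nrm r D (v $ k)"
        by (intro mult_right_mono power_decreasing nrm_nonneg) (use r r1 e' in auto)
      ultimately show ?thesis by linarith
    qed
    then have "(\<Sum>k\<in>UNIV. r ^ e * nrm r D (v $ k)) \<le> (\<Sum>k\<in>(UNIV :: 'n set). (2 * \<Gamma> / c) * ?H)"
      by (intro sum_mono)
    then show ?thesis by (simp add: sum_distrib_left[symmetric] K_def)
  qed
  then show ?thesis using s'(1) by blast
qed

text \<open>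
  When \<open>j\<close> exceeds the norm of \<open>B\<close>, the term \<open>j v\<close> dominates and there is no loss.
\<close>
lemma linear_system_estimate_large:
  fixes B :: "('v, complex) mfps^'n::finite^'n"
  assumes B: "\<And>b c. nrm r D (B $ b $ c) \<le> \<beta>" and j: "real CARD('n) * \<beta> + 1 \<le> real j" and r: "0 < r" "r \<le> 1"
    and sys: "\<forall>b. of_nat j * v $ b - (\<Sum>c\<in>UNIV. B $ b $ c * v $ c) = h $ b"
  shows "r ^ e * (\<Sum>b\<in>UNIV. nrm r D (v $ b)) \<le> (\<Sum>b\<in>UNIV. nrm r (D + e) (h $ b))"
proof -
  let ?V = "\<Sum>b\<in>UNIV. nrm r D (v $ b)" and ?H = "\<Sum>b\<in>UNIV. nrm r D (h $ b)"
  have V: "0 \<le> ?V" using r by (intro sum_nonneg nrm_nonneg) auto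
  have "real j * nrm r D (v $ b) \<le> nrm r D (h $ b) + \<beta> * ?V" for b
  proof -
    have "real j * nrm r D (v $ b) = nrm r D (h $ b + (\<Sum>c\<in>UNIV. B $ b $ c * v $ c))"
      using nrm_smult[of r D "of_nat j" "v $ b"] sys[rule_format, of b, symmetric]
      by (simp add: of_nat_mult_eq_smult)
    also have "\<dots> \<le> nrm r D (h $ b) + (\<Sum>c\<in>UNIV. nrm r D (B $ b $ c) * nrm r D (v $ c))"
      using r by (intro order_trans[OF nrm_add_le] add_left_mono order_trans[OF nrm_sum_le] sum_mono nrm_mult_le') auto
    also have "\<dots> \<le> nrm r D (h $ b) + (\<Sum>c\<in>UNIV. \<beta> * nrm r D (v $ c))"
      using r by (intro add_left_mono sum_mono mult_right_mono B nrm_nonneg) auto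
    finally show ?thesis by (simp add: sum_distrib_left)
  qed
  then have "(\<Sum>b\<in>UNIV. real j * nrm r D (v $ b)) \<le> (\<Sum>b\<in>(UNIV :: 'n set). nrm r D (h $ b) + \<beta> * ?V)"
    by (intro sum_mono)
  then have "real j * ?V \<le> ?H + real CARD('n) * \<beta> * ?V"
    by (simp add: sum.distrib sum_distrib_left mult.assoc)
  moreover have "(real CARD('n) * \<beta> + 1) * ?V \<le> real j * ?V"
    by (rule mult_right_mono[OF j V])
  ultimately have "?V \<le> ?H" by (simp add: algebra_simps)
  also have "?H \<le> (\<Sum>b\<in>UNIV. nrm r (D + e) (h $ b))"
    using r by (intro sum_mono nrm_mono) auto
  finally have "?V \<le> (\<Sum>b\<in>UNIV. nrm r (D + e) (h $ b))" .
  moreover have "r ^ e * ?V \<le> 1 * ?V"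
    by (intro mult_right_mono V power_le_one) (use r in auto)
  ultimately show ?thesis by linarith
qed

text \<open>
  Constant, radius and the loss of \<open>e\<close> levels are uniform in \<open>j\<close>: all but finitely many \<open>j\<close> are large.
\<close>
lemma linear_system_estimate:
  fixes B :: "('v, complex) mfps^'n::finite^'n"
  assumes free: "\<And>b c. free_of i (B $ b $ c)" and s: "0 < s" "s \<le> 1"
    and B: "\<And>D b c. nrm s D (B $ b $ c) \<le> \<beta>"
    and J: "real CARD('n) * \<beta> + 1 \<le> real J"
    and det: "\<And>j. j < J \<Longrightarrow> \<exists>e'\<le>e. (\<forall>w<e'. part (0, w) (det (B - mat (of_nat j))) = 0) \<and>
      part (0, e') (det (B - mat (of_nat j))) \<noteq> 0"
  shows "\<exists>K s'. 1 \<le> K \<and> 0 < s' \<and> s' \<le> s \<and> (\<forall>j r D v h. 0 < r \<longrightarrow> r \<le> s' \<longrightarrow>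
      (\<forall>b. of_nat j * v $ b - (\<Sum>c\<in>UNIV. B $ b $ c * v $ c) = h $ b) \<longrightarrow>
      r ^ e * (\<Sum>b\<in>UNIV. nrm r D (v $ b)) \<le> K * (\<Sum>b\<in>UNIV. nrm r (D + e) (h $ b)))"
proof -
  define P where "P = (\<lambda>j K r. \<forall>D (v::('v, complex) mfps^'n) h. 0 < r \<longrightarrow>
      (\<forall>b. of_nat j * v $ b - (\<Sum>c\<in>UNIV. B $ b $ c * v $ c) = h $ b) \<longrightarrow>
      r ^ e * (\<Sum>b\<in>UNIV. nrm r D (v $ b)) \<le> K * (\<Sum>b\<in>UNIV. nrm r (D + e) (h $ b)))"
  have "\<exists>K s'. 1 \<le> K \<and> 0 < s' \<and> s' \<le> s \<and> (\<forall>j<J. \<forall>r. 0 < r \<longrightarrow> r \<le> s' \<longrightarrow> P j K r)"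
  proof (rule finite_uniform_constants[OF _ _ s(1)])
    fix j assume "j < J"
    from det[OF this] obtain e' where e': "e' \<le> e" "\<And>w. w < e' \<Longrightarrow> part (0, w) (det (B - mat (of_nat j))) = 0"
      "part (0, e') (det (B - mat (of_nat j))) \<noteq> 0" by blast
    show "\<exists>K s. 0 < s \<and> (\<forall>r. 0 < r \<longrightarrow> r \<le> s \<longrightarrow> P j K r)"
      using linear_system_estimate_small[OF free s B e'] unfolding P_def by blast
  next
    fix j K K' r assume P: "P j K r" and K: "K \<le> (K' :: real)"
    show "P j K' r"
      unfolding P_def
    proof (intro allI impI)
      fix D and v h :: "('v, complex) mfps^'n"
      assume *: "0 < r" "\<forall>b. of_nat j * v $ b - (\<Sum>c\<in>UNIV. B $ b $ c * v $ c) = h $ b"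
      have "r ^ e * (\<Sum>b\<in>UNIV. nrm r D (v $ b)) \<le> K * (\<Sum>b\<in>UNIV. nrm r (D + e) (h $ b))"
        using P * unfolding P_def by blast
      also have "\<dots> \<le> K' * (\<Sum>b\<in>UNIV. nrm r (D + e) (h $ b))"
        by (intro mult_right_mono K sum_nonneg nrm_nonneg) (use * in auto)
      finally show "r ^ e * (\<Sum>b\<in>UNIV. nrm r D (v $ b)) \<le> K' * (\<Sum>b\<in>UNIV. nrm r (D + e) (h $ b))" .
    qed
  qed
  then obtain K s' where K: "1 \<le> K" "0 < s'" "s' \<le> s"
    and P: "\<And>j r. j < J \<Longrightarrow> 0 < r \<Longrightarrow> r \<le> s' \<Longrightarrow> P j K r" by blast
  have "r ^ e * (\<Sum>b\<in>UNIV. nrm r D (v $ b)) \<le> K * (\<Sum>b\<in>UNIV. nrm r (D + e) (h $ b))"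
    if r: "0 < r" "r \<le> s'" and sys: "\<forall>b. of_nat j * v $ b - (\<Sum>c\<in>UNIV. B $ b $ c * v $ c) = h $ b"
    for j r D v h
  proof (cases "j < J")
    case True
    then show ?thesis using P[OF True r] r sys unfolding P_def by blast
  next
    case False
    have "r ^ e * (\<Sum>b\<in>UNIV. nrm r D (v $ b)) \<le> (\<Sum>b\<in>UNIV. nrm r (D + e) (h $ b))"
    proof (rule linear_system_estimate_large[OF _ _ _ _ sys])
      show "nrm r D (B $ b $ c) \<le> \<beta>" for b c
        by (rule order_trans[OF nrm_mono B]) (use r K in auto)
    qed (use J False r K s in auto)
    also have "\<dots> \<le> K * (\<Sum>b\<in>UNIV. nrm r (D + e) (h $ b))"
    proof -
      have "0 \<le> (\<Sum>b\<in>UNIV. nrm r (D + e) (h $ b))"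
        using r by (intro sum_nonneg nrm_nonneg) auto
      from mult_right_mono[OF K(1) this] show ?thesis by simp
    qed
    finally show ?thesis .
  qed
  then show ?thesis using K by blast
qed

end

section \<open>Convergence along a generic direction\<close>

text \<open>
  The final recursion bounds \<open>r\<^sup>e\<close> times the norm of the solution by the left-hand side, if lower levels are
  bounded by \<open>R\<close>. With \<open>R\<close> of size \<open>r\<^bsup>e + 1\<^esup>\<close> the first term is half of \<open>r\<^sup>e R\<close> or less, and the other two carry an
  additional factor \<open>r\<close>. This is why the exponent has to be \<open>2e + 1\<close>.
\<close>
lemma small_radius:
  fixes c1 c2 c3 \<eta> s :: real
  assumes "0 \<le> c1" "0 \<le> c2" "0 \<le> c3" "0 < \<eta>" "0 < s" "s \<le> 1"
  obtains r R where "0 < r" "r \<le> s" "0 \<le> R" "R \<le> \<eta>"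
    "c1 * r ^ (2 * e + 1) + c2 * r ^ (2 * e + 1) * R + c3 * R\<^sup>2 \<le> r ^ e * R"
proof -
  define L where "L = 2 * c1 + 1"
  define Z where "Z = L / \<eta> + 4 * c2 + 4 * c3 * L + 1"
  define r where "r = min s (1 / Z)"
  define R where "R = r ^ (e + 1) * L"
  have L: "0 < L" "L / \<eta> \<ge> 0" "4 * c3 * L \<ge> 0" using assms by (auto simp: L_def)
  have Z: "0 < Z" using assms L by (simp add: Z_def add_nonneg_pos)
  have r: "0 < r" "r \<le> s" "r \<le> 1" using assms Z by (auto simp: r_def)
  have "r \<le> 1 / Z" by (simp add: r_def)
  then have rZ: "r * Z \<le> 1" using Z by (simp add: field_simps)
  have *: "r * x \<le> 1" if "x \<le> Z" for x
    using mult_left_mono[OF that, of r] r rZ by linarith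
  have e1: "r ^ (e + 1) \<le> r" using power_decreasing[of 1 "e + 1" r] r by simp
  have R0: "0 \<le> R" using r L by (simp add: R_def)
  have "R \<le> r * L" unfolding R_def by (rule mult_right_mono[OF e1]) (use L in simp)
  also have "r * L \<le> \<eta>" using *[of "L / \<eta>"] L assms by (simp add: Z_def field_simps)
  finally have R\<eta>: "R \<le> \<eta>" .
  have pw: "r ^ (2 * e + 1) = r ^ e * r ^ (e + 1)"
    by (simp only: power_add[symmetric]) (simp add: mult_2)
  have t1: "c1 * r ^ (2 * e + 1) \<le> r ^ e * R / 2"
  proof -
    have "c1 * r ^ (2 * e + 1) = r ^ e * (r ^ (e + 1) * c1)" by (simp only: pw) (simp only: mult_ac)
    also have "\<dots> \<le> r ^ e * (r ^ (e + 1) * (L / 2))"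
      by (intro mult_left_mono) (use r in \<open>auto simp: L_def\<close>)
    finally show ?thesis by (simp add: R_def)
  qed
  have t2: "c2 * r ^ (2 * e + 1) * R \<le> r ^ e * R / 4"
  proof -
    have "c2 * r ^ (2 * e + 1) * R = (r ^ e * R) * (r ^ (e + 1) * c2)" by (simp only: pw) (simp only: mult_ac)
    also have "\<dots> \<le> (r ^ e * R) * (r * c2)"
      by (intro mult_left_mono mult_right_mono e1) (use r R0 assms in auto)
    also have "\<dots> \<le> (r ^ e * R) * (1 / 4)"
      by (intro mult_left_mono) (use *[of "4 * c2"] L r R0 in \<open>auto simp: Z_def\<close>)
    finally show ?thesis by simp
  qed
  have t3: "c3 * R\<^sup>2 \<le> r ^ e * R / 4"
  proof -
    have "c3 * R\<^sup>2 = (r ^ e * R) * (r * (c3 * L))"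
      by (simp add: R_def power2_eq_square mult_ac)
    also have "\<dots> \<le> (r ^ e * R) * (1 / 4)"
      by (intro mult_left_mono) (use *[of "4 * c3 * L"] L r R0 assms in \<open>auto simp: Z_def\<close>)
    finally show ?thesis by simp
  qed
  show ?thesis
    using that[OF r(1,2) R0 R\<eta>] t1 t2 t3 by linarith
qed

lemma nth_deriv_bound:
  fixes F :: "('w::finite, complex) mfps"
  assumes F: "\<And>l. norm (mfps_nth F l) \<le> K * C ^ mdeg l" and C: "0 \<le> C"
  shows "norm (mfps_nth (mfps_deriv w F) l) \<le> K * C * (2 * C) ^ mdeg l"
proof -
  have "l $ w + 1 \<le> 2 ^ mdeg l"
    using le_mdeg[of l w] less_exp[of "mdeg l"] by linarith
  then have "real (l $ w + 1) \<le> 2 ^ mdeg l"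
    by (metis of_nat_le_iff of_nat_numeral of_nat_power)
  moreover have "mfps_nth (mfps_deriv w F) l = of_nat (l $ w + 1) * mfps_nth F (l + axis w 1)"
    by (simp add: mfps_deriv_def)
  ultimately have "norm (mfps_nth (mfps_deriv w F) l) \<le> 2 ^ mdeg l * (K * C ^ mdeg (l + axis w 1))"
    unfolding norm_mult norm_of_nat by (simp only: norm_mult norm_of_nat) (intro mult_mono F, auto)
  then show ?thesis by (simp add: power_mult_distrib mult_ac)
qed

lemma (in bigrading) part_free_of:
  assumes "free_of i F"
  shows "part (0, w) F = hom_part w (mfps_nth F) a"
  unfolding part_def hom_part_def
  by (rule sum.mono_neutral_left) (use assms in \<open>auto simp: grade_def wt_def free_of_def\<close>)

lemma (in bigrading) hom_part_eq_sum_part: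
  "hom_part n (mfps_nth F) a = (\<Sum>j\<le>n. part (j, n + M * j) F)"
proof -
  have "hom_part n (mfps_nth F) a =
      (\<Sum>j\<le>n. \<Sum>k\<in>{k \<in> {k. mdeg k = n}. k $ i = j}. mfps_nth F k * mpow (($) a) k)"
    unfolding hom_part_def by (rule sum.group[symmetric]) (use le_mdeg[of _ i] in auto)
  also have "\<dots> = (\<Sum>j\<le>n. part (j, n + M * j) F)"
    unfolding part_def by (intro sum.cong) (auto simp: grade_def wt_def)
  finally show ?thesis .
qed

text \<open>
  Undoing the substitution: in total degree \<open>n\<close> the powers of \<open>t\<close> that occur are at most \<open>(M + 1) n\<close>, so the bound
  stays geometric.
\<close>
lemma (in bigrading) hom_part_bound_of_nrm:
  assumes r: "0 < r" "r \<le> 1" and nrm: "\<And>D. nrm r D F \<le> U" and U: "0 \<le> U"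
  shows "norm (hom_part n (mfps_nth F) a) \<le> (max 1 U * (2 * (1 / r) ^ (M + 1))) ^ (n + 1)"
proof -
  let ?\<rho> = "(1 / r) ^ (M + 1)"
  have \<rho>: "1 \<le> ?\<rho>" using r by (intro one_le_power) auto
  have "norm (part (j, n + M * j) F) \<le> U * ?\<rho> ^ n" if "j \<le> n" for j
  proof -
    have le: "n + M * j \<le> (M + 1) * n" using that by simp
    have "norm (part (j, n + M * j) F) * r ^ (n + M * j) \<le> nrm r (n + M * j) F"
      unfolding nrm_def
      using member_le_sum[of "(j, n + M * j)" "{p. fst p \<le> snd p \<and> snd p \<le> n + M * j}" "\<lambda>p. norm (part p F) * r ^ snd p"] r that
      by simp
    also have "\<dots> \<le> U" by (rule nrm)
    finally have "norm (part (j, n + M * j) F) \<le> U * (1 / r) ^ (n + M * j)"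
      using r by (simp add: power_divide field_simps)
    also have "\<dots> \<le> U * (1 / r) ^ ((M + 1) * n)"
      by (intro mult_left_mono power_increasing U le) (use r in auto)
    finally show ?thesis by (simp only: power_mult)
  qed
  then have "norm (hom_part n (mfps_nth F) a) \<le> (\<Sum>j\<le>n. U * ?\<rho> ^ n)"
    unfolding hom_part_eq_sum_part by (intro sum_norm_le) auto
  also have "\<dots> = (real n + 1) * (U * ?\<rho> ^ n)" by (simp add: add.commute)
  also have "\<dots> \<le> 2 ^ (n + 1) * (max 1 U ^ (n + 1) * ?\<rho> ^ (n + 1))"
  proof (intro mult_mono)
    show "real n + 1 \<le> 2 ^ (n + 1)"
      using of_nat_less_two_power[of "n + 1", where 'a = real] by (simp add: add.commute)
    show "U \<le> max 1 U ^ (n + 1)" using self_le_power[of "max 1 U" "n + 1"] by simp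
    show "?\<rho> ^ n \<le> ?\<rho> ^ (n + 1)" by (rule power_increasing[OF _ \<rho>]) simp
  qed (use U \<rho> r in auto)
  also have "\<dots> = (max 1 U * (2 * ?\<rho>)) ^ (n + 1)"
    by (simp only: power_mult_distrib mult_ac)
  finally show ?thesis .
qed

text \<open>
  Tougeron's form of Newton's method. Let \<open>e\<close> bound the orders in \<open>t\<close> of \<open>det (A - j)\<close> along \<open>a\<close> for the
  finitely many \<open>j\<close> that are not large, and put \<open>N = 2e + 1\<close>. Split \<open>\<phi> = \<psi> + u\<close>, where \<open>\<psi>\<close> is the polynomial of the
  terms of \<open>\<phi>\<close> without \<open>x\<^sub>i\<close> and of degree below \<open>N\<close>; then \<open>u\<close> is divisible by the \<open>N\<close>-th power of \<open>t\<close>. Taylor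
  expansion at \<open>\<psi>\<close> gives, with \<open>D = x\<^sub>i \<partial>/\<partial>x\<^sub>i\<close>, \<open>B = \<partial>F/\<partial>y (x, \<psi>)\<close> and \<open>B0\<close> its restriction to \<open>x\<^sub>i = 0\<close>,
  
    \<open>D u - B0 u = F(x, \<psi>) + (B - B0) u + Q\<close> with \<open>Q\<close> quadratic in \<open>u\<close>.
  
  All data on the right except \<open>u\<close> converge. The first term and \<open>B - B0\<close> are divisible by the \<open>N\<close>-th power of
  \<open>t\<close>. The degree-\<open>j\<close> slice of the left-hand side is \<open>(j - B0)\<close> applied to the slice of \<open>u\<close>, and \<open>B0\<close> agrees with
  \<open>A\<close> up to order \<open>N > e\<close>, so it may be inverted with a loss of \<open>e\<close> levels and a factor \<open>r\<^bsup>-e\<^esup>\<close>. On the right \<open>u\<close> is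
  needed \<open>N\<close> levels lower. Since \<open>e < N\<close>, induction on the level bounds the norms of \<open>u\<close>.
\<close>
theorem directional_bound:
  fixes F :: "'n::finite \<Rightarrow> ('m::finite + 'n, complex) mfps" and \<phi> :: "('m, complex) mfps^'n"
    and a :: "complex^'m" and i :: 'm
  defines "A \<equiv> \<chi> b c. mfps_restrict0 i (mfps_compose (mfps_deriv (Inr c) (F b)) (case_sum mfps_X (\<lambda>b. \<phi> $ b)))"
  assumes F: "\<And>b l. norm (mfps_nth (F b) l) \<le> K * C ^ mdeg l" and C: "0 < C"
    and \<phi>0: "\<And>b. mfps_nth (\<phi> $ b) 0 = 0"
    and eq: "\<And>b. mfps_X i * mfps_deriv i (\<phi> $ b) = mfps_compose (F b) (case_sum mfps_X (\<lambda>b. \<phi> $ b))"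
    and nondeg: "\<And>j :: nat. \<exists>w. hom_part w (mfps_nth (det (A - mat (of_nat j)))) a \<noteq> 0"
  shows "\<exists>C. \<forall>b n. norm (hom_part n (mfps_nth (\<phi> $ b)) a) \<le> C ^ (n + 1)"
proof -
  let ?n = "real CARD('n)"
  \<comment> \<open>At \<open>4 * \<eta>\<close>, the argument needed for the quadratic remainder, the coefficient series of \<open>F\<close> are
      still dominated by geometric series of ratio \<open>1/2\<close>. The bounds \<open>\<gamma>\<close> of \<open>F\<close> and \<open>\<beta>\<close> of its
      derivatives depend on \<open>\<eta>\<close> only; so \<open>J\<close> and \<open>e\<close> are fixed before \<open>\<psi>\<close> and the radius.\<close>
  define \<eta> where "\<eta> = 1 / (8 * C)"
  define \<gamma> where "\<gamma> = K * 2 ^ CARD('m + 'n)"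
  define \<beta> where "\<beta> = K * C * 2 ^ CARD('m + 'n)"
  have K: "0 \<le> K" using order_trans[OF norm_ge_zero F[of _ 0]] by simp
  have \<eta>: "0 < \<eta>" "C * (4 * \<eta>) \<le> 1 / 2" "C * \<eta> \<le> 1 / 2" "(2 * C) * \<eta> \<le> 1 / 2"
    using C by (auto simp: \<eta>_def)
  have \<gamma>: "0 \<le> \<gamma>" and \<beta>: "0 \<le> \<beta>" using K C by (auto simp: \<gamma>_def \<beta>_def)
  obtain J :: nat where J: "?n * \<beta> + 1 \<le> real J" using real_arch_simple by blast
  define ej where "ej = (\<lambda>j :: nat. LEAST w. hom_part w (mfps_nth (det (A - mat (of_nat j)))) a \<noteq> 0)"
  have ej: "hom_part (ej j) (mfps_nth (det (A - mat (of_nat j)))) a \<noteq> 0"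
    "\<And>w. w < ej j \<Longrightarrow> hom_part w (mfps_nth (det (A - mat (of_nat j)))) a = 0" for j
    unfolding ej_def using LeastI_ex[OF nondeg] not_less_Least by blast+
  define e where "e = (\<Sum>j<J. ej j)"
  have e: "ej j \<le> e" if "j < J" for j
    unfolding e_def using that by (intro member_le_sum) auto
  define N where "N = 2 * e + 1"
  interpret bigrading i a "2 * e" .
  define \<psi> where "\<psi> = (\<lambda>b. Abs_mfps (\<lambda>k. if k $ i = 0 \<and> mdeg k < N then mfps_nth (\<phi> $ b) k else 0))"
  define u where "u = (\<lambda>b. \<phi> $ b - \<psi> b)"
  define G where "G = (case_sum mfps_X \<psi> :: 'm + 'n \<Rightarrow> ('m, complex) mfps)"
  define V where "V = (case_sum (\<lambda>_. 0) u :: 'm + 'n \<Rightarrow> ('m, complex) mfps)"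
  have GV: "(\<lambda>w. G w + V w) = case_sum mfps_X (\<lambda>b. \<phi> $ b)"
    by (auto simp: G_def V_def u_def fun_eq_iff split: sum.split)
  have axis0: "axis v (1::nat) \<noteq> 0" for v :: 'm
    by (metis mdeg_0 mdeg_axis zero_neq_one)
  have G0: "mfps_nth (G w) 0 = 0" and V0: "mfps_nth (V w) 0 = 0" for w
    using \<phi>0 axis0 by (auto simp: G_def V_def u_def \<psi>_def mfps_X_def eq_commute[of 0] split: sum.split)
  have ord_u: "ord_ge N (u b)" for b
  proof (rule ord_ge_I)
    fix k assume k: "wt k < N"
    have "k $ i = 0"
    proof (rule ccontr)
      assume "k $ i \<noteq> 0"
      then obtain m where "k $ i = Suc m" by (cases "k $ i") auto
      then show False using k le_mdeg[of k i] by (simp add: wt_def N_def)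
    qed
    then show "mfps_nth (u b) k = 0" using k by (simp add: u_def \<psi>_def wt_def)
  qed
  have ord_V: "ord_ge N (V w)" for w
    using ord_u by (auto simp: V_def split: sum.split)
  define E where "E = 1 + (\<Sum>w\<in>UNIV. nrm 1 N (G w))"
  have E: "0 < E" unfolding E_def by (intro add_pos_nonneg sum_nonneg nrm_nonneg) auto
  \<comment> \<open>For radii up to \<open>s\<close> the arguments \<open>x\<close> and \<open>\<psi>\<close> have norm at most \<open>\<eta>\<close>.\<close>
  define s where "s = min 1 (\<eta> / E)"
  have s: "0 < s" "s \<le> 1" using \<eta> E by (auto simp: s_def)
  have nrm_G: "nrm r D (G w) \<le> \<eta>" if "0 \<le> r" "r \<le> s" for r D w
  proof -
    have "wt k \<le> N" if "mfps_nth (G w) k \<noteq> 0" for k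
    proof (cases w)
      case (Inl v)
      then have "k = axis v 1" using that by (auto simp: G_def mfps_X_def split: if_splits)
      moreover have "axis v (1::nat) $ i \<le> 1" by (simp add: axis_def)
      ultimately show ?thesis by (simp add: wt_def N_def)
    next
      case (Inr b)
      then show ?thesis using that by (auto simp: G_def \<psi>_def wt_def split: if_splits)
    qed
    then have "nrm r D (G w) \<le> r * nrm 1 N (G w)"
      by (intro nrm_polynomial_le G0) (use that s in auto)
    also have "\<dots> \<le> (\<eta> / E) * E"
    proof (intro mult_mono)
      show "r \<le> \<eta> / E" using that by (simp add: s_def)
      have "nrm 1 N (G w) \<le> (\<Sum>w\<in>UNIV. nrm 1 N (G w))"
        by (rule member_le_sum) (auto intro: nrm_nonneg)
      then show "nrm 1 N (G w) \<le> E" by (simp add: E_def)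
    qed (use \<eta> E in \<open>auto intro: nrm_nonneg\<close>)
    finally show ?thesis using E by simp
  qed
  define B where "B = (\<lambda>b c. mfps_compose (mfps_deriv (Inr c) (F b)) G)"
  define B0 where "B0 = (\<chi> b c. mfps_slice i 0 (B b c))"
  have nrm_B: "nrm s D (B b c) \<le> \<beta>" for D b c
    unfolding B_def \<beta>_def
    by (rule nrm_compose_le[OF G0 nth_deriv_bound[OF F], where \<eta> = \<eta>]) (use s C \<eta> nrm_G in auto)
  have free_A: "free_of i (A $ b $ c)" and free_B0: "free_of i (B0 $ b $ c)" for b c
    by (auto simp: A_def B0_def mfps_restrict0_eq_slice)
  have det_B0: "part (0, w) (det (B0 - mat (of_nat j))) = hom_part w (mfps_nth (det (A - mat (of_nat j)))) a"
    if "w < N" for w j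
  proof -
    have "ord_ge N (det (A - mat (of_nat j)) - det (B0 - mat (of_nat j)))"
    proof (rule ord_ge_det_diff)
      fix b c
      have "ord_ge N (mfps_slice i 0 (mfps_compose (mfps_deriv (Inr c) (F b)) (\<lambda>w. G w + V w) - B b c))"
        unfolding B_def by (intro ord_ge_slice ord_ge_compose_diff G0 V0 ord_V)
      then show "ord_ge N ((A - mat (of_nat j)) $ b $ c - (B0 - mat (of_nat j)) $ b $ c)"
        by (simp add: A_def B0_def mfps_restrict0_eq_slice mfps_slice_diff GV)
    qed
    then have "part (0, w) (det (B0 - mat (of_nat j))) = part (0, w) (det (A - mat (of_nat j)))"
      using that by (simp add: ord_ge_def part_diff)
    also have "\<dots> = hom_part w (mfps_nth (det (A - mat (of_nat j)))) a"
      by (rule part_free_of[OF free_of_det_minus_mat[OF free_A]])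
    finally show ?thesis .
  qed
  have "\<exists>K s'. 1 \<le> K \<and> 0 < s' \<and> s' \<le> s \<and> (\<forall>j r D v h. 0 < r \<longrightarrow> r \<le> s' \<longrightarrow>
      (\<forall>b. of_nat j * v $ b - (\<Sum>c\<in>UNIV. B0 $ b $ c * v $ c) = h $ b) \<longrightarrow>
      r ^ e * (\<Sum>b\<in>UNIV. nrm r D (v $ b)) \<le> K * (\<Sum>b\<in>UNIV. nrm r (D + e) (h $ b)))"
  proof (rule linear_system_estimate[OF free_B0 s _ J])
    show "nrm s D (B0 $ b $ c) \<le> \<beta>" for D b c
      using nrm_slice_le[of s D 0 "B b c"] nrm_B[of D b c] s by (simp add: B0_def)
    fix j assume "j < J"
    then have "ej j \<le> e" "ej j < N" using e[of j] by (auto simp: N_def)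
    then show "\<exists>e'\<le>e. (\<forall>w<e'. part (0, w) (det (B0 - mat (of_nat j))) = 0) \<and>
        part (0, e') (det (B0 - mat (of_nat j))) \<noteq> 0"
      using ej(1)[of j] ej(2)[of _ j] det_B0[of _ j] by (intro exI[of _ "ej j"]) auto
  qed
  then obtain K1 s' where K1: "1 \<le> K1" and s': "0 < s'" "s' \<le> s" and
    linear: "\<And>j r D v h. 0 < r \<Longrightarrow> r \<le> s' \<Longrightarrow>
      (\<And>b. of_nat j * v $ b - (\<Sum>c\<in>UNIV. B0 $ b $ c * v $ c) = h $ b) \<Longrightarrow>
      r ^ e * (\<Sum>b\<in>UNIV. nrm r D (v $ b)) \<le> K1 * (\<Sum>b\<in>UNIV. nrm r (D + e) (h $ b))"
    by blast
  define g where "g = (\<lambda>b. mfps_compose (F b) G)"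
  define Q where "Q = (\<lambda>b. compose_rem (F b) G V)"
  define h where "h = (\<lambda>b. g b + (\<Sum>c\<in>UNIV. (B b c - mfps_slice i 0 (B b c)) * u c) + Q b)"
  have euler_u: "mfps_X i * mfps_deriv i (u b) = g b + (\<Sum>c\<in>UNIV. B b c * u c) + Q b" for b
  proof -
    have "mfps_X i * mfps_deriv i (u b) = mfps_X i * mfps_deriv i (\<phi> $ b)"
      by (rule mfps_eqI) (auto simp: mfps_nth_euler u_def \<psi>_def)
    also have "\<dots> = mfps_compose (F b) (\<lambda>w. G w + V w)" by (simp add: eq GV)
    also have "\<dots> = g b + (\<Sum>w\<in>UNIV. mfps_compose (mfps_deriv w (F b)) G * V w) + Q b"
      by (simp add: Q_def g_def compose_rem_def)
    also have "(\<Sum>w\<in>UNIV. mfps_compose (mfps_deriv w (F b)) G * V w) = (\<Sum>c\<in>UNIV. B b c * u c)"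
      by (subst UNIV_Plus_UNIV[symmetric], subst sum.Plus) (auto simp: V_def B_def)
    finally show ?thesis .
  qed
  have euler_h: "mfps_X i * mfps_deriv i (u b) - (\<Sum>c\<in>UNIV. B0 $ b $ c * u c) = h b" for b
    unfolding euler_u h_def by (simp add: B0_def left_diff_distrib sum_subtractf)
  have slice_h: "of_nat j * mfps_slice i j (u b) - (\<Sum>c\<in>UNIV. B0 $ b $ c * mfps_slice i j (u c)) = mfps_slice i j (h b)"
    for j b
  proof -
    have "of_nat j * mfps_slice i j (u b) = mfps_slice i j (mfps_X i * mfps_deriv i (u b))"
      by (rule mfps_eqI) (simp add: of_nat_mult_eq_smult mfps_nth_euler)
    then show ?thesis
      unfolding euler_h[symmetric]
      by (simp add: mfps_slice_diff mfps_slice_sum mfps_slice_mult[OF free_B0])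
  qed
  \<comment> \<open>Solved for \<open>g b\<close>, the equation shows that \<open>\<psi>\<close> is an approximate solution.\<close>
  have ord_g: "ord_ge N (g b)" for b
  proof -
    have "g b = mfps_X i * mfps_deriv i (u b) - (\<Sum>c\<in>UNIV. B b c * u c) - Q b"
      by (simp add: euler_u)
    also have "ord_ge N \<dots>"
      unfolding Q_def
      by (intro ord_ge_diff ord_ge_euler ord_ge_sum ord_ge_mult_right ord_u ord_ge_compose_rem G0 V0 ord_V)
    finally show ?thesis .
  qed
  define c1 where "c1 = K1 * ?n * \<gamma> / s ^ N"
  define c2 where "c2 = K1 * ?n * \<beta> / s ^ N"
  define c3 where "c3 = K1 * ?n * \<gamma> / \<eta>\<^sup>2"
  obtain r R where r: "0 < r" "r \<le> s'" and R: "0 \<le> R" "R \<le> \<eta>" and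
    rR: "c1 * r ^ (2 * e + 1) + c2 * r ^ (2 * e + 1) * R + c3 * R\<^sup>2 \<le> r ^ e * R"
    by (rule small_radius[of c1 c2 c3 \<eta> s' e]) (use K1 \<gamma> \<beta> \<eta> s s' in \<open>auto simp: c1_def c2_def c3_def\<close>)
  have rs: "0 \<le> r" "r \<le> s" "r \<le> 1" using r s s' by auto
  have main: "(\<Sum>b\<in>UNIV. nrm r D (u b)) \<le> R" for D
  proof (induction D rule: less_induct)
    case (less D)
    show ?case
    proof (cases "D < N")
      case True
      then show ?thesis using nrm_ord_ge_eq_0[OF ord_u] R by simp
    next
      case False
      define D' where "D' = D - e - 1"
      have D': "D' < D" "D + e = D' + N" using False by (auto simp: D'_def N_def)
      have IH: "(\<Sum>c\<in>UNIV. nrm r D' (u c)) \<le> R" by (rule less.IH[OF D'(1)])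
      have IH1: "nrm r D' (u c) \<le> R" for c
        using member_le_sum[of c UNIV "\<lambda>c. nrm r D' (u c)"] IH nrm_nonneg[OF rs(1)] by fastforce
      have h: "nrm r (D' + N) (h b) \<le> (r / s) ^ N * \<gamma> + (r / s) ^ N * \<beta> * R + \<gamma> * (R / \<eta>)\<^sup>2" for b
      proof -
        have "nrm r (D' + N) (g b) \<le> (r / s) ^ N * nrm s (D' + N) (g b)"
          by (rule nrm_scale[OF ord_g rs(1,2) s(1)])
        also have "nrm s (D' + N) (g b) \<le> \<gamma>"
          unfolding g_def \<gamma>_def by (rule nrm_compose_le[OF G0 F, where \<eta> = \<eta>]) (use s C \<eta> nrm_G in auto)
        finally have 1: "nrm r (D' + N) (g b) \<le> (r / s) ^ N * \<gamma>"
          using rs s by (simp add: mult_left_mono)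
        have "nrm r (D' + N) (\<Sum>c\<in>UNIV. (B b c - mfps_slice i 0 (B b c)) * u c) \<le>
            (\<Sum>c\<in>UNIV. (r / s) ^ N * \<beta> * nrm r D' (u c))"
        proof (rule order_trans[OF nrm_sum_le[OF rs(1)] sum_mono])
          fix c
          let ?B1 = "B b c - mfps_slice i 0 (B b c)"
          have ord_B1: "ord_ge N ?B1" unfolding N_def by (rule ord_ge_off_slice_0)
          have "nrm r (D' + N) (?B1 * u c) \<le> nrm r (D' + N - 0) ?B1 * nrm r (D' + N - N) (u c)"
            by (rule nrm_mult_le[OF rs(1) ord_B1 ord_ge_0_left])
          also have "nrm r (D' + N - 0) ?B1 \<le> (r / s) ^ N * nrm s (D' + N) ?B1"
            unfolding diff_zero by (rule nrm_scale[OF ord_B1 rs(1,2) s(1)])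
          also have "nrm s (D' + N) ?B1 \<le> \<beta>"
            using nrm_off_slice_0_le[of s "D' + N" "B b c"] nrm_B[of "D' + N" b c] s by simp
          finally show "nrm r (D' + N) (?B1 * u c) \<le> (r / s) ^ N * \<beta> * nrm r D' (u c)"
            using rs s nrm_nonneg[OF rs(1)] by (simp add: mult_left_mono mult_right_mono)
        qed
        also have "\<dots> = (r / s) ^ N * \<beta> * (\<Sum>c\<in>UNIV. nrm r D' (u c))"
          by (simp add: sum_distrib_left)
        also have "\<dots> \<le> (r / s) ^ N * \<beta> * R"
          by (intro mult_left_mono IH) (use rs s \<beta> in auto)
        finally have 2: "nrm r (D' + N) (\<Sum>c\<in>UNIV. (B b c - mfps_slice i 0 (B b c)) * u c) \<le> (r / s) ^ N * \<beta> * R" .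
        have 3: "nrm r (D' + N) (Q b) \<le> \<gamma> * (R / \<eta>)\<^sup>2"
          unfolding Q_def \<gamma>_def
        proof (rule nrm_compose_rem_le[OF G0 V0 F rs(1) _ _ \<eta>(2) \<eta>(1) _ R(2) ord_V])
          show "nrm r D' (V w) \<le> R" for w using IH1 R by (auto simp: V_def split: sum.split)
        qed (use C nrm_G rs in auto)
        have "nrm r (D' + N) (h b) \<le> nrm r (D' + N) (g b) +
            nrm r (D' + N) (\<Sum>c\<in>UNIV. (B b c - mfps_slice i 0 (B b c)) * u c) + nrm r (D' + N) (Q b)"
          unfolding h_def by (intro order_trans[OF nrm_add_le] add_right_mono nrm_add_le rs(1))
        then show ?thesis using 1 2 3 by linarith
      qed
      have "r ^ e * (\<Sum>b\<in>UNIV. nrm r D (u b)) \<le> r ^ e * (\<Sum>b\<in>UNIV. \<Sum>j\<le>D. nrm r D (mfps_slice i j (u b)))"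
        by (intro mult_left_mono sum_mono nrm_le_sum_slice) (use rs in auto)
      also have "\<dots> = (\<Sum>j\<le>D. r ^ e * (\<Sum>b\<in>UNIV. nrm r D (mfps_slice i j (u b))))"
        by (subst sum.swap) (simp add: sum_distrib_left)
      also have "\<dots> \<le> (\<Sum>j\<le>D. K1 * (\<Sum>b\<in>UNIV. nrm r (D + e) (mfps_slice i j (h b))))"
      proof (rule sum_mono)
        fix j
        show "r ^ e * (\<Sum>b\<in>UNIV. nrm r D (mfps_slice i j (u b))) \<le>
            K1 * (\<Sum>b\<in>UNIV. nrm r (D + e) (mfps_slice i j (h b)))"
          using linear[OF r, of j "\<chi> b. mfps_slice i j (u b)" "\<chi> b. mfps_slice i j (h b)" D] slice_h by simp
      qed
      also have "\<dots> = K1 * (\<Sum>b\<in>UNIV. \<Sum>j\<le>D. nrm r (D + e) (mfps_slice i j (h b)))"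
        by (subst sum.swap) (simp add: sum_distrib_left)
      also have "\<dots> \<le> K1 * (\<Sum>b\<in>UNIV. nrm r (D' + N) (h b))"
        unfolding D'(2) by (intro mult_left_mono sum_mono sum_nrm_slice_le) (use rs K1 in auto)
      also have "\<dots> \<le> K1 * (\<Sum>b\<in>(UNIV :: 'n set). (r / s) ^ N * \<gamma> + (r / s) ^ N * \<beta> * R + \<gamma> * (R / \<eta>)\<^sup>2)"
        by (intro mult_left_mono sum_mono h) (use K1 in auto)
      also have "\<dots> = c1 * r ^ (2 * e + 1) + c2 * r ^ (2 * e + 1) * R + c3 * R\<^sup>2"
        by (simp only: c1_def c2_def c3_def N_def[symmetric] sum_constant power_divide)
           (simp add: algebra_simps add_divide_distrib)
      also have "\<dots> \<le> r ^ e * R" by (rule rR)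
      finally show ?thesis using r by simp
    qed
  qed
  have "nrm r D (\<phi> $ b) \<le> 2 * \<eta>" for D b
  proof -
    have "nrm r D (\<phi> $ b) \<le> nrm r D (G (Inr b)) + nrm r D (u b)"
      using nrm_add_le[OF rs(1), of D "\<psi> b" "u b"] by (simp add: G_def u_def)
    moreover have "nrm r D (u b) \<le> (\<Sum>b\<in>UNIV. nrm r D (u b))"
      by (rule member_le_sum) (use nrm_nonneg[OF rs(1)] in auto)
    ultimately show ?thesis
      using nrm_G[OF rs(1,2), of D "Inr b"] main[of D] R by linarith
  qed
  then have "norm (hom_part n (mfps_nth (\<phi> $ b)) a) \<le> (max 1 (2 * \<eta>) * (2 * (1 / r) ^ (2 * e + 1))) ^ (n + 1)" for b n
    by (intro hom_part_bound_of_nrm) (use r rs \<eta> in auto)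
  then show ?thesis by blast
qed

section \<open>Convergence of the formal solution\<close>

text \<open>
  Hence substituting the formal solution into a partial derivative of \<open>f\<close> is the same as substituting it into
  the formal derivative of the Taylor series of \<open>f\<close>.
\<close>
lemma taylor_partial_deriv:
  assumes "pseries C g (mfps_nth (taylor g))"
  shows "taylor (partial_deriv w g) = mfps_deriv w (taylor g)"
  using taylor_pseries[OF pseries_partial_deriv[OF assms]]
  by (intro mfps_eqI) (simp add: mfps_deriv_def)

theorem theorem1:
  fixes f :: "'m::finite \<Rightarrow> complex^('m + 'n::finite) \<Rightarrow> complex^'n"
    and p :: "'m \<Rightarrow> nat"
    and i1 :: 'm
    and \<phi> :: "('m, complex) mfps^'n"
    and A :: "('m, complex) mfps^'n^'n"
  assumes "\<And>i. p i \<ge> 1"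
    and "p i1 = 1"
    and "\<And>i. holomorphic_near_0 (f i)"
    and "\<And>i. f i 0 = 0"
    and "formal_solution p f \<phi>"
    and "A = (\<chi> a b. mfps_restrict0 i1 (jacobian_y (f i1) \<phi> $ a $ b))"
    and "\<And>j :: nat. det (A - mat (of_nat j)) \<noteq> 0"
  shows "\<forall>b. mfps_convergent (\<phi> $ b)"
proof
  fix b0
  from holomorphic_near_0_sep_holo[OF assms(3)[of i1]] obtain r M where
    r: "r > 0" and sep: "\<And>b. sep_holo r M (\<lambda>z. f i1 z $ b)" by blast
  define F where "F = (\<lambda>b. taylor (\<lambda>z. f i1 z $ b))"
  have F: "norm (mfps_nth (F b) l) \<le> M * (1 / r) ^ mdeg l" for b l
    using osgood(2)[OF sep r, of b l] by (simp add: F_def power_divide)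
  have A: "A = (\<chi> b c. mfps_restrict0 i1 (mfps_compose (mfps_deriv (Inr c) (F b)) (case_sum mfps_X (\<lambda>b. \<phi> $ b))))"
    unfolding assms(6) jacobian_y_def subst_y_def F_def
    by (simp add: taylor_partial_deriv[OF osgood(1)[OF sep r]])
  have eq: "mfps_X i1 * mfps_deriv i1 (\<phi> $ b) = mfps_compose (F b) (case_sum mfps_X (\<lambda>b. \<phi> $ b))" for b
  proof -
    have "mfps_X i1 ^ p i1 * mfps_deriv i1 (\<phi> $ b) = subst_y (\<lambda>z. f i1 z $ b) \<phi>"
      using assms(5) unfolding formal_solution_def by blast
    then show ?thesis unfolding assms(2) power_one_right subst_y_def F_def .
  qed
  have \<phi>0: "mfps_nth (\<phi> $ b) 0 = 0" for b
    using assms(5) by (simp add: formal_solution_def)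
  have "\<exists>k. mfps_nth (det (A - mat (of_nat j))) k \<noteq> 0" for j :: nat
    using assms(7)[of j] by (auto simp: mfps_eq_iff)
  \<comment> \<open>A non-zero coefficient of the \<open>j\<close>-th determinant singles out a homogeneous part of it, whose zeros are
      the excluded directions.\<close>
  then obtain k where k: "\<And>j :: nat. mfps_nth (det (A - mat (of_nat j))) (k j) \<noteq> 0"
    by metis
  have "\<exists>C. \<forall>l. norm (mfps_nth (\<phi> $ b0) l) \<le> C ^ (mdeg l + 1)"
  proof (rule coeff_bound_if_generic_bound)
    show "\<exists>l. mdeg l = mdeg (k j) \<and> mfps_nth (det (A - mat (of_nat j))) l \<noteq> 0" for j
      using k by blast
    fix a :: "complex^'m"
    assume "\<And>j. hom_part (mdeg (k j)) (mfps_nth (det (A - mat (of_nat j)))) a \<noteq> 0"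
    then have "\<exists>w. hom_part w (mfps_nth (det (A - mat (of_nat j)))) a \<noteq> 0" for j :: nat
      by blast
    from directional_bound[where F = F and \<phi> = \<phi> and i = i1 and a = a, folded A, OF F _ \<phi>0 eq this]
    show "\<exists>C. \<forall>n. norm (hom_part n (mfps_nth (\<phi> $ b0)) a) \<le> C ^ (n + 1)"
      using r by auto
  qed
  then show "mfps_convergent (\<phi> $ b0)"
    using mfps_convergentI by blast
qed

end
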